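(* Let $\mathcal K$ be a 2-category. The following assignment is a 2-functor $\mathcal T:{}_\psi\mathrm{Bimnd}(\mathcal K)\to\mathrm{Cat}$: a 0-cell $(\mathcal A,F,B,\psi_{B,F})$ is sent to the category ${}^F_B\mathcal K$; a 1-cell $(X,\psi_{F,X},\phi_{X,F},\psi_{B,X}):(\mathcal A,F,B,\psi_{B,F})\to(\mathcal A',F',B',\psi_{B',F'})$ is sent to the functor $\mathcal T_X:{}^F_B\mathcal K\to{}^{F'}_{B'}\mathcal K$, $M\mapsto XM$, $f\mapsto X\times f$, where $XM$ has left $B'$-action $(X\times\nu_M)(\psi_{B,X}\times M)$ and left $F'$-coaction $(\phi_{X,F}\times M)(X\times\lambda_M)$; a 2-cell $\zeta$ is sent to the natural transformation $\mathcal T_\zeta$ with $\mathcal T_\zeta(M)=\zeta\times M$. Moreover, fixing a 0-cell $(\mathcal A,F,B,\psi_{B,F})$, the induced monoidal functor ${}_\psi\mathrm{Bimnd}(\mathcal K)(F,F)\to\mathrm{Fun}({}^F_B\mathcal K,{}^F_B\mathcal K)$ corresponds to the action of categories ${}_{\psi_B}{}^F_F\mathcal{YD}_s(\mathcal K,\mathcal A)\times{}^F_B\mathcal K\to{}^F_B\mathcal K$, $(X,M)\mapsto XM$, with $XM$ a left $F$-comodule by $(\phi_{X,F}\times M)(X\times\lambda_M)$ and a left $B$-module by $(X\times\nu_M)(\psi_{B,X}\times M)$.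
   Context: Conventions: 1-cells are composed by juxtaposition, $\times$ is horizontal and $\circ$ (or juxtaposition) vertical composition of 2-cells; a 1-cell in a formula stands for its identity 2-cell. $\mathrm{Mnd}(\mathcal K)$: 0-cells monads $(\mathcal A,B)$; 1-cells $(X,\psi):(\mathcal A,B)\to(\mathcal A',B')$ with $X:\mathcal A\to\mathcal A'$, $\psi:B'X\to XB$, $\psi(\mu_{B'}\times X)=(X\times\mu_B)(\psi\times B)(B'\times\psi)$, $\psi(\eta_{B'}\times X)=X\times\eta_B$; 2-cells $\zeta:X\to Y$ with $(\zeta\times B)\psi=\psi'(B'\times\zeta)$. $\mathrm{Comnd}(\mathcal K)$: 0-cells comonads; 1-cells $(X,\phi)$, $\phi:XF\to F'X$ with $(\Delta'\times X)\phi=(F'\times\phi)(\phi\times F)(X\times\Delta)$, $(\varepsilon'\times X)\phi=X\times\varepsilon$; 2-cells $\zeta$ with $(F'\times\zeta)\phi=\phi'(\zeta\times F)$. A bimonad $(\mathcal A,F,\mu,\eta,\Delta,\varepsilon,\lambda)$: $(F,\mu,\eta)$ a monad, $(F,\Delta,\varepsilon)$ a comonad, $\lambda:FF\to FF$ with $(F,\lambda)$ a 1-cell in $\mathrm{Mnd}(\mathcal K)$ and in $\mathrm{Comnd}(\mathcal K)$, $\Delta\mu=(F\times\mu)(\lambda\times F)(F\times\Delta)$, $\varepsilon\mu=\varepsilon\times\varepsilon$, $\Delta\eta=\eta\times\eta$, $\varepsilon\eta=\mathrm{Id}$. $\mathrm{Bimnd}(\mathcal K)$: 0-cells bimonads;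 1-cells $(X,\psi,\phi)$ with $(X,\psi)$ a 1-cell in $\mathrm{Mnd}(\mathcal K)$, $(X,\phi)$ a 1-cell in $\mathrm{Comnd}(\mathcal K)$ and $(\phi\times F)(X\times\lambda)(\psi\times F)=(F'\times\psi)(\lambda'\times X)(F'\times\phi)$; 2-cells are simultaneously 2-cells of $\mathrm{Mnd}(\mathcal K)$ and $\mathrm{Comnd}(\mathcal K)$. The 2-category ${}_\psi\mathrm{Bimnd}(\mathcal K)$ of Tambara bimonads: 0-cells $(\mathcal A,F,B,\psi_{B,F})$ with $(\mathcal A,F)$ a bimonad, $(\mathcal A,B)$ a monad, $(F,\psi_{B,F})$ a 1-cell $(\mathcal A,B)\to(\mathcal A,B)$ of $\mathrm{Mnd}(\mathcal K)$; 1-cells $(X,\psi_{F,X},\phi_{X,F},\psi_{B,X})$ with $(X,\psi_{F,X},\phi_{X,F})$ a 1-cell of $\mathrm{Bimnd}(\mathcal K)$ from $F$ to $F'$ and $(X,\psi_{B,X})$ a 1-cell of $\mathrm{Mnd}(\mathcal K)$ from $B$ to $B'$, such that $(X\times\psi_{B,F})(\psi_{B,X}\times F)(B'\times\psi_{F,X})=(\psi_{F,X}\times B)(F'\times\psi_{B,X})(\psi_{B',F'}\times X)$ and $(F'\times\psi_{B,X})(\psi_{B',F'}\times X)(B'\times\phi_{X,F})=(\phi_{X,F}\times B)(X\times\psi_{B,F})(\psi_{B,X}\times F)$; 2-cells are 2-cells of $\mathrm{Bimnd}(\mathcal K)$ that are also 2-cells $(X,\psi_{B,X})\to(Y,\psi_{B,Y})$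 of $\mathrm{Mnd}(\mathcal K)$. Composition of 1-cells: $YX$ with $\psi_{-,YX}=(Y\times\psi_{-,X})(\psi_{-,Y}\times X)$, $\phi_{YX}=(\phi_Y\times X)(Y\times\phi_X)$. Its category of 1-endocells on $(\mathcal A,F,B,\psi_{B,F})$ is the monoidal category ${}_{\psi_B}{}^F_F\mathcal{YD}_s(\mathcal K,\mathcal A)$ (strong Yetter–Drinfel'd modules over $F$ with compatible $\psi_{B,X}$). ${}^F_B\mathcal K$ (left relative $(F,B)$-modules): 1-cells $M:\mathcal D\to\mathcal A$ (any 0-cell $\mathcal D$) that are left $F$-comodules $(M,\lambda_M)$ and left $B$-modules $(M,\nu_M)$ with $\lambda_M\nu_M=(F\times\nu_M)(\psi_{B,F}\times M)(B\times\lambda_M)$; morphisms are left $F$-colinear, left $B$-linear 2-cells. $\mathrm{Cat}$ is the 2-category of categories. *)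

theory Defs
  imports Main "HOL-Library.FuncSet"
begin

section \<open>Strict 2-categories and 2-functors\<close>

text \<open>
  \<open>Y \<cdot> X\<close> is the 1-cell "first \<open>X\<close>, then \<open>Y\<close>", written \<open>YX\<close> by juxtaposition;
  \<open>\<star>\<close> is horizontal composition (written \<open>\<times>\<close> on paper) and \<open>\<odot>\<close> vertical composition of 2-cells.
  Whiskering \<open>X \<rhd> \<alpha>\<close>, \<open>\<alpha> \<lhd> X\<close> is horizontal composition with an identity 2-cell.
  Operations are only meaningful on cells of the carriers and on composable arguments.
\<close>

record ('o, 'm, 'c) twocat =
  Cell0 :: "'o set"
  Cell1 :: "'m set"
  Cell2 :: "'c set"
  Src1  :: "'m \<Rightarrow> 'o"
  Tgt1  :: "'m \<Rightarrow> 'o"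
  Src2  :: "'c \<Rightarrow> 'm"
  Tgt2  :: "'c \<Rightarrow> 'm"
  Id1   :: "'o \<Rightarrow> 'm"
  Id2   :: "'m \<Rightarrow> 'c"
  Comp1 :: "'m \<Rightarrow> 'm \<Rightarrow> 'm"  (infixl "\<cdot>\<index>" 80)
  HComp :: "'c \<Rightarrow> 'c \<Rightarrow> 'c"  (infixl "\<star>\<index>" 75)
  VComp :: "'c \<Rightarrow> 'c \<Rightarrow> 'c"  (infixl "\<odot>\<index>" 70)

abbreviation lwhisk :: "('o, 'm, 'c) twocat \<Rightarrow> 'm \<Rightarrow> 'c \<Rightarrow> 'c"  (infix "\<rhd>\<index>" 75)
  where "lwhisk K X \<alpha> \<equiv> HComp K (Id2 K X) \<alpha>"

abbreviation rwhisk :: "('o, 'm, 'c) twocat \<Rightarrow> 'c \<Rightarrow> 'm \<Rightarrow> 'c"  (infix "\<lhd>\<index>" 75)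
  where "rwhisk K \<alpha> X \<equiv> HComp K \<alpha> (Id2 K X)"

definition hom1 :: "('o, 'm, 'c) twocat \<Rightarrow> 'o \<Rightarrow> 'o \<Rightarrow> 'm set"
  where "hom1 K a b = {X \<in> Cell1 K. Src1 K X = a \<and> Tgt1 K X = b}"

definition hom2 :: "('o, 'm, 'c) twocat \<Rightarrow> 'm \<Rightarrow> 'm \<Rightarrow> 'c set"
  where "hom2 K X Y = {\<alpha> \<in> Cell2 K. Src2 K \<alpha> = X \<and> Tgt2 K \<alpha> = Y}"

locale two_category =
  fixes K :: "('o, 'm, 'c) twocat" (structure)
  assumes cell1_ends: "X \<in> Cell1 K \<Longrightarrow> Src1 K X \<in> Cell0 K \<and> Tgt1 K X \<in> Cell0 K"
    and cell2_ends: "\<alpha> \<in> Cell2 K \<Longrightarrow> Src2 K \<alpha> \<in> Cell1 K \<and> Tgt2 K \<alpha> \<in> Cell1 K"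
    and cell2_parallel: "\<alpha> \<in> Cell2 K \<Longrightarrow>
          Src1 K (Src2 K \<alpha>) = Src1 K (Tgt2 K \<alpha>) \<and> Tgt1 K (Src2 K \<alpha>) = Tgt1 K (Tgt2 K \<alpha>)"
    and id1: "a \<in> Cell0 K \<Longrightarrow> Id1 K a \<in> hom1 K a a"
    and comp1: "\<lbrakk>X \<in> hom1 K a b; Y \<in> hom1 K b c\<rbrakk> \<Longrightarrow> Y \<cdot> X \<in> hom1 K a c"
    and comp1_id_left: "X \<in> hom1 K a b \<Longrightarrow> Id1 K b \<cdot> X = X"
    and comp1_id_right: "X \<in> hom1 K a b \<Longrightarrow> X \<cdot> Id1 K a = X"
    and comp1_assoc: "\<lbrakk>X \<in> hom1 K a b; Y \<in> hom1 K b c; Z \<in> hom1 K c d\<rbrakk>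
          \<Longrightarrow> (Z \<cdot> Y) \<cdot> X = Z \<cdot> (Y \<cdot> X)"
    and id2: "X \<in> Cell1 K \<Longrightarrow> Id2 K X \<in> hom2 K X X"
    and vcomp: "\<lbrakk>\<alpha> \<in> hom2 K X Y; \<beta> \<in> hom2 K Y Z\<rbrakk> \<Longrightarrow> \<beta> \<odot> \<alpha> \<in> hom2 K X Z"
    and vcomp_id_left: "\<alpha> \<in> hom2 K X Y \<Longrightarrow> Id2 K Y \<odot> \<alpha> = \<alpha>"
    and vcomp_id_right: "\<alpha> \<in> hom2 K X Y \<Longrightarrow> \<alpha> \<odot> Id2 K X = \<alpha>"
    and vcomp_assoc: "\<lbrakk>\<alpha> \<in> hom2 K X Y; \<beta> \<in> hom2 K Y Z; \<gamma> \<in> hom2 K Z W\<rbrakk>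
          \<Longrightarrow> (\<gamma> \<odot> \<beta>) \<odot> \<alpha> = \<gamma> \<odot> (\<beta> \<odot> \<alpha>)"
    and hcomp: "\<lbrakk>X \<in> hom1 K a b; Y \<in> hom1 K b c; \<alpha> \<in> hom2 K X X'; \<beta> \<in> hom2 K Y Y'\<rbrakk>
          \<Longrightarrow> \<beta> \<star> \<alpha> \<in> hom2 K (Y \<cdot> X) (Y' \<cdot> X')"
    and hcomp_id_left: "\<lbrakk>X \<in> hom1 K a b; \<alpha> \<in> hom2 K X X'\<rbrakk> \<Longrightarrow> Id1 K b \<rhd> \<alpha> = \<alpha>"
    and hcomp_id_right: "\<lbrakk>X \<in> hom1 K a b; \<alpha> \<in> hom2 K X X'\<rbrakk> \<Longrightarrow> \<alpha> \<lhd> Id1 K a = \<alpha>"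
    and hcomp_assoc: "\<lbrakk>X \<in> hom1 K a b; Y \<in> hom1 K b c; Z \<in> hom1 K c d;
            \<alpha> \<in> hom2 K X X'; \<beta> \<in> hom2 K Y Y'; \<gamma> \<in> hom2 K Z Z'\<rbrakk>
          \<Longrightarrow> (\<gamma> \<star> \<beta>) \<star> \<alpha> = \<gamma> \<star> (\<beta> \<star> \<alpha>)"
    and hcomp_id2: "\<lbrakk>X \<in> hom1 K a b; Y \<in> hom1 K b c\<rbrakk> \<Longrightarrow> Y \<rhd> Id2 K X = Id2 K (Y \<cdot> X)"
    and interchange: "\<lbrakk>X \<in> hom1 K a b; Y \<in> hom1 K b c; \<alpha> \<in> hom2 K X X'; \<alpha>' \<in> hom2 K X' X'';
            \<beta> \<in> hom2 K Y Y'; \<beta>' \<in> hom2 K Y' Y''\<rbrakk>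
          \<Longrightarrow> (\<beta>' \<odot> \<beta>) \<star> (\<alpha>' \<odot> \<alpha>) = (\<beta>' \<star> \<alpha>') \<odot> (\<beta> \<star> \<alpha>)"

record ('o, 'm, 'c, 'o2, 'm2, 'c2) two_map =
  On0 :: "'o \<Rightarrow> 'o2"
  On1 :: "'m \<Rightarrow> 'm2"
  On2 :: "'c \<Rightarrow> 'c2"

locale two_functor = C: two_category C + D: two_category D
  for C :: "('o, 'm, 'c) twocat"
    and D :: "('o2, 'm2, 'c2) twocat" +
  fixes T :: "('o, 'm, 'c, 'o2, 'm2, 'c2) two_map"
  assumes on0: "a \<in> Cell0 C \<Longrightarrow> On0 T a \<in> Cell0 D"
    and on1: "X \<in> hom1 C a b \<Longrightarrow> On1 T X \<in> hom1 D (On0 T a) (On0 T b)"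
    and on2: "\<alpha> \<in> hom2 C X Y \<Longrightarrow> On2 T \<alpha> \<in> hom2 D (On1 T X) (On1 T Y)"
    and on_id1: "a \<in> Cell0 C \<Longrightarrow> On1 T (Id1 C a) = Id1 D (On0 T a)"
    and on_comp1: "\<lbrakk>X \<in> hom1 C a b; Y \<in> hom1 C b c\<rbrakk>
          \<Longrightarrow> On1 T (Comp1 C Y X) = Comp1 D (On1 T Y) (On1 T X)"
    and on_id2: "X \<in> Cell1 C \<Longrightarrow> On2 T (Id2 C X) = Id2 D (On1 T X)"
    and on_vcomp: "\<lbrakk>\<alpha> \<in> hom2 C X Y; \<beta> \<in> hom2 C Y Z\<rbrakk>
          \<Longrightarrow> On2 T (VComp C \<beta> \<alpha>) = VComp D (On2 T \<beta>) (On2 T \<alpha>)"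
    and on_hcomp: "\<lbrakk>X \<in> hom1 C a b; Y \<in> hom1 C b c; \<alpha> \<in> hom2 C X X'; \<beta> \<in> hom2 C Y Y'\<rbrakk>
          \<Longrightarrow> On2 T (HComp C \<beta> \<alpha>) = HComp D (On2 T \<beta>) (On2 T \<alpha>)"


section \<open>Categories, functors, natural transformations and the 2-category Cat\<close>

text \<open>
  Structure maps of categories, functors and natural transformations are required to take the
  value \<open>undefined\<close> outside their mathematical domain (cf. \<^const>\<open>extensional\<close>),
  so that HOL equality of these records is mathematical equality.
\<close>

record ('x, 'y) cat =
  Obj :: "'x set"
  Arr :: "'y set"
  Dom :: "'y \<Rightarrow> 'x"
  Cod :: "'y \<Rightarrow> 'x"
  Ide :: "'x \<Rightarrow> 'y"
  Cmp :: "'y \<Rightarrow> 'y \<Rightarrow> 'y"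

definition Hom :: "('x, 'y) cat \<Rightarrow> 'x \<Rightarrow> 'x \<Rightarrow> 'y set"
  where "Hom C x y = {f \<in> Arr C. Dom C f = x \<and> Cod C f = y}"

locale category =
  fixes C :: "('x, 'y) cat"
  assumes arr_ends: "f \<in> Arr C \<Longrightarrow> Dom C f \<in> Obj C \<and> Cod C f \<in> Obj C"
    and ide: "x \<in> Obj C \<Longrightarrow> Ide C x \<in> Hom C x x"
    and cmp: "\<lbrakk>f \<in> Hom C x y; g \<in> Hom C y z\<rbrakk> \<Longrightarrow> Cmp C g f \<in> Hom C x z"
    and cmp_ide_left: "f \<in> Hom C x y \<Longrightarrow> Cmp C (Ide C y) f = f"
    and cmp_ide_right: "f \<in> Hom C x y \<Longrightarrow> Cmp C f (Ide C x) = f"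
    and cmp_assoc: "\<lbrakk>f \<in> Hom C x y; g \<in> Hom C y z; h \<in> Hom C z w\<rbrakk>
          \<Longrightarrow> Cmp C (Cmp C h g) f = Cmp C h (Cmp C g f)"
    and ends_extensional: "Dom C \<in> extensional (Arr C)" "Cod C \<in> extensional (Arr C)"
    and ide_extensional: "Ide C \<in> extensional (Obj C)"
    and cmp_extensional: "\<not> (f \<in> Arr C \<and> g \<in> Arr C \<and> Dom C g = Cod C f)
          \<Longrightarrow> Cmp C g f = undefined"

definition make_cat ::
    "'x set \<Rightarrow> 'y set \<Rightarrow> ('y \<Rightarrow> 'x) \<Rightarrow> ('y \<Rightarrow> 'x) \<Rightarrow> ('x \<Rightarrow> 'y) \<Rightarrow> ('y \<Rightarrow> 'y \<Rightarrow> 'y) \<Rightarrow> ('x, 'y) cat"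
  where "make_cat Ob Ar dm cd i m =
    \<lparr>Obj = Ob, Arr = Ar, Dom = restrict dm Ar, Cod = restrict cd Ar, Ide = restrict i Ob,
     Cmp = (\<lambda>g f. if f \<in> Ar \<and> g \<in> Ar \<and> dm g = cd f then m g f else undefined)\<rparr>"

record ('x, 'y, 'u, 'v) ftor =
  fdom :: "('x, 'y) cat"
  fcod :: "('u, 'v) cat"
  fob  :: "'x \<Rightarrow> 'u"
  far  :: "'y \<Rightarrow> 'v"

locale is_functor =
  fixes F :: "('x, 'y, 'u, 'v) ftor"
  assumes fdom_category: "category (fdom F)"
    and fcod_category: "category (fcod F)"
    and fob: "x \<in> Obj (fdom F) \<Longrightarrow> fob F x \<in> Obj (fcod F)"
    and far: "f \<in> Hom (fdom F) x y \<Longrightarrow> far F f \<in> Hom (fcod F) (fob F x) (fob F y)"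
    and far_ide: "x \<in> Obj (fdom F) \<Longrightarrow> far F (Ide (fdom F) x) = Ide (fcod F) (fob F x)"
    and far_cmp: "\<lbrakk>f \<in> Hom (fdom F) x y; g \<in> Hom (fdom F) y z\<rbrakk>
          \<Longrightarrow> far F (Cmp (fdom F) g f) = Cmp (fcod F) (far F g) (far F f)"
    and fob_extensional: "fob F \<in> extensional (Obj (fdom F))"
    and far_extensional: "far F \<in> extensional (Arr (fdom F))"

record ('x, 'y, 'u, 'v) ntrans =
  ndom :: "('x, 'y, 'u, 'v) ftor"
  ncod :: "('x, 'y, 'u, 'v) ftor"
  nmap :: "'x \<Rightarrow> 'v"

locale is_natural =
  fixes t :: "('x, 'y, 'u, 'v) ntrans"
  assumes ndom_functor: "is_functor (ndom t)"
    and ncod_functor: "is_functor (ncod t)"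
    and same_fdom: "fdom (ncod t) = fdom (ndom t)"
    and same_fcod: "fcod (ncod t) = fcod (ndom t)"
    and nmap: "x \<in> Obj (fdom (ndom t))
          \<Longrightarrow> nmap t x \<in> Hom (fcod (ndom t)) (fob (ndom t) x) (fob (ncod t) x)"
    and naturality: "f \<in> Hom (fdom (ndom t)) x y
          \<Longrightarrow> Cmp (fcod (ndom t)) (nmap t y) (far (ndom t) f)
            = Cmp (fcod (ndom t)) (far (ncod t) f) (nmap t x)"
    and nmap_extensional: "nmap t \<in> extensional (Obj (fdom (ndom t)))"

definition id_ftor :: "('x, 'y) cat \<Rightarrow> ('x, 'y, 'x, 'y) ftor"
  where "id_ftor C = \<lparr>fdom = C, fcod = C, fob = (\<lambda>x\<in>Obj C. x), far = (\<lambda>f\<in>Arr C. f)\<rparr>"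

definition comp_ftor ::
    "('u, 'v, 'r, 's) ftor \<Rightarrow> ('x, 'y, 'u, 'v) ftor \<Rightarrow> ('x, 'y, 'r, 's) ftor"
  where "comp_ftor G F =
    \<lparr>fdom = fdom F, fcod = fcod G,
     fob = compose (Obj (fdom F)) (fob G) (fob F),
     far = compose (Arr (fdom F)) (far G) (far F)\<rparr>"

definition id_ntrans :: "('x, 'y, 'u, 'v) ftor \<Rightarrow> ('x, 'y, 'u, 'v) ntrans"
  where "id_ntrans F =
    \<lparr>ndom = F, ncod = F, nmap = (\<lambda>x\<in>Obj (fdom F). Ide (fcod F) (fob F x))\<rparr>"

definition vcomp_ntrans ::
    "('x, 'y, 'u, 'v) ntrans \<Rightarrow> ('x, 'y, 'u, 'v) ntrans \<Rightarrow> ('x, 'y, 'u, 'v) ntrans"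
  where "vcomp_ntrans s t =
    \<lparr>ndom = ndom t, ncod = ncod s,
     nmap = (\<lambda>x\<in>Obj (fdom (ndom t)). Cmp (fcod (ndom t)) (nmap s x) (nmap t x))\<rparr>"

definition hcomp_ntrans ::
    "('u, 'v, 'r, 's) ntrans \<Rightarrow> ('x, 'y, 'u, 'v) ntrans \<Rightarrow> ('x, 'y, 'r, 's) ntrans"
  where "hcomp_ntrans s t =
    \<lparr>ndom = comp_ftor (ndom s) (ndom t), ncod = comp_ftor (ncod s) (ncod t),
     nmap = (\<lambda>x\<in>Obj (fdom (ndom t)).
       Cmp (fcod (ndom s)) (nmap s (fob (ncod t) x)) (far (ndom s) (nmap t x)))\<rparr>"

text \<open>The 2-category of all categories with objects in \<open>'x\<close> and arrows in \<open>'y\<close>.\<close>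

definition Cat :: "(('x, 'y) cat, ('x, 'y, 'x, 'y) ftor, ('x, 'y, 'x, 'y) ntrans) twocat"
  where "Cat =
    \<lparr>Cell0 = {C. category C}, Cell1 = {F. is_functor F}, Cell2 = {t. is_natural t},
     Src1 = fdom, Tgt1 = fcod, Src2 = ndom, Tgt2 = ncod,
     Id1 = id_ftor, Id2 = id_ntrans,
     Comp1 = comp_ftor, HComp = hcomp_ntrans, VComp = vcomp_ntrans\<rparr>"


section \<open>Strict monoidal categories and their actions\<close>

record ('x, 'y) moncat =
  under  :: "('x, 'y) cat"
  tensob :: "'x \<Rightarrow> 'x \<Rightarrow> 'x"
  tensar :: "'y \<Rightarrow> 'y \<Rightarrow> 'y"
  unitob :: "'x"

locale strict_monoidal =
  fixes V :: "('x, 'y) moncat"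
  assumes under_category: "category (under V)"
    and tensob: "\<lbrakk>x \<in> Obj (under V); y \<in> Obj (under V)\<rbrakk> \<Longrightarrow> tensob V x y \<in> Obj (under V)"
    and tensar: "\<lbrakk>f \<in> Hom (under V) x x'; g \<in> Hom (under V) y y'\<rbrakk>
          \<Longrightarrow> tensar V f g \<in> Hom (under V) (tensob V x y) (tensob V x' y')"
    and tensar_ide: "\<lbrakk>x \<in> Obj (under V); y \<in> Obj (under V)\<rbrakk>
          \<Longrightarrow> tensar V (Ide (under V) x) (Ide (under V) y) = Ide (under V) (tensob V x y)"
    and tensar_cmp: "\<lbrakk>f \<in> Hom (under V) x x'; f' \<in> Hom (under V) x' x'';
            g \<in> Hom (under V) y y'; g' \<in> Hom (under V) y' y''\<rbrakk>
          \<Longrightarrow> tensar V (Cmp (under V) f' f) (Cmp (under V) g' g)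
            = Cmp (under V) (tensar V f' g') (tensar V f g)"
    and unitob: "unitob V \<in> Obj (under V)"
    and tensob_unit: "x \<in> Obj (under V) \<Longrightarrow> tensob V (unitob V) x = x \<and> tensob V x (unitob V) = x"
    and tensar_unit: "f \<in> Arr (under V) \<Longrightarrow>
          tensar V (Ide (under V) (unitob V)) f = f \<and> tensar V f (Ide (under V) (unitob V)) = f"
    and tensob_assoc: "\<lbrakk>x \<in> Obj (under V); y \<in> Obj (under V); z \<in> Obj (under V)\<rbrakk>
          \<Longrightarrow> tensob V (tensob V x y) z = tensob V x (tensob V y z)"
    and tensar_assoc: "\<lbrakk>f \<in> Arr (under V); g \<in> Arr (under V); h \<in> Arr (under V)\<rbrakk>
          \<Longrightarrow> tensar V (tensar V f g) h = tensar V f (tensar V g h)"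

locale strict_monoidal_functor = V: strict_monoidal V + W: strict_monoidal W + is_functor P
  for V :: "('x, 'y) moncat"
    and W :: "('u, 'v) moncat"
    and P :: "('x, 'y, 'u, 'v) ftor" +
  assumes fdom_under: "fdom P = under V"
    and fcod_under: "fcod P = under W"
    and fob_unit: "fob P (unitob V) = unitob W"
    and fob_tens: "\<lbrakk>x \<in> Obj (under V); y \<in> Obj (under V)\<rbrakk>
          \<Longrightarrow> fob P (tensob V x y) = tensob W (fob P x) (fob P y)"
    and far_tens: "\<lbrakk>f \<in> Arr (under V); g \<in> Arr (under V)\<rbrakk>
          \<Longrightarrow> far P (tensar V f g) = tensar W (far P f) (far P g)"

definition prod_cat :: "('x, 'y) cat \<Rightarrow> ('u, 'v) cat \<Rightarrow> ('x \<times> 'u, 'y \<times> 'v) cat"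
  where "prod_cat C D = make_cat (Obj C \<times> Obj D) (Arr C \<times> Arr D)
    (\<lambda>(f, g). (Dom C f, Dom D g)) (\<lambda>(f, g). (Cod C f, Cod D g))
    (\<lambda>(x, u). (Ide C x, Ide D u)) (\<lambda>(f', g') (f, g). (Cmp C f' f, Cmp D g' g))"

text \<open>A (strict) action \<open>V \<times> C \<rightarrow> C\<close> of a strict monoidal category on a category.\<close>

locale strict_action = V: strict_monoidal V + is_functor A
  for V :: "('x, 'y) moncat"
    and C :: "('u, 'v) cat"
    and A :: "('x \<times> 'u, 'y \<times> 'v, 'u, 'v) ftor" +
  assumes fdom_prod: "fdom A = prod_cat (under V) C"
    and fcod_C: "fcod A = C"
    and unit_ob: "m \<in> Obj C \<Longrightarrow> fob A (unitob V, m) = m"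
    and unit_ar: "f \<in> Arr C \<Longrightarrow> far A (Ide (under V) (unitob V), f) = f"
    and tens_ob: "\<lbrakk>x \<in> Obj (under V); y \<in> Obj (under V); m \<in> Obj C\<rbrakk>
          \<Longrightarrow> fob A (tensob V x y, m) = fob A (x, fob A (y, m))"
    and tens_ar: "\<lbrakk>s \<in> Arr (under V); t \<in> Arr (under V); f \<in> Arr C\<rbrakk>
          \<Longrightarrow> far A (tensar V s t, f) = far A (s, far A (t, f))"

text \<open>The strict monoidal category of 1-endocells of a 0-cell, with \<open>Y \<otimes> X = YX\<close>.\<close>

definition endo_moncat :: "('o, 'm, 'c) twocat \<Rightarrow> 'o \<Rightarrow> ('m, 'c) moncat"
  where "endo_moncat K a =
    \<lparr>under = make_cat (hom1 K a a) {\<alpha> \<in> Cell2 K. Src2 K \<alpha> \<in> hom1 K a a}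
       (Src2 K) (Tgt2 K) (Id2 K) (VComp K),
     tensob = Comp1 K, tensar = HComp K, unitob = Id1 K a\<rparr>"

definition Fun :: "('x, 'y) cat \<Rightarrow> (('x, 'y, 'x, 'y) ftor, ('x, 'y, 'x, 'y) ntrans) moncat"
  where "Fun C = endo_moncat Cat C"

definition endo_ftor ::
    "('o, 'm, 'c) twocat \<Rightarrow> ('o2, 'm2, 'c2) twocat \<Rightarrow> ('o, 'm, 'c, 'o2, 'm2, 'c2) two_map
      \<Rightarrow> 'o \<Rightarrow> ('m, 'c, 'm2, 'c2) ftor"
  where "endo_ftor C D T a =
    \<lparr>fdom = under (endo_moncat C a), fcod = under (endo_moncat D (On0 T a)),
     fob = restrict (On1 T) (Obj (under (endo_moncat C a))),
     far = restrict (On2 T) (Arr (under (endo_moncat C a)))\<rparr>"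

text \<open>Currying between functors \<open>V \<times> C \<rightarrow> C\<close> and functors \<open>V \<rightarrow> Fun(C, C)\<close>.\<close>

definition uncurry_ftor ::
    "('x, 'y) moncat \<Rightarrow> ('u, 'v) cat
      \<Rightarrow> ('x, 'y, ('u, 'v, 'u, 'v) ftor, ('u, 'v, 'u, 'v) ntrans) ftor
      \<Rightarrow> ('x \<times> 'u, 'y \<times> 'v, 'u, 'v) ftor"
  where "uncurry_ftor V C P =
    \<lparr>fdom = prod_cat (under V) C, fcod = C,
     fob = (\<lambda>(x, m)\<in>Obj (under V) \<times> Obj C. fob (fob P x) m),
     far = (\<lambda>(s, f)\<in>Arr (under V) \<times> Arr C.
       Cmp C (nmap (far P s) (Cod C f)) (far (fob P (Dom (under V) s)) f))\<rparr>"

definition partial_ftor ::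
    "('x, 'y) moncat \<Rightarrow> ('u, 'v) cat \<Rightarrow> ('x \<times> 'u, 'y \<times> 'v, 'u, 'v) ftor
      \<Rightarrow> 'x \<Rightarrow> ('u, 'v, 'u, 'v) ftor"
  where "partial_ftor V C A x =
    \<lparr>fdom = C, fcod = C, fob = (\<lambda>m\<in>Obj C. fob A (x, m)),
     far = (\<lambda>f\<in>Arr C. far A (Ide (under V) x, f))\<rparr>"

definition curry_ftor ::
    "('x, 'y) moncat \<Rightarrow> ('u, 'v) cat \<Rightarrow> ('x \<times> 'u, 'y \<times> 'v, 'u, 'v) ftor
      \<Rightarrow> ('x, 'y, ('u, 'v, 'u, 'v) ftor, ('u, 'v, 'u, 'v) ntrans) ftor"
  where "curry_ftor V C A =
    \<lparr>fdom = under V, fcod = under (Fun C),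
     fob = (\<lambda>x\<in>Obj (under V). partial_ftor V C A x),
     far = (\<lambda>s\<in>Arr (under V).
       \<lparr>ndom = partial_ftor V C A (Dom (under V) s), ncod = partial_ftor V C A (Cod (under V) s),
        nmap = (\<lambda>m\<in>Obj C. far A (s, Ide C m))\<rparr>)\<rparr>"


section \<open>Monads, comonads and bimonads in a 2-category\<close>

record ('o, 'm, 'c) monad =
  mnd_base :: 'o
  mnd_cell :: 'm
  mnd_mult :: 'c
  mnd_unit :: 'c

record ('o, 'm, 'c) comonad =
  cmd_base   :: 'o
  cmd_cell   :: 'm
  cmd_comult :: 'c
  cmd_counit :: 'c

record ('o, 'm, 'c) bimonad =
  bi_base   :: 'o
  bi_cell   :: 'm
  bi_mult   :: 'c
  bi_unit   :: 'c
  bi_comult :: 'c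
  bi_counit :: 'c
  bi_lambda :: 'c

definition bi_mnd :: "('o, 'm, 'c) bimonad \<Rightarrow> ('o, 'm, 'c) monad"
  where "bi_mnd F = \<lparr>mnd_base = bi_base F, mnd_cell = bi_cell F,
    mnd_mult = bi_mult F, mnd_unit = bi_unit F\<rparr>"

definition bi_cmd :: "('o, 'm, 'c) bimonad \<Rightarrow> ('o, 'm, 'c) comonad"
  where "bi_cmd F = \<lparr>cmd_base = bi_base F, cmd_cell = bi_cell F,
    cmd_comult = bi_comult F, cmd_counit = bi_counit F\<rparr>"

definition is_monad :: "('o, 'm, 'c) twocat \<Rightarrow> ('o, 'm, 'c) monad \<Rightarrow> bool"
  where
  "is_monad K S \<longleftrightarrow>
    (let A = mnd_base S; B = mnd_cell S; \<mu> = mnd_mult S; \<eta> = mnd_unit S in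
      A \<in> Cell0 K \<and> B \<in> hom1 K A A \<and>
      \<mu> \<in> hom2 K (B \<cdot> B) B \<and> \<eta> \<in> hom2 K (Id1 K A) B \<and>
      \<mu> \<odot> (\<mu> \<lhd> B) = \<mu> \<odot> (B \<rhd> \<mu>) \<and>
      \<mu> \<odot> (\<eta> \<lhd> B) = Id2 K B \<and> \<mu> \<odot> (B \<rhd> \<eta>) = Id2 K B)"
  for K (structure)

definition is_comonad :: "('o, 'm, 'c) twocat \<Rightarrow> ('o, 'm, 'c) comonad \<Rightarrow> bool"
  where
  "is_comonad K S \<longleftrightarrow>
    (let A = cmd_base S; F = cmd_cell S; \<Delta> = cmd_comult S; \<epsilon> = cmd_counit S in
      A \<in> Cell0 K \<and> F \<in> hom1 K A A \<and>
      \<Delta> \<in> hom2 K F (F \<cdot> F) \<and> \<epsilon> \<in> hom2 K F (Id1 K A) \<and>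
      (\<Delta> \<lhd> F) \<odot> \<Delta> = (F \<rhd> \<Delta>) \<odot> \<Delta> \<and>
      (\<epsilon> \<lhd> F) \<odot> \<Delta> = Id2 K F \<and> (F \<rhd> \<epsilon>) \<odot> \<Delta> = Id2 K F)"
  for K (structure)

definition mnd_1cell ::
    "('o, 'm, 'c) twocat \<Rightarrow> ('o, 'm, 'c) monad \<Rightarrow> ('o, 'm, 'c) monad \<Rightarrow> 'm \<Rightarrow> 'c \<Rightarrow> bool"
  where
  "mnd_1cell K S S' X \<psi> \<longleftrightarrow>
    (let B = mnd_cell S; B' = mnd_cell S' in
      X \<in> hom1 K (mnd_base S) (mnd_base S') \<and> \<psi> \<in> hom2 K (B' \<cdot> X) (X \<cdot> B) \<and>
      \<psi> \<odot> (mnd_mult S' \<lhd> X) = (X \<rhd> mnd_mult S) \<odot> (\<psi> \<lhd> B) \<odot> (B' \<rhd> \<psi>) \<and>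
      \<psi> \<odot> (mnd_unit S' \<lhd> X) = X \<rhd> mnd_unit S)"
  for K (structure)

definition comnd_1cell ::
    "('o, 'm, 'c) twocat \<Rightarrow> ('o, 'm, 'c) comonad \<Rightarrow> ('o, 'm, 'c) comonad \<Rightarrow> 'm \<Rightarrow> 'c \<Rightarrow> bool"
  where
  "comnd_1cell K S S' X \<phi> \<longleftrightarrow>
    (let F = cmd_cell S; F' = cmd_cell S' in
      X \<in> hom1 K (cmd_base S) (cmd_base S') \<and> \<phi> \<in> hom2 K (X \<cdot> F) (F' \<cdot> X) \<and>
      (cmd_comult S' \<lhd> X) \<odot> \<phi> = (F' \<rhd> \<phi>) \<odot> (\<phi> \<lhd> F) \<odot> (X \<rhd> cmd_comult S) \<and>
      (cmd_counit S' \<lhd> X) \<odot> \<phi> = X \<rhd> cmd_counit S)"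
  for K (structure)

text \<open>In the next two definitions \<open>\<zeta>\<close> is a 2-cell between 1-cells \<open>(X, \<psi>)\<close>, \<open>(Y, \<psi>')\<close>
  (resp. \<open>(X, \<phi>)\<close>, \<open>(Y, \<phi>')\<close>) from \<open>S\<close> to \<open>S'\<close>.\<close>

definition mnd_2cell ::
    "('o, 'm, 'c) twocat \<Rightarrow> ('o, 'm, 'c) monad \<Rightarrow> ('o, 'm, 'c) monad
      \<Rightarrow> 'm \<Rightarrow> 'c \<Rightarrow> 'm \<Rightarrow> 'c \<Rightarrow> 'c \<Rightarrow> bool"
  where
  "mnd_2cell K S S' X \<psi> Y \<psi>' \<zeta> \<longleftrightarrow>
    \<zeta> \<in> hom2 K X Y \<and> (\<zeta> \<lhd> mnd_cell S) \<odot> \<psi> = \<psi>' \<odot> (mnd_cell S' \<rhd> \<zeta>)"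
  for K (structure)

definition comnd_2cell ::
    "('o, 'm, 'c) twocat \<Rightarrow> ('o, 'm, 'c) comonad \<Rightarrow> ('o, 'm, 'c) comonad
      \<Rightarrow> 'm \<Rightarrow> 'c \<Rightarrow> 'm \<Rightarrow> 'c \<Rightarrow> 'c \<Rightarrow> bool"
  where
  "comnd_2cell K S S' X \<phi> Y \<phi>' \<zeta> \<longleftrightarrow>
    \<zeta> \<in> hom2 K X Y \<and> (cmd_cell S' \<rhd> \<zeta>) \<odot> \<phi> = \<phi>' \<odot> (\<zeta> \<lhd> cmd_cell S)"
  for K (structure)

definition is_bimonad :: "('o, 'm, 'c) twocat \<Rightarrow> ('o, 'm, 'c) bimonad \<Rightarrow> bool"
  where
  "is_bimonad K S \<longleftrightarrow>
    (let A = bi_base S; F = bi_cell S; \<mu> = bi_mult S; \<eta> = bi_unit S;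
         \<Delta> = bi_comult S; \<epsilon> = bi_counit S; l = bi_lambda S in
      is_monad K (bi_mnd S) \<and> is_comonad K (bi_cmd S) \<and>
      mnd_1cell K (bi_mnd S) (bi_mnd S) F l \<and> comnd_1cell K (bi_cmd S) (bi_cmd S) F l \<and>
      \<Delta> \<odot> \<mu> = (F \<rhd> \<mu>) \<odot> (l \<lhd> F) \<odot> (F \<rhd> \<Delta>) \<and>
      \<epsilon> \<odot> \<mu> = \<epsilon> \<star> \<epsilon> \<and> \<Delta> \<odot> \<eta> = \<eta> \<star> \<eta> \<and> \<epsilon> \<odot> \<eta> = Id2 K (Id1 K A))"
  for K (structure)

definition bimnd_1cell ::
    "('o, 'm, 'c) twocat \<Rightarrow> ('o, 'm, 'c) bimonad \<Rightarrow> ('o, 'm, 'c) bimonad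
      \<Rightarrow> 'm \<Rightarrow> 'c \<Rightarrow> 'c \<Rightarrow> bool"
  where
  "bimnd_1cell K S S' X \<psi> \<phi> \<longleftrightarrow>
    (let F = bi_cell S; F' = bi_cell S' in
      mnd_1cell K (bi_mnd S) (bi_mnd S') X \<psi> \<and> comnd_1cell K (bi_cmd S) (bi_cmd S') X \<phi> \<and>
      (\<phi> \<lhd> F) \<odot> (X \<rhd> bi_lambda S) \<odot> (\<psi> \<lhd> F) = (F' \<rhd> \<psi>) \<odot> (bi_lambda S' \<lhd> X) \<odot> (F' \<rhd> \<phi>))"
  for K (structure)

definition bimnd_2cell ::
    "('o, 'm, 'c) twocat \<Rightarrow> ('o, 'm, 'c) bimonad \<Rightarrow> ('o, 'm, 'c) bimonad
      \<Rightarrow> 'm \<Rightarrow> 'c \<Rightarrow> 'c \<Rightarrow> 'm \<Rightarrow> 'c \<Rightarrow> 'c \<Rightarrow> 'c \<Rightarrow> bool"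
  where
  "bimnd_2cell K S S' X \<psi> \<phi> Y \<psi>' \<phi>' \<zeta> \<longleftrightarrow>
    mnd_2cell K (bi_mnd S) (bi_mnd S') X \<psi> Y \<psi>' \<zeta> \<and>
    comnd_2cell K (bi_cmd S) (bi_cmd S') X \<phi> Y \<phi>' \<zeta>"


section \<open>The 2-category of Tambara bimonads\<close>

record ('o, 'm, 'c) tambara =
  tb_F   :: "('o, 'm, 'c) bimonad"
  tb_B   :: "('o, 'm, 'c) monad"
  tb_psi :: 'c    \<comment> \<open>\<open>\<psi>\<^bsub>B,F\<^esub> : BF \<rightarrow> FB\<close>\<close>

definition is_tambara :: "('o, 'm, 'c) twocat \<Rightarrow> ('o, 'm, 'c) tambara \<Rightarrow> bool"
  where
  "is_tambara K S \<longleftrightarrow>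
    is_bimonad K (tb_F S) \<and> is_monad K (tb_B S) \<and> mnd_base (tb_B S) = bi_base (tb_F S) \<and>
    mnd_1cell K (tb_B S) (tb_B S) (bi_cell (tb_F S)) (tb_psi S)"

record ('o, 'm, 'c) tambara_1cell =
  t1_src  :: "('o, 'm, 'c) tambara"
  t1_tgt  :: "('o, 'm, 'c) tambara"
  t1_cell :: 'm    \<comment> \<open>\<open>X\<close>\<close>
  t1_psiF :: 'c    \<comment> \<open>\<open>\<psi>\<^bsub>F,X\<^esub> : F'X \<rightarrow> XF\<close>\<close>
  t1_phi  :: 'c    \<comment> \<open>\<open>\<phi>\<^bsub>X,F\<^esub> : XF \<rightarrow> F'X\<close>\<close>
  t1_psiB :: 'c    \<comment> \<open>\<open>\<psi>\<^bsub>B,X\<^esub> : B'X \<rightarrow> XB\<close>\<close>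

definition is_tambara_1cell :: "('o, 'm, 'c) twocat \<Rightarrow> ('o, 'm, 'c) tambara_1cell \<Rightarrow> bool"
  where
  "is_tambara_1cell K x \<longleftrightarrow>
    (let S = t1_src x; S' = t1_tgt x; X = t1_cell x;
         F = bi_cell (tb_F S); F' = bi_cell (tb_F S'); B = mnd_cell (tb_B S); B' = mnd_cell (tb_B S');
         \<psi>\<^sub>F = t1_psiF x; \<phi> = t1_phi x; \<psi>\<^sub>B = t1_psiB x in
      is_tambara K S \<and> is_tambara K S' \<and>
      bimnd_1cell K (tb_F S) (tb_F S') X \<psi>\<^sub>F \<phi> \<and> mnd_1cell K (tb_B S) (tb_B S') X \<psi>\<^sub>B \<and>
      (X \<rhd> tb_psi S) \<odot> (\<psi>\<^sub>B \<lhd> F) \<odot> (B' \<rhd> \<psi>\<^sub>F) = (\<psi>\<^sub>F \<lhd> B) \<odot> (F' \<rhd> \<psi>\<^sub>B) \<odot> (tb_psi S' \<lhd> X) \<and>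
      (F' \<rhd> \<psi>\<^sub>B) \<odot> (tb_psi S' \<lhd> X) \<odot> (B' \<rhd> \<phi>) = (\<phi> \<lhd> B) \<odot> (X \<rhd> tb_psi S) \<odot> (\<psi>\<^sub>B \<lhd> F))"
  for K (structure)

text \<open>2-cells of \<open>\<K>\<close> bundled with the structured source and target they are considered between;
  used for 2-cells of Tambara bimonads and for morphisms of relative modules.\<close>

record ('x, 'c) arrow =
  ar_src  :: 'x
  ar_tgt  :: 'x
  ar_cell :: 'c

definition is_tambara_2cell ::
    "('o, 'm, 'c) twocat \<Rightarrow> (('o, 'm, 'c) tambara_1cell, 'c) arrow \<Rightarrow> bool"
  where
  "is_tambara_2cell K z \<longleftrightarrow>
    (let x = ar_src z; y = ar_tgt z; S = t1_src x; S' = t1_tgt x in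
      is_tambara_1cell K x \<and> is_tambara_1cell K y \<and> t1_src y = S \<and> t1_tgt y = S' \<and>
      bimnd_2cell K (tb_F S) (tb_F S')
        (t1_cell x) (t1_psiF x) (t1_phi x) (t1_cell y) (t1_psiF y) (t1_phi y) (ar_cell z) \<and>
      mnd_2cell K (tb_B S) (tb_B S')
        (t1_cell x) (t1_psiB x) (t1_cell y) (t1_psiB y) (ar_cell z))"

definition tambara_id1 ::
    "('o, 'm, 'c) twocat \<Rightarrow> ('o, 'm, 'c) tambara \<Rightarrow> ('o, 'm, 'c) tambara_1cell"
  where
  "tambara_id1 K S =
    \<lparr>t1_src = S, t1_tgt = S, t1_cell = Id1 K (bi_base (tb_F S)),
     t1_psiF = Id2 K (bi_cell (tb_F S)), t1_phi = Id2 K (bi_cell (tb_F S)),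
     t1_psiB = Id2 K (mnd_cell (tb_B S))\<rparr>"

definition tambara_comp1 ::
    "('o, 'm, 'c) twocat \<Rightarrow> ('o, 'm, 'c) tambara_1cell \<Rightarrow> ('o, 'm, 'c) tambara_1cell
      \<Rightarrow> ('o, 'm, 'c) tambara_1cell"
  where
  "tambara_comp1 K y x =
    (let X = t1_cell x; Y = t1_cell y in
      \<lparr>t1_src = t1_src x, t1_tgt = t1_tgt y, t1_cell = Y \<cdot> X,
       t1_psiF = (Y \<rhd> t1_psiF x) \<odot> (t1_psiF y \<lhd> X),
       t1_phi = (t1_phi y \<lhd> X) \<odot> (Y \<rhd> t1_phi x),
       t1_psiB = (Y \<rhd> t1_psiB x) \<odot> (t1_psiB y \<lhd> X)\<rparr>)"
  for K (structure)

definition Tambara_Bimnd :: "('o, 'm, 'c) twocat \<Rightarrow>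
    (('o, 'm, 'c) tambara, ('o, 'm, 'c) tambara_1cell, (('o, 'm, 'c) tambara_1cell, 'c) arrow) twocat"
  where
  "Tambara_Bimnd K =
    \<lparr>Cell0 = {S. is_tambara K S}, Cell1 = {x. is_tambara_1cell K x}, Cell2 = {z. is_tambara_2cell K z},
     Src1 = t1_src, Tgt1 = t1_tgt, Src2 = ar_src, Tgt2 = ar_tgt,
     Id1 = tambara_id1 K,
     Id2 = (\<lambda>x. \<lparr>ar_src = x, ar_tgt = x, ar_cell = Id2 K (t1_cell x)\<rparr>),
     Comp1 = tambara_comp1 K,
     HComp = (\<lambda>w z. \<lparr>ar_src = tambara_comp1 K (ar_src w) (ar_src z),
                     ar_tgt = tambara_comp1 K (ar_tgt w) (ar_tgt z),
                     ar_cell = ar_cell w \<star> ar_cell z\<rparr>),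
     VComp = (\<lambda>w z. \<lparr>ar_src = ar_src z, ar_tgt = ar_tgt w, ar_cell = ar_cell w \<odot> ar_cell z\<rparr>)\<rparr>"
  for K (structure)

text \<open>Strong Yetter--Drinfel'd modules over \<open>F\<close> with a compatible \<open>\<psi>\<^bsub>B,X\<^esub>\<close>.\<close>

definition YD_strong :: "('o, 'm, 'c) twocat \<Rightarrow> ('o, 'm, 'c) tambara
    \<Rightarrow> (('o, 'm, 'c) tambara_1cell, (('o, 'm, 'c) tambara_1cell, 'c) arrow) moncat"
  where "YD_strong K S = endo_moncat (Tambara_Bimnd K) S"


section \<open>Left relative modules\<close>

definition is_left_module ::
    "('o, 'm, 'c) twocat \<Rightarrow> ('o, 'm, 'c) monad \<Rightarrow> 'm \<Rightarrow> 'c \<Rightarrow> bool"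
  where
  "is_left_module K S M \<nu> \<longleftrightarrow>
    (let B = mnd_cell S in
      M \<in> Cell1 K \<and> Tgt1 K M = mnd_base S \<and> \<nu> \<in> hom2 K (B \<cdot> M) M \<and>
      \<nu> \<odot> (mnd_mult S \<lhd> M) = \<nu> \<odot> (B \<rhd> \<nu>) \<and> \<nu> \<odot> (mnd_unit S \<lhd> M) = Id2 K M)"
  for K (structure)

definition is_left_comodule ::
    "('o, 'm, 'c) twocat \<Rightarrow> ('o, 'm, 'c) comonad \<Rightarrow> 'm \<Rightarrow> 'c \<Rightarrow> bool"
  where
  "is_left_comodule K S M l \<longleftrightarrow>
    (let F = cmd_cell S in
      M \<in> Cell1 K \<and> Tgt1 K M = cmd_base S \<and> l \<in> hom2 K M (F \<cdot> M) \<and>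
      (cmd_comult S \<lhd> M) \<odot> l = (F \<rhd> l) \<odot> l \<and> (cmd_counit S \<lhd> M) \<odot> l = Id2 K M)"
  for K (structure)

record ('m, 'c) relmod =
  rm_cell  :: 'm
  rm_coact :: 'c    \<comment> \<open>\<open>\<lambda>\<^sub>M : M \<rightarrow> FM\<close>\<close>
  rm_act   :: 'c    \<comment> \<open>\<open>\<nu>\<^sub>M : BM \<rightarrow> M\<close>\<close>

text \<open>The source 0-cell of the underlying 1-cell is arbitrary.\<close>

definition is_relmod ::
    "('o, 'm, 'c) twocat \<Rightarrow> ('o, 'm, 'c) tambara \<Rightarrow> ('m, 'c) relmod \<Rightarrow> bool"
  where
  "is_relmod K S m \<longleftrightarrow>
    (let F = bi_cell (tb_F S); B = mnd_cell (tb_B S);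
         M = rm_cell m; l = rm_coact m; \<nu> = rm_act m in
      is_left_comodule K (bi_cmd (tb_F S)) M l \<and> is_left_module K (tb_B S) M \<nu> \<and>
      l \<odot> \<nu> = (F \<rhd> \<nu>) \<odot> (tb_psi S \<lhd> M) \<odot> (B \<rhd> l))"
  for K (structure)

definition is_relmod_mor ::
    "('o, 'm, 'c) twocat \<Rightarrow> ('o, 'm, 'c) tambara \<Rightarrow> (('m, 'c) relmod, 'c) arrow \<Rightarrow> bool"
  where
  "is_relmod_mor K S f \<longleftrightarrow>
    (let F = bi_cell (tb_F S); B = mnd_cell (tb_B S);
         m = ar_src f; n = ar_tgt f; h = ar_cell f in
      is_relmod K S m \<and> is_relmod K S n \<and> h \<in> hom2 K (rm_cell m) (rm_cell n) \<and>
      (F \<rhd> h) \<odot> rm_coact m = rm_coact n \<odot> h \<and>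
      h \<odot> rm_act m = rm_act n \<odot> (B \<rhd> h))"
  for K (structure)

definition RelMod :: "('o, 'm, 'c) twocat \<Rightarrow> ('o, 'm, 'c) tambara
    \<Rightarrow> (('m, 'c) relmod, (('m, 'c) relmod, 'c) arrow) cat"
  where
  "RelMod K S = make_cat {m. is_relmod K S m} {f. is_relmod_mor K S f} ar_src ar_tgt
     (\<lambda>m. \<lparr>ar_src = m, ar_tgt = m, ar_cell = Id2 K (rm_cell m)\<rparr>)
     (\<lambda>g f. \<lparr>ar_src = ar_src f, ar_tgt = ar_tgt g, ar_cell = ar_cell g \<odot> ar_cell f\<rparr>)"
  for K (structure)


section \<open>The assignment \<open>\<T>\<close> and the action on relative modules\<close>

text \<open>The 1-cell \<open>XM\<close> with its left \<open>F'\<close>-coaction and left \<open>B'\<close>-action.\<close>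

definition act_relmod ::
    "('o, 'm, 'c) twocat \<Rightarrow> ('o, 'm, 'c) tambara_1cell \<Rightarrow> ('m, 'c) relmod \<Rightarrow> ('m, 'c) relmod"
  where
  "act_relmod K x m =
    (let X = t1_cell x; M = rm_cell m in
      \<lparr>rm_cell = X \<cdot> M,
       rm_coact = (t1_phi x \<lhd> M) \<odot> (X \<rhd> rm_coact m),
       rm_act = (X \<rhd> rm_act m) \<odot> (t1_psiB x \<lhd> M)\<rparr>)"
  for K (structure)

definition T_map1 :: "('o, 'm, 'c) twocat \<Rightarrow> ('o, 'm, 'c) tambara_1cell
    \<Rightarrow> (('m, 'c) relmod, (('m, 'c) relmod, 'c) arrow, ('m, 'c) relmod, (('m, 'c) relmod, 'c) arrow) ftor"
  where
  "T_map1 K x =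
    \<lparr>fdom = RelMod K (t1_src x), fcod = RelMod K (t1_tgt x),
     fob = (\<lambda>m\<in>Obj (RelMod K (t1_src x)). act_relmod K x m),
     far = (\<lambda>f\<in>Arr (RelMod K (t1_src x)).
       \<lparr>ar_src = act_relmod K x (ar_src f), ar_tgt = act_relmod K x (ar_tgt f),
        ar_cell = t1_cell x \<rhd> ar_cell f\<rparr>)\<rparr>"
  for K (structure)

definition T_map2 :: "('o, 'm, 'c) twocat \<Rightarrow> (('o, 'm, 'c) tambara_1cell, 'c) arrow
    \<Rightarrow> (('m, 'c) relmod, (('m, 'c) relmod, 'c) arrow, ('m, 'c) relmod, (('m, 'c) relmod, 'c) arrow) ntrans"
  where
  "T_map2 K z =
    \<lparr>ndom = T_map1 K (ar_src z), ncod = T_map1 K (ar_tgt z),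
     nmap = (\<lambda>m\<in>Obj (RelMod K (t1_src (ar_src z))).
       \<lparr>ar_src = act_relmod K (ar_src z) m, ar_tgt = act_relmod K (ar_tgt z) m,
        ar_cell = ar_cell z \<lhd> rm_cell m\<rparr>)\<rparr>"
  for K (structure)

definition T_fun :: "('o, 'm, 'c) twocat \<Rightarrow>
    (('o, 'm, 'c) tambara, ('o, 'm, 'c) tambara_1cell, (('o, 'm, 'c) tambara_1cell, 'c) arrow,
     (('m, 'c) relmod, (('m, 'c) relmod, 'c) arrow) cat,
     (('m, 'c) relmod, (('m, 'c) relmod, 'c) arrow, ('m, 'c) relmod, (('m, 'c) relmod, 'c) arrow) ftor,
     (('m, 'c) relmod, (('m, 'c) relmod, 'c) arrow, ('m, 'c) relmod, (('m, 'c) relmod, 'c) arrow) ntrans)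
    two_map"
  where "T_fun K = \<lparr>On0 = RelMod K, On1 = T_map1 K, On2 = T_map2 K\<rparr>"

definition YD_action :: "('o, 'm, 'c) twocat \<Rightarrow> ('o, 'm, 'c) tambara
    \<Rightarrow> (('o, 'm, 'c) tambara_1cell \<times> ('m, 'c) relmod,
        (('o, 'm, 'c) tambara_1cell, 'c) arrow \<times> (('m, 'c) relmod, 'c) arrow,
        ('m, 'c) relmod, (('m, 'c) relmod, 'c) arrow) ftor"
  where
  "YD_action K S =
    \<lparr>fdom = prod_cat (under (YD_strong K S)) (RelMod K S), fcod = RelMod K S,
     fob = (\<lambda>(x, m)\<in>Obj (under (YD_strong K S)) \<times> Obj (RelMod K S). act_relmod K x m),
     far = (\<lambda>(z, f)\<in>Arr (under (YD_strong K S)) \<times> Arr (RelMod K S).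
       \<lparr>ar_src = act_relmod K (ar_src z) (ar_src f), ar_tgt = act_relmod K (ar_tgt z) (ar_tgt f),
        ar_cell = ar_cell z \<star> ar_cell f\<rparr>)\<rparr>"
  for K (structure)

end

theory Submission
  imports Defs
begin

text \<open>
  Forget the monad structure of \<open>F\<close>, \<open>\<lambda>\<close> and \<open>\<psi>\<^bsub>F,X\<^esub>\<close>. Then a left relative module with underlying
  1-cell \<open>M : \<D> \<rightarrow> \<A>\<close> is the same thing as a 1-cell \<open>(M, \<lambda>\<^sub>M, \<nu>\<^sub>M)\<close> into \<open>(\<A>, F, B, \<psi>\<^bsub>B,F\<^esub>)\<close> from the
  trivial structure on \<open>\<D>\<close>, in which \<open>F\<close> and \<open>B\<close> are identities, and a morphism of relative modules
  is a 2-cell between such 1-cells. So \<open>\<T>\<close> is a representable 2-functor: \<open>\<T>\<^sub>X\<close> is composition with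
  \<open>X\<close>, \<open>\<T>\<^sub>\<zeta>\<close> is whiskering with \<open>\<zeta>\<close>, and functoriality is associativity and interchange. The statement on
  actions is currying: a strict action of \<open>V\<close> on \<open>C\<close> amounts to a strict monoidal functor \<open>V \<rightarrow> Fun(C, C)\<close>.
\<close>

section \<open>Pasting in a 2-category\<close>

text \<open>A module \<open>M\<close> carries no \<open>F\<close>-action, so nothing can serve as
  \<psi>_{F,M} : FM -> M, and \<open>M\<close> is not a 1-cell of \<open>Tambara_Bimnd K\<close>
  itself. The representing object therefore lives in a wider setting, given by
  \<open>mixed_0cell\<close>, \<open>mixed_1cell\<close> and \<open>mixed_2cell\<close>. Closure of
  these cells under composition is proved once and used twice: for the corresponding part of Tambara
  cells and, with a trivial source, for objects and morphisms of \<open>RelMod\<close>. As the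
  source 0-cell of \<open>M\<close> is arbitrary, \<open>RelMod K S\<close> is the disjoint union,
  over all 0-cells, of hom categories out of trivial structures. Everything is strict and compared
  by HOL equality: (YX)M and Y(XM) must agree including coaction and action, and two functors agree
  only because their maps are extensional. In a pasting, two independent 2-cells have no preferred
  order, so normalisation by rewriting cannot decide these identities alone. The equational chains
  display the uses of the axioms and the exchanges; everything else is rewriting.\<close>

context two_category
begin

text \<open>The locale axioms are phrased with \<open>hom1 K a b\<close> and
  \<open>hom2 K X Y\<close>, whose intermediate ends occur only in premises and would have to be
  guessed. Here and in the lemmas that follow the ends are computed by \<open>Src1\<close>,
  \<open>Tgt1\<close>, \<open>Src2\<close>, \<open>Tgt2\<close>, so that typing a composite becomes
  conditional rewriting.\<close>

lemma comp1_cells: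
  assumes "X \<in> Cell1 K" "Y \<in> Cell1 K" "Src1 K Y = Tgt1 K X"
  shows "Y \<cdot> X \<in> Cell1 K" "Src1 K (Y \<cdot> X) = Src1 K X" "Tgt1 K (Y \<cdot> X) = Tgt1 K Y"
  using comp1[of X "Src1 K X" "Tgt1 K X" Y "Tgt1 K Y"] assms by (auto simp: hom1_def)

lemma id1_cells:
  assumes "a \<in> Cell0 K"
  shows "Id1 K a \<in> Cell1 K" "Src1 K (Id1 K a) = a" "Tgt1 K (Id1 K a) = a"
  using id1[OF assms] by (auto simp: hom1_def)

lemma comp1_id_eq:
  assumes "X \<in> Cell1 K"
  shows "Tgt1 K X = a \<Longrightarrow> Id1 K a \<cdot> X = X" "Src1 K X = a \<Longrightarrow> X \<cdot> Id1 K a = X"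
  using comp1_id_left[of X "Src1 K X" "Tgt1 K X"] comp1_id_right[of X "Src1 K X" "Tgt1 K X"] assms
  by (auto simp: hom1_def)

lemma comp1_assoc':
  assumes "X \<in> Cell1 K" "Y \<in> Cell1 K" "Z \<in> Cell1 K" "Src1 K Y = Tgt1 K X" "Src1 K Z = Tgt1 K Y"
  shows "(Z \<cdot> Y) \<cdot> X = Z \<cdot> (Y \<cdot> X)"
  using comp1_assoc[of X "Src1 K X" "Tgt1 K X" Y "Tgt1 K Y" Z "Tgt1 K Z"] assms
  by (auto simp: hom1_def)

lemma id2_cells:
  assumes "X \<in> Cell1 K"
  shows "Id2 K X \<in> Cell2 K" "Src2 K (Id2 K X) = X" "Tgt2 K (Id2 K X) = X"
  using id2[OF assms] by (auto simp: hom2_def)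

lemma vcomp_cells:
  assumes "\<alpha> \<in> Cell2 K" "\<beta> \<in> Cell2 K" "Src2 K \<beta> = Tgt2 K \<alpha>"
  shows "\<beta> \<odot> \<alpha> \<in> Cell2 K" "Src2 K (\<beta> \<odot> \<alpha>) = Src2 K \<alpha>" "Tgt2 K (\<beta> \<odot> \<alpha>) = Tgt2 K \<beta>"
  using vcomp[of \<alpha> "Src2 K \<alpha>" "Tgt2 K \<alpha>" \<beta> "Tgt2 K \<beta>"] assms by (auto simp: hom2_def)

lemma hcomp_cells:
  assumes "\<alpha> \<in> Cell2 K" "\<beta> \<in> Cell2 K" "Src1 K (Src2 K \<beta>) = Tgt1 K (Src2 K \<alpha>)"
  shows "\<beta> \<star> \<alpha> \<in> Cell2 K" "Src2 K (\<beta> \<star> \<alpha>) = Src2 K \<beta> \<cdot> Src2 K \<alpha>"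
    "Tgt2 K (\<beta> \<star> \<alpha>) = Tgt2 K \<beta> \<cdot> Tgt2 K \<alpha>"
  using hcomp[of "Src2 K \<alpha>" "Src1 K (Src2 K \<alpha>)" "Tgt1 K (Src2 K \<alpha>)" "Src2 K \<beta>"
      "Tgt1 K (Src2 K \<beta>)" \<alpha> "Tgt2 K \<alpha>" \<beta> "Tgt2 K \<beta>"] assms cell2_ends
  by (auto simp: hom1_def hom2_def)

lemma vcomp_id_eq:
  assumes "\<alpha> \<in> Cell2 K"
  shows "Tgt2 K \<alpha> = X \<Longrightarrow> Id2 K X \<odot> \<alpha> = \<alpha>" "Src2 K \<alpha> = X \<Longrightarrow> \<alpha> \<odot> Id2 K X = \<alpha>"
  using vcomp_id_left[of \<alpha> "Src2 K \<alpha>" "Tgt2 K \<alpha>"] vcomp_id_right[of \<alpha> "Src2 K \<alpha>" "Tgt2 K \<alpha>"] assms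
  by (auto simp: hom2_def)

lemma vcomp_assoc':
  assumes "\<alpha> \<in> Cell2 K" "\<beta> \<in> Cell2 K" "\<gamma> \<in> Cell2 K" "Src2 K \<beta> = Tgt2 K \<alpha>" "Src2 K \<gamma> = Tgt2 K \<beta>"
  shows "(\<gamma> \<odot> \<beta>) \<odot> \<alpha> = \<gamma> \<odot> (\<beta> \<odot> \<alpha>)"
  using vcomp_assoc[of \<alpha> "Src2 K \<alpha>" "Tgt2 K \<alpha>" \<beta> "Tgt2 K \<beta>" \<gamma> "Tgt2 K \<gamma>"] assms
  by (auto simp: hom2_def)

lemma hcomp_id1_eq:
  assumes "\<alpha> \<in> Cell2 K"
  shows "Tgt1 K (Src2 K \<alpha>) = a \<Longrightarrow> Id1 K a \<rhd> \<alpha> = \<alpha>" "Src1 K (Src2 K \<alpha>) = a \<Longrightarrow> \<alpha> \<lhd> Id1 K a = \<alpha>"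
  using hcomp_id_left[of "Src2 K \<alpha>" "Src1 K (Src2 K \<alpha>)" "Tgt1 K (Src2 K \<alpha>)" \<alpha>]
    hcomp_id_right[of "Src2 K \<alpha>" "Src1 K (Src2 K \<alpha>)" "Tgt1 K (Src2 K \<alpha>)" \<alpha>] assms cell2_ends
  by (auto simp: hom1_def hom2_def)

lemma hcomp_assoc':
  assumes "\<alpha> \<in> Cell2 K" "\<beta> \<in> Cell2 K" "\<gamma> \<in> Cell2 K"
    "Src1 K (Src2 K \<beta>) = Tgt1 K (Src2 K \<alpha>)" "Src1 K (Src2 K \<gamma>) = Tgt1 K (Src2 K \<beta>)"
  shows "(\<gamma> \<star> \<beta>) \<star> \<alpha> = \<gamma> \<star> (\<beta> \<star> \<alpha>)"
  using hcomp_assoc[of "Src2 K \<alpha>" "Src1 K (Src2 K \<alpha>)" "Tgt1 K (Src2 K \<alpha>)" "Src2 K \<beta>"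
      "Tgt1 K (Src2 K \<beta>)" "Src2 K \<gamma>" "Tgt1 K (Src2 K \<gamma>)" \<alpha> "Tgt2 K \<alpha>" \<beta> "Tgt2 K \<beta>" \<gamma> "Tgt2 K \<gamma>"]
    assms cell2_ends
  by (auto simp: hom1_def hom2_def)

lemma hcomp_id2':
  assumes "X \<in> Cell1 K" "Y \<in> Cell1 K" "Src1 K Y = Tgt1 K X"
  shows "Y \<rhd> Id2 K X = Id2 K (Y \<cdot> X)"
  using hcomp_id2[of X "Src1 K X" "Tgt1 K X" Y "Tgt1 K Y"] assms by (auto simp: hom1_def)

lemma interchange':
  assumes "\<alpha> \<in> Cell2 K" "\<alpha>' \<in> Cell2 K" "\<beta> \<in> Cell2 K" "\<beta>' \<in> Cell2 K"
    "Src2 K \<alpha>' = Tgt2 K \<alpha>" "Src2 K \<beta>' = Tgt2 K \<beta>" "Src1 K (Src2 K \<beta>) = Tgt1 K (Src2 K \<alpha>)"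
  shows "(\<beta>' \<odot> \<beta>) \<star> (\<alpha>' \<odot> \<alpha>) = (\<beta>' \<star> \<alpha>') \<odot> (\<beta> \<star> \<alpha>)"
  using interchange[of "Src2 K \<alpha>" "Src1 K (Src2 K \<alpha>)" "Tgt1 K (Src2 K \<alpha>)" "Src2 K \<beta>"
      "Tgt1 K (Src2 K \<beta>)" \<alpha> "Tgt2 K \<alpha>" \<alpha>' "Tgt2 K \<alpha>'" \<beta> "Tgt2 K \<beta>" \<beta>' "Tgt2 K \<beta>'"]
    assms cell2_ends
  by (auto simp: hom1_def hom2_def)

text \<open>Fixes a direction: the 0-cells bounding a 2-cell are always read off from its source
  1-cell. This is why \<open>hcomp_cells\<close> and \<open>interchange'\<close> state horizontal
  composability for \<open>Src2\<close> only.\<close>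

lemma tgt2_ends:
  assumes "\<alpha> \<in> Cell2 K"
  shows "Src1 K (Tgt2 K \<alpha>) = Src1 K (Src2 K \<alpha>)" "Tgt1 K (Tgt2 K \<alpha>) = Tgt1 K (Src2 K \<alpha>)"
    "Src2 K \<alpha> \<in> Cell1 K" "Tgt2 K \<alpha> \<in> Cell1 K"
  using cell2_parallel[OF assms] cell2_ends[OF assms] by auto

lemma lwhisk_vcomp:
  assumes "X \<in> Cell1 K" "\<alpha> \<in> Cell2 K" "\<beta> \<in> Cell2 K" "Src2 K \<beta> = Tgt2 K \<alpha>"
    "Src1 K X = Tgt1 K (Src2 K \<alpha>)"
  shows "X \<rhd> (\<beta> \<odot> \<alpha>) = (X \<rhd> \<beta>) \<odot> (X \<rhd> \<alpha>)"
  using interchange'[of \<alpha> \<beta> "Id2 K X" "Id2 K X"] assms by (simp add: id2_cells vcomp_id_eq)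

lemma rwhisk_vcomp:
  assumes "X \<in> Cell1 K" "\<alpha> \<in> Cell2 K" "\<beta> \<in> Cell2 K" "Src2 K \<beta> = Tgt2 K \<alpha>"
    "Src1 K (Src2 K \<alpha>) = Tgt1 K X"
  shows "(\<beta> \<odot> \<alpha>) \<lhd> X = (\<beta> \<lhd> X) \<odot> (\<alpha> \<lhd> X)"
  using interchange'[of "Id2 K X" "Id2 K X" \<alpha> \<beta>] assms by (simp add: id2_cells vcomp_id_eq)

lemma lwhisk_lwhisk:
  assumes "\<alpha> \<in> Cell2 K" "Y \<in> Cell1 K" "Z \<in> Cell1 K" "Src1 K Y = Tgt1 K (Src2 K \<alpha>)" "Src1 K Z = Tgt1 K Y"
  shows "Z \<rhd> (Y \<rhd> \<alpha>) = (Z \<cdot> Y) \<rhd> \<alpha>"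
  using hcomp_assoc'[of \<alpha> "Id2 K Y" "Id2 K Z"] assms by (simp add: id2_cells hcomp_id2')

lemma rwhisk_rwhisk:
  assumes "\<alpha> \<in> Cell2 K" "X \<in> Cell1 K" "Y \<in> Cell1 K" "Src1 K (Src2 K \<alpha>) = Tgt1 K Y" "Src1 K Y = Tgt1 K X"
  shows "(\<alpha> \<lhd> Y) \<lhd> X = \<alpha> \<lhd> (Y \<cdot> X)"
  using hcomp_assoc'[of "Id2 K X" "Id2 K Y" \<alpha>] assms by (simp add: id2_cells hcomp_id2')

lemma lwhisk_rwhisk:
  assumes "\<alpha> \<in> Cell2 K" "X \<in> Cell1 K" "Z \<in> Cell1 K" "Src1 K Z = Tgt1 K (Src2 K \<alpha>)"
    "Src1 K (Src2 K \<alpha>) = Tgt1 K X"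
  shows "(Z \<rhd> \<alpha>) \<lhd> X = Z \<rhd> (\<alpha> \<lhd> X)"
  using hcomp_assoc'[of "Id2 K X" \<alpha> "Id2 K Z"] assms by (simp add: id2_cells)

text \<open>Interchange after padding each factor with an identity, above or below. The two paddings
  give the two orders in which \<alpha> and \<beta> can be performed.\<close>

lemma hcomp_whisk:
  assumes "\<alpha> \<in> Cell2 K" "\<beta> \<in> Cell2 K" "Src1 K (Src2 K \<beta>) = Tgt1 K (Src2 K \<alpha>)"
  shows "\<beta> \<star> \<alpha> = (\<beta> \<lhd> Tgt2 K \<alpha>) \<odot> (Src2 K \<beta> \<rhd> \<alpha>)" "\<beta> \<star> \<alpha> = (Tgt2 K \<beta> \<rhd> \<alpha>) \<odot> (\<beta> \<lhd> Src2 K \<alpha>)"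
  using interchange'[of \<alpha> "Id2 K (Tgt2 K \<alpha>)" "Id2 K (Src2 K \<beta>)" \<beta>]
    interchange'[of "Id2 K (Src2 K \<alpha>)" \<alpha> \<beta> "Id2 K (Tgt2 K \<beta>)"] assms
  by (simp_all add: id2_cells vcomp_id_eq tgt2_ends)

lemmas cell_simps = comp1_cells id1_cells id2_cells vcomp_cells hcomp_cells

text \<open>Rewrites every pasting to a vertical composite, associated to the right, of 2-cells of the form
  \<open>X \<rhd> (\<alpha> \<lhd> Y)\<close>.\<close>

lemmas paste_simps = cell_simps comp1_id_eq comp1_assoc' vcomp_id_eq vcomp_assoc' hcomp_id1_eq hcomp_id2'
  lwhisk_vcomp rwhisk_vcomp lwhisk_lwhisk rwhisk_rwhisk lwhisk_rwhisk

text \<open>Both sides are \<beta> \<star> \<alpha>. The rule is kept out of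
  \<open>paste_simps\<close>, since neither order is a normal form; the pasting proofs state each
  exchange explicitly (\<open>swap\<close>, \<open>swap1\<close>, \<open>swap2\<close>).\<close>

lemma whisk_swap:
  assumes "\<alpha> \<in> hom2 K X X'" "\<beta> \<in> hom2 K Y Y'" "Src1 K Y = Tgt1 K X"
  shows "(\<beta> \<lhd> X') \<odot> (Y \<rhd> \<alpha>) = (Y' \<rhd> \<alpha>) \<odot> (\<beta> \<lhd> X)"
  using hcomp_whisk[of \<alpha> \<beta>] assms by (auto simp: hom2_def)

text \<open>The multiplication is pushed through \<open>q\<close> and then through \<open>p\<close>.
  After that both strands of \<open>B''\<close> cross \<open>Y\<close> before either crosses
  \<open>X\<close>; the single exchange \<open>swap\<close> lets the inner strand cross all of
  \<open>Y \<cdot> X\<close> before the outer one starts, which is the form required of the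
  composite.\<close>

lemma mnd_1cell_comp:
  assumes mnd: "is_monad K S" "is_monad K S'" "is_monad K S''"
    and x: "mnd_1cell K S S' X p" and y: "mnd_1cell K S' S'' Y q"
  shows "mnd_1cell K S S'' (Y \<cdot> X) ((Y \<rhd> p) \<odot> (q \<lhd> X))"
proof -
  let ?B = "mnd_cell S" and ?B' = "mnd_cell S'" and ?B'' = "mnd_cell S''"
  let ?\<mu> = "mnd_mult S" and ?\<mu>' = "mnd_mult S'" and ?\<mu>'' = "mnd_mult S''"
  let ?\<eta> = "mnd_unit S" and ?\<eta>' = "mnd_unit S'" and ?\<eta>'' = "mnd_unit S''"
  have [simp]: "X \<in> Cell1 K" "Src1 K X = mnd_base S" "Tgt1 K X = mnd_base S'"
    "Y \<in> Cell1 K" "Src1 K Y = mnd_base S'" "Tgt1 K Y = mnd_base S''"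
    "p \<in> Cell2 K" "Src2 K p = ?B' \<cdot> X" "Tgt2 K p = X \<cdot> ?B"
    "q \<in> Cell2 K" "Src2 K q = ?B'' \<cdot> Y" "Tgt2 K q = Y \<cdot> ?B'"
    using x y by (auto simp: mnd_1cell_def Let_def hom1_def hom2_def)
  have [simp]: "U \<in> {S, S', S''} \<Longrightarrow> mnd_base U \<in> Cell0 K \<and> mnd_cell U \<in> Cell1 K \<and>
    Src1 K (mnd_cell U) = mnd_base U \<and> Tgt1 K (mnd_cell U) = mnd_base U \<and>
    mnd_mult U \<in> Cell2 K \<and> Src2 K (mnd_mult U) = mnd_cell U \<cdot> mnd_cell U \<and> Tgt2 K (mnd_mult U) = mnd_cell U \<and>
    mnd_unit U \<in> Cell2 K \<and> Src2 K (mnd_unit U) = Id1 K (mnd_base U) \<and> Tgt2 K (mnd_unit U) = mnd_cell U" for U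
    using mnd by (auto simp: is_monad_def Let_def hom1_def hom2_def)
  have p: "p \<odot> (?\<mu>' \<lhd> X) = (X \<rhd> ?\<mu>) \<odot> (p \<lhd> ?B) \<odot> (?B' \<rhd> p)" "p \<odot> (?\<eta>' \<lhd> X) = X \<rhd> ?\<eta>"
    and q: "q \<odot> (?\<mu>'' \<lhd> Y) = (Y \<rhd> ?\<mu>') \<odot> (q \<lhd> ?B') \<odot> (?B'' \<rhd> q)" "q \<odot> (?\<eta>'' \<lhd> Y) = Y \<rhd> ?\<eta>'"
    using x y by (auto simp: mnd_1cell_def Let_def)
  have swap: "(q \<lhd> (X \<cdot> ?B)) \<odot> ((?B'' \<cdot> Y) \<rhd> p) = ((Y \<cdot> ?B') \<rhd> p) \<odot> (q \<lhd> (?B' \<cdot> X))"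
    by (rule whisk_swap) (auto simp: hom2_def cell_simps)
  have "(Y \<rhd> p) \<odot> (q \<lhd> X) \<odot> (?\<mu>'' \<lhd> (Y \<cdot> X)) = (Y \<rhd> p) \<odot> ((q \<odot> (?\<mu>'' \<lhd> Y)) \<lhd> X)"
    by (simp add: paste_simps)
  also have "\<dots> = (Y \<rhd> (p \<odot> (?\<mu>' \<lhd> X))) \<odot> (q \<lhd> (?B' \<cdot> X)) \<odot> (?B'' \<rhd> (q \<lhd> X))"
    unfolding q by (simp add: paste_simps)
  also have "\<dots> = ((Y \<cdot> X) \<rhd> ?\<mu>) \<odot> (Y \<rhd> (p \<lhd> ?B)) \<odot> (((Y \<cdot> ?B') \<rhd> p) \<odot> (q \<lhd> (?B' \<cdot> X))) \<odot> (?B'' \<rhd> (q \<lhd> X))"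
    unfolding p by (simp add: paste_simps)
  also have "\<dots> = ((Y \<cdot> X) \<rhd> ?\<mu>) \<odot> (((Y \<rhd> p) \<odot> (q \<lhd> X)) \<lhd> ?B) \<odot> (?B'' \<rhd> ((Y \<rhd> p) \<odot> (q \<lhd> X)))"
    unfolding swap[symmetric] by (simp add: paste_simps)
  finally have mult: "(Y \<rhd> p) \<odot> (q \<lhd> X) \<odot> (?\<mu>'' \<lhd> (Y \<cdot> X)) = \<dots>" .
  have "(Y \<rhd> p) \<odot> (q \<lhd> X) \<odot> (?\<eta>'' \<lhd> (Y \<cdot> X)) = (Y \<rhd> p) \<odot> ((q \<odot> (?\<eta>'' \<lhd> Y)) \<lhd> X)"
    by (simp add: paste_simps)
  also have "\<dots> = Y \<rhd> (p \<odot> (?\<eta>' \<lhd> X))"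
    unfolding q by (simp add: paste_simps)
  also have "\<dots> = (Y \<cdot> X) \<rhd> ?\<eta>"
    unfolding p by (simp add: paste_simps)
  finally show ?thesis
    using mult by (simp add: mnd_1cell_def Let_def hom1_def hom2_def cell_simps comp1_assoc')
qed

text \<open>Formally \<open>mnd_1cell_comp\<close> with all 2-cells reversed, which turns
  \<open>p : XF -> F'X\<close> into a cell of monad type. The pasting is written out again rather
  than transported along the duality.\<close>

lemma comnd_1cell_comp:
  assumes cmd: "is_comonad K S" "is_comonad K S'" "is_comonad K S''"
    and x: "comnd_1cell K S S' X p" and y: "comnd_1cell K S' S'' Y q"
  shows "comnd_1cell K S S'' (Y \<cdot> X) ((q \<lhd> X) \<odot> (Y \<rhd> p))"
proof -
  let ?F = "cmd_cell S" and ?F' = "cmd_cell S'" and ?F'' = "cmd_cell S''"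
  let ?\<Delta> = "cmd_comult S" and ?\<Delta>' = "cmd_comult S'" and ?\<Delta>'' = "cmd_comult S''"
  let ?\<epsilon> = "cmd_counit S" and ?\<epsilon>' = "cmd_counit S'" and ?\<epsilon>'' = "cmd_counit S''"
  have [simp]: "X \<in> Cell1 K" "Src1 K X = cmd_base S" "Tgt1 K X = cmd_base S'"
    "Y \<in> Cell1 K" "Src1 K Y = cmd_base S'" "Tgt1 K Y = cmd_base S''"
    "p \<in> Cell2 K" "Src2 K p = X \<cdot> ?F" "Tgt2 K p = ?F' \<cdot> X"
    "q \<in> Cell2 K" "Src2 K q = Y \<cdot> ?F'" "Tgt2 K q = ?F'' \<cdot> Y"
    using x y by (auto simp: comnd_1cell_def Let_def hom1_def hom2_def)
  have [simp]: "U \<in> {S, S', S''} \<Longrightarrow> cmd_base U \<in> Cell0 K \<and> cmd_cell U \<in> Cell1 K \<and>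
    Src1 K (cmd_cell U) = cmd_base U \<and> Tgt1 K (cmd_cell U) = cmd_base U \<and>
    cmd_comult U \<in> Cell2 K \<and> Src2 K (cmd_comult U) = cmd_cell U \<and>
    Tgt2 K (cmd_comult U) = cmd_cell U \<cdot> cmd_cell U \<and>
    cmd_counit U \<in> Cell2 K \<and> Src2 K (cmd_counit U) = cmd_cell U \<and>
    Tgt2 K (cmd_counit U) = Id1 K (cmd_base U)" for U
    using cmd by (auto simp: is_comonad_def Let_def hom1_def hom2_def)
  have p: "(?\<Delta>' \<lhd> X) \<odot> p = (?F' \<rhd> p) \<odot> (p \<lhd> ?F) \<odot> (X \<rhd> ?\<Delta>)" "(?\<epsilon>' \<lhd> X) \<odot> p = X \<rhd> ?\<epsilon>"
    and q: "(?\<Delta>'' \<lhd> Y) \<odot> q = (?F'' \<rhd> q) \<odot> (q \<lhd> ?F') \<odot> (Y \<rhd> ?\<Delta>')" "(?\<epsilon>'' \<lhd> Y) \<odot> q = Y \<rhd> ?\<epsilon>'"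
    using x y by (auto simp: comnd_1cell_def Let_def)
  have swap: "(q \<lhd> (?F' \<cdot> X)) \<odot> ((Y \<cdot> ?F') \<rhd> p) = ((?F'' \<cdot> Y) \<rhd> p) \<odot> (q \<lhd> (X \<cdot> ?F))"
    by (rule whisk_swap) (auto simp: hom2_def cell_simps)
  have "(?\<Delta>'' \<lhd> (Y \<cdot> X)) \<odot> ((q \<lhd> X) \<odot> (Y \<rhd> p)) = (((?\<Delta>'' \<lhd> Y) \<odot> q) \<lhd> X) \<odot> (Y \<rhd> p)"
    by (simp add: paste_simps)
  also have "\<dots> = (?F'' \<rhd> (q \<lhd> X)) \<odot> (q \<lhd> (?F' \<cdot> X)) \<odot> (Y \<rhd> ((?\<Delta>' \<lhd> X) \<odot> p))"
    unfolding q by (simp add: paste_simps)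
  also have "\<dots> = (?F'' \<rhd> (q \<lhd> X)) \<odot> ((q \<lhd> (?F' \<cdot> X)) \<odot> ((Y \<cdot> ?F') \<rhd> p)) \<odot> (Y \<rhd> (p \<lhd> ?F)) \<odot> ((Y \<cdot> X) \<rhd> ?\<Delta>)"
    unfolding p by (simp add: paste_simps)
  also have "\<dots> = (?F'' \<rhd> ((q \<lhd> X) \<odot> (Y \<rhd> p))) \<odot> (((q \<lhd> X) \<odot> (Y \<rhd> p)) \<lhd> ?F) \<odot> ((Y \<cdot> X) \<rhd> ?\<Delta>)"
    unfolding swap by (simp add: paste_simps)
  finally have comult: "(?\<Delta>'' \<lhd> (Y \<cdot> X)) \<odot> ((q \<lhd> X) \<odot> (Y \<rhd> p)) = \<dots>" .
  have "(?\<epsilon>'' \<lhd> (Y \<cdot> X)) \<odot> ((q \<lhd> X) \<odot> (Y \<rhd> p)) = (((?\<epsilon>'' \<lhd> Y) \<odot> q) \<lhd> X) \<odot> (Y \<rhd> p)"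
    by (simp add: paste_simps)
  also have "\<dots> = Y \<rhd> ((?\<epsilon>' \<lhd> X) \<odot> p)"
    unfolding q by (simp add: paste_simps)
  also have "\<dots> = (Y \<cdot> X) \<rhd> ?\<epsilon>"
    unfolding p by (simp add: paste_simps)
  finally show ?thesis
    using comult by (simp add: comnd_1cell_def Let_def hom1_def hom2_def cell_simps comp1_assoc')
qed

text \<open>Common form of the bimonad condition (with \<open>B = F\<close>, \<open>t = \<lambda>\<close>) and of the compatibility of
  \<open>\<phi>\<close> with \<open>\<psi>\<^bsub>B,F\<^esub>\<close>.\<close>

lemma mixed_hexagon_comp:
  assumes X: "X \<in> hom1 K a a'" and Y: "Y \<in> hom1 K a' a''"
    and F: "F \<in> hom1 K a a" "F' \<in> hom1 K a' a'" "F'' \<in> hom1 K a'' a''"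
    and B: "B \<in> hom1 K a a" "B' \<in> hom1 K a' a'" "B'' \<in> hom1 K a'' a''"
    and t: "t \<in> hom2 K (B \<cdot> F) (F \<cdot> B)" "t' \<in> hom2 K (B' \<cdot> F') (F' \<cdot> B')"
      "t'' \<in> hom2 K (B'' \<cdot> F'') (F'' \<cdot> B'')"
    and f: "f \<in> hom2 K (X \<cdot> F) (F' \<cdot> X)" "g \<in> hom2 K (Y \<cdot> F') (F'' \<cdot> Y)"
    and s: "s \<in> hom2 K (B' \<cdot> X) (X \<cdot> B)" "r \<in> hom2 K (B'' \<cdot> Y) (Y \<cdot> B')"
    and x: "(f \<lhd> B) \<odot> (X \<rhd> t) \<odot> (s \<lhd> F) = (F' \<rhd> s) \<odot> (t' \<lhd> X) \<odot> (B' \<rhd> f)"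
    and y: "(g \<lhd> B') \<odot> (Y \<rhd> t') \<odot> (r \<lhd> F') = (F'' \<rhd> r) \<odot> (t'' \<lhd> Y) \<odot> (B'' \<rhd> g)"
  shows "(((g \<lhd> X) \<odot> (Y \<rhd> f)) \<lhd> B) \<odot> ((Y \<cdot> X) \<rhd> t) \<odot> (((Y \<rhd> s) \<odot> (r \<lhd> X)) \<lhd> F)
    = (F'' \<rhd> ((Y \<rhd> s) \<odot> (r \<lhd> X))) \<odot> (t'' \<lhd> (Y \<cdot> X)) \<odot> (B'' \<rhd> ((g \<lhd> X) \<odot> (Y \<rhd> f)))"
    (is "?L = ?R")
proof -
  note typing [simp] = X[unfolded hom1_def, simplified] Y[unfolded hom1_def, simplified]
    F[unfolded hom1_def, simplified] B[unfolded hom1_def, simplified]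
    t[unfolded hom2_def, simplified] f[unfolded hom2_def, simplified] s[unfolded hom2_def, simplified]
  \<comment> \<open>Once the hexagon of \<open>x\<close> has been applied inside \<open>Y\<close>,
    the cell \<open>f\<close> has to pass \<open>r\<close> and the cell \<open>s\<close> has to pass
    \<open>g\<close>. What then remains in the middle is the left side of the hexagon of
    \<open>y\<close>, whiskered with \<open>X\<close>.\<close>
  have swap1: "(r \<lhd> (F' \<cdot> X)) \<odot> ((B'' \<cdot> Y) \<rhd> f) = ((Y \<cdot> B') \<rhd> f) \<odot> (r \<lhd> (X \<cdot> F))"
    using f s by (intro whisk_swap) (auto simp: cell_simps)
  have swap2: "(g \<lhd> (X \<cdot> B)) \<odot> ((Y \<cdot> F') \<rhd> s) = ((F'' \<cdot> Y) \<rhd> s) \<odot> (g \<lhd> (B' \<cdot> X))"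
    using f s by (intro whisk_swap) (auto simp: cell_simps)
  have "?L = (g \<lhd> (X \<cdot> B)) \<odot> (Y \<rhd> ((f \<lhd> B) \<odot> (X \<rhd> t) \<odot> (s \<lhd> F))) \<odot> (r \<lhd> (X \<cdot> F))"
    by (simp add: paste_simps)
  also have "\<dots> = ((g \<lhd> (X \<cdot> B)) \<odot> ((Y \<cdot> F') \<rhd> s)) \<odot> (Y \<rhd> (t' \<lhd> X)) \<odot> (((Y \<cdot> B') \<rhd> f) \<odot> (r \<lhd> (X \<cdot> F)))"
    unfolding x by (simp add: paste_simps)
  also have "\<dots> = ((F'' \<cdot> Y) \<rhd> s) \<odot> (((g \<lhd> B') \<odot> (Y \<rhd> t') \<odot> (r \<lhd> F')) \<lhd> X) \<odot> ((B'' \<cdot> Y) \<rhd> f)"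
    unfolding swap1[symmetric] swap2 by (simp add: paste_simps)
  also have "\<dots> = ?R"
    unfolding y by (simp add: paste_simps)
  finally show ?thesis .
qed

text \<open>The hypothesis \<open>x\<close> is a Yang-Baxter equation for \<open>B'\<close>,
  \<open>F'\<close>, \<open>X\<close>: both \<open>f\<close> and \<open>s\<close> now move
  \<open>X\<close> to the left. For invertible \<open>f\<close> it would be the hypothesis of
  \<open>mixed_hexagon_comp\<close> for the inverse of \<open>f\<close>. In general the direction of
  \<open>f\<close> matters, so the pasting is done separately; it serves the compatibility of
  \<psi>_{F,X} with \<psi>_{B,X}.\<close>

lemma mnd_hexagon_comp:
  assumes X: "X \<in> hom1 K a a'" and Y: "Y \<in> hom1 K a' a''"
    and F: "F \<in> hom1 K a a" "F' \<in> hom1 K a' a'" "F'' \<in> hom1 K a'' a''"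
    and B: "B \<in> hom1 K a a" "B' \<in> hom1 K a' a'" "B'' \<in> hom1 K a'' a''"
    and t: "t \<in> hom2 K (B \<cdot> F) (F \<cdot> B)" "t' \<in> hom2 K (B' \<cdot> F') (F' \<cdot> B')"
      "t'' \<in> hom2 K (B'' \<cdot> F'') (F'' \<cdot> B'')"
    and f: "f \<in> hom2 K (F' \<cdot> X) (X \<cdot> F)" "g \<in> hom2 K (F'' \<cdot> Y) (Y \<cdot> F')"
    and s: "s \<in> hom2 K (B' \<cdot> X) (X \<cdot> B)" "r \<in> hom2 K (B'' \<cdot> Y) (Y \<cdot> B')"
    and x: "(X \<rhd> t) \<odot> (s \<lhd> F) \<odot> (B' \<rhd> f) = (f \<lhd> B) \<odot> (F' \<rhd> s) \<odot> (t' \<lhd> X)"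
    and y: "(Y \<rhd> t') \<odot> (r \<lhd> F') \<odot> (B'' \<rhd> g) = (g \<lhd> B') \<odot> (F'' \<rhd> r) \<odot> (t'' \<lhd> Y)"
  shows "((Y \<cdot> X) \<rhd> t) \<odot> (((Y \<rhd> s) \<odot> (r \<lhd> X)) \<lhd> F) \<odot> (B'' \<rhd> ((Y \<rhd> f) \<odot> (g \<lhd> X)))
    = (((Y \<rhd> f) \<odot> (g \<lhd> X)) \<lhd> B) \<odot> (F'' \<rhd> ((Y \<rhd> s) \<odot> (r \<lhd> X))) \<odot> (t'' \<lhd> (Y \<cdot> X))"
    (is "?L = ?R")
proof -
  note typing [simp] = X[unfolded hom1_def, simplified] Y[unfolded hom1_def, simplified]
    F[unfolded hom1_def, simplified] B[unfolded hom1_def, simplified]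
    t[unfolded hom2_def, simplified] f[unfolded hom2_def, simplified] s[unfolded hom2_def, simplified]
  have swap1: "(r \<lhd> (X \<cdot> F)) \<odot> ((B'' \<cdot> Y) \<rhd> f) = ((Y \<cdot> B') \<rhd> f) \<odot> (r \<lhd> (F' \<cdot> X))"
    using f s by (intro whisk_swap) (auto simp: cell_simps)
  have swap2: "(g \<lhd> (X \<cdot> B)) \<odot> ((F'' \<cdot> Y) \<rhd> s) = ((Y \<cdot> F') \<rhd> s) \<odot> (g \<lhd> (B' \<cdot> X))"
    using f s by (intro whisk_swap) (auto simp: cell_simps)
  have "?L = ((Y \<cdot> X) \<rhd> t) \<odot> (Y \<rhd> (s \<lhd> F)) \<odot> ((r \<lhd> (X \<cdot> F)) \<odot> ((B'' \<cdot> Y) \<rhd> f)) \<odot> (B'' \<rhd> (g \<lhd> X))"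
    by (simp add: paste_simps)
  also have "\<dots> = (Y \<rhd> ((X \<rhd> t) \<odot> (s \<lhd> F) \<odot> (B' \<rhd> f))) \<odot> (r \<lhd> (F' \<cdot> X)) \<odot> (B'' \<rhd> (g \<lhd> X))"
    unfolding swap1 by (simp add: paste_simps)
  also have "\<dots> = (Y \<rhd> (f \<lhd> B)) \<odot> ((Y \<cdot> F') \<rhd> s) \<odot> (((Y \<rhd> t') \<odot> (r \<lhd> F') \<odot> (B'' \<rhd> g)) \<lhd> X)"
    unfolding x by (simp add: paste_simps)
  also have "\<dots> = (Y \<rhd> (f \<lhd> B)) \<odot> (((Y \<cdot> F') \<rhd> s) \<odot> (g \<lhd> (B' \<cdot> X))) \<odot> (F'' \<rhd> (r \<lhd> X)) \<odot> (t'' \<lhd> (Y \<cdot> X))"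
    unfolding y by (simp add: paste_simps)
  also have "\<dots> = ?R"
    unfolding swap2[symmetric] by (simp add: paste_simps)
  finally show ?thesis .
qed

section \<open>Vertical and horizontal composites of 2-cells of monads and comonads\<close>

lemma mnd_2cell_vcomp:
  assumes "is_monad K S" "is_monad K S'"
    and "mnd_1cell K S S' X p" "mnd_1cell K S S' Y q" "mnd_1cell K S S' Z r"
    and z: "mnd_2cell K S S' X p Y q \<zeta>" and w: "mnd_2cell K S S' Y q Z r \<xi>"
  shows "mnd_2cell K S S' X p Z r (\<xi> \<odot> \<zeta>)"
proof -
  let ?B = "mnd_cell S" and ?B' = "mnd_cell S'"
  have [simp]: "X \<in> Cell1 K" "Src1 K X = mnd_base S" "Tgt1 K X = mnd_base S'"
    "Y \<in> Cell1 K" "Src1 K Y = mnd_base S" "Tgt1 K Y = mnd_base S'"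
    "Z \<in> Cell1 K" "Src1 K Z = mnd_base S" "Tgt1 K Z = mnd_base S'"
    "p \<in> Cell2 K" "Src2 K p = ?B' \<cdot> X" "Tgt2 K p = X \<cdot> ?B"
    "q \<in> Cell2 K" "Src2 K q = ?B' \<cdot> Y" "Tgt2 K q = Y \<cdot> ?B"
    "r \<in> Cell2 K" "Src2 K r = ?B' \<cdot> Z" "Tgt2 K r = Z \<cdot> ?B"
    "\<zeta> \<in> Cell2 K" "Src2 K \<zeta> = X" "Tgt2 K \<zeta> = Y" "\<xi> \<in> Cell2 K" "Src2 K \<xi> = Y" "Tgt2 K \<xi> = Z"
    "?B \<in> Cell1 K" "Src1 K ?B = mnd_base S" "Tgt1 K ?B = mnd_base S"
    "?B' \<in> Cell1 K" "Src1 K ?B' = mnd_base S'" "Tgt1 K ?B' = mnd_base S'"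
    using assms by (auto simp: mnd_1cell_def mnd_2cell_def is_monad_def Let_def hom1_def hom2_def)
  have \<zeta>: "(\<zeta> \<lhd> ?B) \<odot> p = q \<odot> (?B' \<rhd> \<zeta>)" and \<xi>: "(\<xi> \<lhd> ?B) \<odot> q = r \<odot> (?B' \<rhd> \<xi>)"
    using z w by (auto simp: mnd_2cell_def)
  have "((\<xi> \<odot> \<zeta>) \<lhd> ?B) \<odot> p = (\<xi> \<lhd> ?B) \<odot> ((\<zeta> \<lhd> ?B) \<odot> p)"
    by (simp add: paste_simps)
  also have "\<dots> = ((\<xi> \<lhd> ?B) \<odot> q) \<odot> (?B' \<rhd> \<zeta>)"
    unfolding \<zeta> by (simp add: paste_simps)
  also have "\<dots> = r \<odot> (?B' \<rhd> (\<xi> \<odot> \<zeta>))"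
    unfolding \<xi> by (simp add: paste_simps)
  finally show ?thesis
    by (simp add: mnd_2cell_def hom2_def cell_simps)
qed

lemma comnd_2cell_vcomp:
  assumes "is_comonad K S" "is_comonad K S'"
    and "comnd_1cell K S S' X p" "comnd_1cell K S S' Y q" "comnd_1cell K S S' Z r"
    and z: "comnd_2cell K S S' X p Y q \<zeta>" and w: "comnd_2cell K S S' Y q Z r \<xi>"
  shows "comnd_2cell K S S' X p Z r (\<xi> \<odot> \<zeta>)"
proof -
  let ?F = "cmd_cell S" and ?F' = "cmd_cell S'"
  have [simp]: "X \<in> Cell1 K" "Src1 K X = cmd_base S" "Tgt1 K X = cmd_base S'"
    "Y \<in> Cell1 K" "Src1 K Y = cmd_base S" "Tgt1 K Y = cmd_base S'"
    "Z \<in> Cell1 K" "Src1 K Z = cmd_base S" "Tgt1 K Z = cmd_base S'"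
    "p \<in> Cell2 K" "Src2 K p = X \<cdot> ?F" "Tgt2 K p = ?F' \<cdot> X"
    "q \<in> Cell2 K" "Src2 K q = Y \<cdot> ?F" "Tgt2 K q = ?F' \<cdot> Y"
    "r \<in> Cell2 K" "Src2 K r = Z \<cdot> ?F" "Tgt2 K r = ?F' \<cdot> Z"
    "\<zeta> \<in> Cell2 K" "Src2 K \<zeta> = X" "Tgt2 K \<zeta> = Y" "\<xi> \<in> Cell2 K" "Src2 K \<xi> = Y" "Tgt2 K \<xi> = Z"
    "?F \<in> Cell1 K" "Src1 K ?F = cmd_base S" "Tgt1 K ?F = cmd_base S"
    "?F' \<in> Cell1 K" "Src1 K ?F' = cmd_base S'" "Tgt1 K ?F' = cmd_base S'"
    using assms by (auto simp: comnd_1cell_def comnd_2cell_def is_comonad_def Let_def hom1_def hom2_def)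
  have \<zeta>: "(?F' \<rhd> \<zeta>) \<odot> p = q \<odot> (\<zeta> \<lhd> ?F)" and \<xi>: "(?F' \<rhd> \<xi>) \<odot> q = r \<odot> (\<xi> \<lhd> ?F)"
    using z w by (auto simp: comnd_2cell_def)
  have "(?F' \<rhd> (\<xi> \<odot> \<zeta>)) \<odot> p = (?F' \<rhd> \<xi>) \<odot> ((?F' \<rhd> \<zeta>) \<odot> p)"
    by (simp add: paste_simps)
  also have "\<dots> = ((?F' \<rhd> \<xi>) \<odot> q) \<odot> (\<zeta> \<lhd> ?F)"
    unfolding \<zeta> by (simp add: paste_simps)
  also have "\<dots> = r \<odot> ((\<xi> \<odot> \<zeta>) \<lhd> ?F)"
    unfolding \<xi> by (simp add: paste_simps)
  finally show ?thesis
    by (simp add: comnd_2cell_def hom2_def cell_simps)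
qed

lemma mnd_2cell_hcomp:
  assumes "is_monad K S" "is_monad K S'" "is_monad K S''"
    and "mnd_1cell K S S' X p" "mnd_1cell K S S' X' p'" "mnd_1cell K S' S'' Y q" "mnd_1cell K S' S'' Y' q'"
    and z: "mnd_2cell K S S' X p X' p' \<zeta>" and w: "mnd_2cell K S' S'' Y q Y' q' \<xi>"
  shows "mnd_2cell K S S'' (Y \<cdot> X) ((Y \<rhd> p) \<odot> (q \<lhd> X)) (Y' \<cdot> X') ((Y' \<rhd> p') \<odot> (q' \<lhd> X')) (\<xi> \<star> \<zeta>)"
proof -
  let ?B = "mnd_cell S" and ?B' = "mnd_cell S'" and ?B'' = "mnd_cell S''"
  have [simp]: "X \<in> Cell1 K" "Src1 K X = mnd_base S" "Tgt1 K X = mnd_base S'"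
    "X' \<in> Cell1 K" "Src1 K X' = mnd_base S" "Tgt1 K X' = mnd_base S'"
    "Y \<in> Cell1 K" "Src1 K Y = mnd_base S'" "Tgt1 K Y = mnd_base S''"
    "Y' \<in> Cell1 K" "Src1 K Y' = mnd_base S'" "Tgt1 K Y' = mnd_base S''"
    "p \<in> Cell2 K" "Src2 K p = ?B' \<cdot> X" "Tgt2 K p = X \<cdot> ?B"
    "p' \<in> Cell2 K" "Src2 K p' = ?B' \<cdot> X'" "Tgt2 K p' = X' \<cdot> ?B"
    "q \<in> Cell2 K" "Src2 K q = ?B'' \<cdot> Y" "Tgt2 K q = Y \<cdot> ?B'"
    "q' \<in> Cell2 K" "Src2 K q' = ?B'' \<cdot> Y'" "Tgt2 K q' = Y' \<cdot> ?B'"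
    "\<zeta> \<in> Cell2 K" "Src2 K \<zeta> = X" "Tgt2 K \<zeta> = X'" "\<xi> \<in> Cell2 K" "Src2 K \<xi> = Y" "Tgt2 K \<xi> = Y'"
    "?B \<in> Cell1 K" "Src1 K ?B = mnd_base S" "Tgt1 K ?B = mnd_base S"
    "?B' \<in> Cell1 K" "Src1 K ?B' = mnd_base S'" "Tgt1 K ?B' = mnd_base S'"
    "?B'' \<in> Cell1 K" "Src1 K ?B'' = mnd_base S''" "Tgt1 K ?B'' = mnd_base S''"
    using assms by (auto simp: mnd_1cell_def mnd_2cell_def is_monad_def Let_def hom1_def hom2_def)
  have \<zeta>: "(\<zeta> \<lhd> ?B) \<odot> p = p' \<odot> (?B' \<rhd> \<zeta>)" and \<xi>: "(\<xi> \<lhd> ?B') \<odot> q = q' \<odot> (?B'' \<rhd> \<xi>)"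
    using z w by (auto simp: mnd_2cell_def)
  \<comment> \<open>Of the two orders this one puts \<zeta> directly after \<open>p\<close>, so that
    the 2-cell law of \<zeta> applies at once.\<close>
  have h: "\<xi> \<star> \<zeta> = (\<xi> \<lhd> X') \<odot> (Y \<rhd> \<zeta>)"
    using hcomp_whisk(1)[of \<zeta> \<xi>] by simp
  have swap1: "(q \<lhd> X') \<odot> ((?B'' \<cdot> Y) \<rhd> \<zeta>) = ((Y \<cdot> ?B') \<rhd> \<zeta>) \<odot> (q \<lhd> X)"
    by (rule whisk_swap) (auto simp: hom2_def cell_simps)
  have swap2: "(\<xi> \<lhd> (X' \<cdot> ?B)) \<odot> (Y \<rhd> p') = (Y' \<rhd> p') \<odot> (\<xi> \<lhd> (?B' \<cdot> X'))"
    by (rule whisk_swap) (auto simp: hom2_def cell_simps)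
  have "((\<xi> \<star> \<zeta>) \<lhd> ?B) \<odot> ((Y \<rhd> p) \<odot> (q \<lhd> X)) = (\<xi> \<lhd> (X' \<cdot> ?B)) \<odot> (Y \<rhd> ((\<zeta> \<lhd> ?B) \<odot> p)) \<odot> (q \<lhd> X)"
    unfolding h by (simp add: paste_simps)
  also have "\<dots> = ((\<xi> \<lhd> (X' \<cdot> ?B)) \<odot> (Y \<rhd> p')) \<odot> (((Y \<cdot> ?B') \<rhd> \<zeta>) \<odot> (q \<lhd> X))"
    unfolding \<zeta> by (simp add: paste_simps)
  also have "\<dots> = (Y' \<rhd> p') \<odot> (((\<xi> \<lhd> ?B') \<odot> q) \<lhd> X') \<odot> ((?B'' \<cdot> Y) \<rhd> \<zeta>)"
    unfolding swap1[symmetric] swap2 by (simp add: paste_simps)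
  also have "\<dots> = ((Y' \<rhd> p') \<odot> (q' \<lhd> X')) \<odot> (?B'' \<rhd> (\<xi> \<star> \<zeta>))"
    unfolding \<xi> h by (simp add: paste_simps)
  finally show ?thesis
    by (simp add: mnd_2cell_def hom2_def cell_simps)
qed

lemma comnd_2cell_hcomp:
  assumes "is_comonad K S" "is_comonad K S'" "is_comonad K S''"
    and "comnd_1cell K S S' X p" "comnd_1cell K S S' X' p'"
    and "comnd_1cell K S' S'' Y q" "comnd_1cell K S' S'' Y' q'"
    and z: "comnd_2cell K S S' X p X' p' \<zeta>" and w: "comnd_2cell K S' S'' Y q Y' q' \<xi>"
  shows "comnd_2cell K S S'' (Y \<cdot> X) ((q \<lhd> X) \<odot> (Y \<rhd> p)) (Y' \<cdot> X') ((q' \<lhd> X') \<odot> (Y' \<rhd> p')) (\<xi> \<star> \<zeta>)"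
proof -
  let ?F = "cmd_cell S" and ?F' = "cmd_cell S'" and ?F'' = "cmd_cell S''"
  have [simp]: "X \<in> Cell1 K" "Src1 K X = cmd_base S" "Tgt1 K X = cmd_base S'"
    "X' \<in> Cell1 K" "Src1 K X' = cmd_base S" "Tgt1 K X' = cmd_base S'"
    "Y \<in> Cell1 K" "Src1 K Y = cmd_base S'" "Tgt1 K Y = cmd_base S''"
    "Y' \<in> Cell1 K" "Src1 K Y' = cmd_base S'" "Tgt1 K Y' = cmd_base S''"
    "p \<in> Cell2 K" "Src2 K p = X \<cdot> ?F" "Tgt2 K p = ?F' \<cdot> X"
    "p' \<in> Cell2 K" "Src2 K p' = X' \<cdot> ?F" "Tgt2 K p' = ?F' \<cdot> X'"
    "q \<in> Cell2 K" "Src2 K q = Y \<cdot> ?F'" "Tgt2 K q = ?F'' \<cdot> Y"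
    "q' \<in> Cell2 K" "Src2 K q' = Y' \<cdot> ?F'" "Tgt2 K q' = ?F'' \<cdot> Y'"
    "\<zeta> \<in> Cell2 K" "Src2 K \<zeta> = X" "Tgt2 K \<zeta> = X'" "\<xi> \<in> Cell2 K" "Src2 K \<xi> = Y" "Tgt2 K \<xi> = Y'"
    "?F \<in> Cell1 K" "Src1 K ?F = cmd_base S" "Tgt1 K ?F = cmd_base S"
    "?F' \<in> Cell1 K" "Src1 K ?F' = cmd_base S'" "Tgt1 K ?F' = cmd_base S'"
    "?F'' \<in> Cell1 K" "Src1 K ?F'' = cmd_base S''" "Tgt1 K ?F'' = cmd_base S''"
    using assms by (auto simp: comnd_1cell_def comnd_2cell_def is_comonad_def Let_def hom1_def hom2_def)
  have \<zeta>: "(?F' \<rhd> \<zeta>) \<odot> p = p' \<odot> (\<zeta> \<lhd> ?F)" and \<xi>: "(?F'' \<rhd> \<xi>) \<odot> q = q' \<odot> (\<xi> \<lhd> ?F')"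
    using z w by (auto simp: comnd_2cell_def)
  \<comment> \<open>The opposite order to the monad case: the composite structure cell now ends with
    \<open>q\<close>, so \<xi> has to be the factor that meets it first.\<close>
  have h: "\<xi> \<star> \<zeta> = (Y' \<rhd> \<zeta>) \<odot> (\<xi> \<lhd> X)"
    using hcomp_whisk(2)[of \<zeta> \<xi>] by simp
  have swap1: "(\<xi> \<lhd> (?F' \<cdot> X)) \<odot> (Y \<rhd> p) = (Y' \<rhd> p) \<odot> (\<xi> \<lhd> (X \<cdot> ?F))"
    by (rule whisk_swap) (auto simp: hom2_def cell_simps)
  have swap2: "(q' \<lhd> X') \<odot> ((Y' \<cdot> ?F') \<rhd> \<zeta>) = ((?F'' \<cdot> Y') \<rhd> \<zeta>) \<odot> (q' \<lhd> X)"
    by (rule whisk_swap) (auto simp: hom2_def cell_simps)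
  have "(?F'' \<rhd> (\<xi> \<star> \<zeta>)) \<odot> ((q \<lhd> X) \<odot> (Y \<rhd> p)) = ((?F'' \<cdot> Y') \<rhd> \<zeta>) \<odot> (((?F'' \<rhd> \<xi>) \<odot> q) \<lhd> X) \<odot> (Y \<rhd> p)"
    unfolding h by (simp add: paste_simps)
  also have "\<dots> = (((?F'' \<cdot> Y') \<rhd> \<zeta>) \<odot> (q' \<lhd> X)) \<odot> ((\<xi> \<lhd> (?F' \<cdot> X)) \<odot> (Y \<rhd> p))"
    unfolding \<xi> by (simp add: paste_simps)
  also have "\<dots> = (q' \<lhd> X') \<odot> (Y' \<rhd> ((?F' \<rhd> \<zeta>) \<odot> p)) \<odot> (\<xi> \<lhd> (X \<cdot> ?F))"
    unfolding swap1 swap2[symmetric] by (simp add: paste_simps)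
  also have "\<dots> = ((q' \<lhd> X') \<odot> (Y' \<rhd> p')) \<odot> ((\<xi> \<star> \<zeta>) \<lhd> ?F)"
    unfolding \<zeta> h by (simp add: paste_simps)
  finally show ?thesis
    by (simp add: comnd_2cell_def hom2_def cell_simps)
qed

end

section \<open>Tambara bimonads form a 2-category\<close>

lemma bi_mnd_simps [simp]:
  "mnd_base (bi_mnd F) = bi_base F" "mnd_cell (bi_mnd F) = bi_cell F"
  "mnd_mult (bi_mnd F) = bi_mult F" "mnd_unit (bi_mnd F) = bi_unit F"
  by (simp_all add: bi_mnd_def)

lemma bi_cmd_simps [simp]:
  "cmd_base (bi_cmd F) = bi_base F" "cmd_cell (bi_cmd F) = bi_cell F"
  "cmd_comult (bi_cmd F) = bi_comult F" "cmd_counit (bi_cmd F) = bi_counit F"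
  by (simp_all add: bi_cmd_def)

text \<open>The part of the Tambara structure seen by relative modules, i.e. without the monad structure
  of \<open>F\<close>, \<open>\<lambda>\<close> and \<open>\<psi>\<^bsub>F,X\<^esub>\<close>.\<close>

definition mixed_0cell :: "('o, 'm, 'c) twocat \<Rightarrow> ('o, 'm, 'c) tambara \<Rightarrow> bool"
  where
  "mixed_0cell K S \<longleftrightarrow>
    is_comonad K (bi_cmd (tb_F S)) \<and> is_monad K (tb_B S) \<and> mnd_base (tb_B S) = bi_base (tb_F S) \<and>
    tb_psi S \<in> hom2 K (mnd_cell (tb_B S) \<cdot> bi_cell (tb_F S)) (bi_cell (tb_F S) \<cdot> mnd_cell (tb_B S))"
  for K (structure)

text \<open>The data are passed unbundled because they come from two different records,
  \<open>tambara_1cell\<close> and \<open>relmod\<close>. The hexagon is oriented so that for a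
  trivial source it reads as the compatibility of coaction and action in
  \<open>is_relmod\<close>.\<close>

definition mixed_1cell :: "('o, 'm, 'c) twocat \<Rightarrow> ('o, 'm, 'c) tambara \<Rightarrow> ('o, 'm, 'c) tambara
    \<Rightarrow> 'm \<Rightarrow> 'c \<Rightarrow> 'c \<Rightarrow> bool"
  where
  "mixed_1cell K S S' X f s \<longleftrightarrow>
    comnd_1cell K (bi_cmd (tb_F S)) (bi_cmd (tb_F S')) X f \<and> mnd_1cell K (tb_B S) (tb_B S') X s \<and>
    (f \<lhd> mnd_cell (tb_B S)) \<odot> (X \<rhd> tb_psi S) \<odot> (s \<lhd> bi_cell (tb_F S)) =
    (bi_cell (tb_F S') \<rhd> s) \<odot> (tb_psi S' \<lhd> X) \<odot> (mnd_cell (tb_B S') \<rhd> f)"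
  for K (structure)

definition mixed_2cell :: "('o, 'm, 'c) twocat \<Rightarrow> ('o, 'm, 'c) tambara \<Rightarrow> ('o, 'm, 'c) tambara
    \<Rightarrow> 'm \<Rightarrow> 'c \<Rightarrow> 'c \<Rightarrow> 'm \<Rightarrow> 'c \<Rightarrow> 'c \<Rightarrow> 'c \<Rightarrow> bool"
  where
  "mixed_2cell K S S' X f s Y g r \<zeta> \<longleftrightarrow>
    comnd_2cell K (bi_cmd (tb_F S)) (bi_cmd (tb_F S')) X f Y g \<zeta> \<and>
    mnd_2cell K (tb_B S) (tb_B S') X s Y r \<zeta>"

context two_category
begin

lemma mixed_0cell_cells:
  assumes "mixed_0cell K S"
  shows "bi_base (tb_F S) \<in> Cell0 K" "mnd_base (tb_B S) = bi_base (tb_F S)"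
    "bi_cell (tb_F S) \<in> hom1 K (bi_base (tb_F S)) (bi_base (tb_F S))"
    "mnd_cell (tb_B S) \<in> hom1 K (bi_base (tb_F S)) (bi_base (tb_F S))"
    "tb_psi S \<in> hom2 K (mnd_cell (tb_B S) \<cdot> bi_cell (tb_F S)) (bi_cell (tb_F S) \<cdot> mnd_cell (tb_B S))"
  using assms by (auto simp: mixed_0cell_def is_comonad_def is_monad_def Let_def)

lemma mixed_1cell_cells:
  assumes "mixed_1cell K S S' X f s"
  shows "X \<in> hom1 K (bi_base (tb_F S)) (bi_base (tb_F S'))"
    "f \<in> hom2 K (X \<cdot> bi_cell (tb_F S)) (bi_cell (tb_F S') \<cdot> X)"
    "s \<in> hom2 K (mnd_cell (tb_B S') \<cdot> X) (X \<cdot> mnd_cell (tb_B S))"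
  using assms by (auto simp: mixed_1cell_def comnd_1cell_def mnd_1cell_def Let_def)

lemma mixed_1cell_comp:
  assumes S: "mixed_0cell K S" "mixed_0cell K S'" "mixed_0cell K S''"
    and x: "mixed_1cell K S S' X f s" and y: "mixed_1cell K S' S'' Y g r"
  shows "mixed_1cell K S S'' (Y \<cdot> X) ((g \<lhd> X) \<odot> (Y \<rhd> f)) ((Y \<rhd> s) \<odot> (r \<lhd> X))"
proof -
  have "comnd_1cell K (bi_cmd (tb_F S)) (bi_cmd (tb_F S'')) (Y \<cdot> X) ((g \<lhd> X) \<odot> (Y \<rhd> f))"
    using S x y comnd_1cell_comp by (auto simp: mixed_0cell_def mixed_1cell_def)
  moreover have "mnd_1cell K (tb_B S) (tb_B S'') (Y \<cdot> X) ((Y \<rhd> s) \<odot> (r \<lhd> X))"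
    using S x y mnd_1cell_comp by (auto simp: mixed_0cell_def mixed_1cell_def)
  moreover note mixed_hexagon_comp[OF mixed_1cell_cells(1)[OF x] mixed_1cell_cells(1)[OF y]
      S[THEN mixed_0cell_cells(3)] S[THEN mixed_0cell_cells(4)] S[THEN mixed_0cell_cells(5)]
      mixed_1cell_cells(2)[OF x] mixed_1cell_cells(2)[OF y] mixed_1cell_cells(3)[OF x]
      mixed_1cell_cells(3)[OF y]]
  ultimately show ?thesis
    using x y unfolding mixed_1cell_def by blast
qed

lemma mixed_2cell_vcomp:
  assumes "mixed_0cell K S" "mixed_0cell K S'"
    and "mixed_1cell K S S' X f s" "mixed_1cell K S S' Y g r" "mixed_1cell K S S' Z h t"
    and "mixed_2cell K S S' X f s Y g r \<zeta>" "mixed_2cell K S S' Y g r Z h t \<xi>"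
  shows "mixed_2cell K S S' X f s Z h t (\<xi> \<odot> \<zeta>)"
  using assms mnd_2cell_vcomp comnd_2cell_vcomp
  unfolding mixed_0cell_def mixed_1cell_def mixed_2cell_def by blast

lemma mixed_2cell_hcomp:
  assumes "mixed_0cell K S" "mixed_0cell K S'" "mixed_0cell K S''"
    and "mixed_1cell K S S' X f s" "mixed_1cell K S S' X' f' s'"
    and "mixed_1cell K S' S'' Y g r" "mixed_1cell K S' S'' Y' g' r'"
    and "mixed_2cell K S S' X f s X' f' s' \<zeta>" "mixed_2cell K S' S'' Y g r Y' g' r' \<xi>"
  shows "mixed_2cell K S S'' (Y \<cdot> X) ((g \<lhd> X) \<odot> (Y \<rhd> f)) ((Y \<rhd> s) \<odot> (r \<lhd> X))
    (Y' \<cdot> X') ((g' \<lhd> X') \<odot> (Y' \<rhd> f')) ((Y' \<rhd> s') \<odot> (r' \<lhd> X')) (\<xi> \<star> \<zeta>)"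
  using assms unfolding mixed_0cell_def mixed_1cell_def mixed_2cell_def
  by (blast intro: mnd_2cell_hcomp comnd_2cell_hcomp)

lemma mixed_2cell_id:
  assumes "mixed_0cell K S" "mixed_0cell K S'" "mixed_1cell K S S' X f s"
  shows "mixed_2cell K S S' X f s X f s (Id2 K X)"
proof -
  note assms(1)[THEN mixed_0cell_cells(3), unfolded hom1_def, simplified, simp]
    assms(2)[THEN mixed_0cell_cells(3), unfolded hom1_def, simplified, simp]
    assms(1)[THEN mixed_0cell_cells(4), unfolded hom1_def, simplified, simp]
    assms(2)[THEN mixed_0cell_cells(4), unfolded hom1_def, simplified, simp]
    mixed_1cell_cells[OF assms(3), unfolded hom1_def hom2_def, simplified, simp]
  show ?thesis
    by (simp add: mixed_2cell_def mnd_2cell_def comnd_2cell_def hom2_def paste_simps)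
qed

section \<open>Tambara cells as mixed cells with a compatible \<psi>_F\<close>

lemma tambara_mixed_0cell: "is_tambara K S \<Longrightarrow> mixed_0cell K S"
  by (auto simp: is_tambara_def mixed_0cell_def is_bimonad_def mnd_1cell_def Let_def)

text \<open>Regroups the conditions so that everything free of \<psi>_{F,X} is one
  \<open>mixed_1cell\<close>, to which the closure lemmas apply as a block. The three remaining
  clauses on the cells are those that involve \<open>t1_psiF\<close>.\<close>

lemma tambara_1cell_iff:
  "is_tambara_1cell K x \<longleftrightarrow>
    (let S = t1_src x; S' = t1_tgt x; X = t1_cell x;
         F = bi_cell (tb_F S); F' = bi_cell (tb_F S'); B = mnd_cell (tb_B S); B' = mnd_cell (tb_B S');
         p = t1_psiF x; f = t1_phi x; s = t1_psiB x in
      is_tambara K S \<and> is_tambara K S' \<and> mixed_1cell K S S' X f s \<and>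
      mnd_1cell K (bi_mnd (tb_F S)) (bi_mnd (tb_F S')) X p \<and>
      (f \<lhd> F) \<odot> (X \<rhd> bi_lambda (tb_F S)) \<odot> (p \<lhd> F) = (F' \<rhd> p) \<odot> (bi_lambda (tb_F S') \<lhd> X) \<odot> (F' \<rhd> f) \<and>
      (X \<rhd> tb_psi S) \<odot> (s \<lhd> F) \<odot> (B' \<rhd> p) = (p \<lhd> B) \<odot> (F' \<rhd> s) \<odot> (tb_psi S' \<lhd> X))"
  unfolding is_tambara_1cell_def mixed_1cell_def bimnd_1cell_def Let_def by (metis (no_types))

lemma tambara_2cell_iff:
  "is_tambara_2cell K z \<longleftrightarrow>
    (let x = ar_src z; y = ar_tgt z; S = t1_src x; S' = t1_tgt x in
      is_tambara_1cell K x \<and> is_tambara_1cell K y \<and> t1_src y = S \<and> t1_tgt y = S' \<and>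
      mixed_2cell K S S' (t1_cell x) (t1_phi x) (t1_psiB x) (t1_cell y) (t1_phi y) (t1_psiB y) (ar_cell z) \<and>
      mnd_2cell K (bi_mnd (tb_F S)) (bi_mnd (tb_F S'))
        (t1_cell x) (t1_psiF x) (t1_cell y) (t1_psiF y) (ar_cell z))"
  unfolding is_tambara_2cell_def mixed_2cell_def bimnd_2cell_def Let_def by blast

lemma tambara_cells:
  assumes "is_tambara K S"
  shows "bi_base (tb_F S) \<in> Cell0 K" "mnd_base (tb_B S) = bi_base (tb_F S)"
    "bi_cell (tb_F S) \<in> Cell1 K" "Src1 K (bi_cell (tb_F S)) = bi_base (tb_F S)"
    "Tgt1 K (bi_cell (tb_F S)) = bi_base (tb_F S)"
    "mnd_cell (tb_B S) \<in> Cell1 K" "Src1 K (mnd_cell (tb_B S)) = bi_base (tb_F S)"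
    "Tgt1 K (mnd_cell (tb_B S)) = bi_base (tb_F S)"
    "tb_psi S \<in> Cell2 K" "Src2 K (tb_psi S) = mnd_cell (tb_B S) \<cdot> bi_cell (tb_F S)"
    "Tgt2 K (tb_psi S) = bi_cell (tb_F S) \<cdot> mnd_cell (tb_B S)"
    "bi_lambda (tb_F S) \<in> Cell2 K" "Src2 K (bi_lambda (tb_F S)) = bi_cell (tb_F S) \<cdot> bi_cell (tb_F S)"
    "Tgt2 K (bi_lambda (tb_F S)) = bi_cell (tb_F S) \<cdot> bi_cell (tb_F S)"
  using assms
  by (auto simp: is_tambara_def is_bimonad_def is_monad_def mnd_1cell_def Let_def hom1_def hom2_def)

lemma tambara_1cell_cells:
  assumes "is_tambara_1cell K x"
  shows "is_tambara K (t1_src x)" "is_tambara K (t1_tgt x)"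
    "t1_cell x \<in> Cell1 K" "Src1 K (t1_cell x) = bi_base (tb_F (t1_src x))"
    "Tgt1 K (t1_cell x) = bi_base (tb_F (t1_tgt x))"
    "t1_psiF x \<in> Cell2 K" "Src2 K (t1_psiF x) = bi_cell (tb_F (t1_tgt x)) \<cdot> t1_cell x"
    "Tgt2 K (t1_psiF x) = t1_cell x \<cdot> bi_cell (tb_F (t1_src x))"
    "t1_phi x \<in> Cell2 K" "Src2 K (t1_phi x) = t1_cell x \<cdot> bi_cell (tb_F (t1_src x))"
    "Tgt2 K (t1_phi x) = bi_cell (tb_F (t1_tgt x)) \<cdot> t1_cell x"
    "t1_psiB x \<in> Cell2 K" "Src2 K (t1_psiB x) = mnd_cell (tb_B (t1_tgt x)) \<cdot> t1_cell x"
    "Tgt2 K (t1_psiB x) = t1_cell x \<cdot> mnd_cell (tb_B (t1_src x))"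
  using assms
  by (auto simp: is_tambara_1cell_def bimnd_1cell_def mnd_1cell_def comnd_1cell_def Let_def hom1_def hom2_def)

lemma tambara_2cell_cells:
  assumes "is_tambara_2cell K z"
  shows "is_tambara_1cell K (ar_src z)" "is_tambara_1cell K (ar_tgt z)"
    "t1_src (ar_tgt z) = t1_src (ar_src z)" "t1_tgt (ar_tgt z) = t1_tgt (ar_src z)"
    "ar_cell z \<in> Cell2 K" "Src2 K (ar_cell z) = t1_cell (ar_src z)" "Tgt2 K (ar_cell z) = t1_cell (ar_tgt z)"
  using assms by (auto simp: is_tambara_2cell_def mnd_2cell_def Let_def hom2_def)

lemmas tambara_simps = tambara_cells tambara_1cell_cells tambara_2cell_cells

lemma tambara_comp1_simps:
  "t1_src (tambara_comp1 K y x) = t1_src x" "t1_tgt (tambara_comp1 K y x) = t1_tgt y"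
  "t1_cell (tambara_comp1 K y x) = t1_cell y \<cdot> t1_cell x"
  "t1_psiF (tambara_comp1 K y x) = (t1_cell y \<rhd> t1_psiF x) \<odot> (t1_psiF y \<lhd> t1_cell x)"
  "t1_phi (tambara_comp1 K y x) = (t1_phi y \<lhd> t1_cell x) \<odot> (t1_cell y \<rhd> t1_phi x)"
  "t1_psiB (tambara_comp1 K y x) = (t1_cell y \<rhd> t1_psiB x) \<odot> (t1_psiB y \<lhd> t1_cell x)"
  by (simp_all add: tambara_comp1_def Let_def)

lemma tambara_1cell_id:
  assumes "is_tambara K S"
  shows "is_tambara_1cell K (tambara_id1 K S)"
proof -
  note tambara_cells[OF assms, simp]
  have [simp]: "bi_mult (tb_F S) \<in> Cell2 K" "Src2 K (bi_mult (tb_F S)) = bi_cell (tb_F S) \<cdot> bi_cell (tb_F S)"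
    "Tgt2 K (bi_mult (tb_F S)) = bi_cell (tb_F S)"
    "bi_unit (tb_F S) \<in> Cell2 K" "Src2 K (bi_unit (tb_F S)) = Id1 K (bi_base (tb_F S))"
    "Tgt2 K (bi_unit (tb_F S)) = bi_cell (tb_F S)"
    "bi_comult (tb_F S) \<in> Cell2 K" "Tgt2 K (bi_comult (tb_F S)) = bi_cell (tb_F S) \<cdot> bi_cell (tb_F S)"
    "Src2 K (bi_comult (tb_F S)) = bi_cell (tb_F S)"
    "bi_counit (tb_F S) \<in> Cell2 K" "Tgt2 K (bi_counit (tb_F S)) = Id1 K (bi_base (tb_F S))"
    "Src2 K (bi_counit (tb_F S)) = bi_cell (tb_F S)"
    "mnd_mult (tb_B S) \<in> Cell2 K" "Src2 K (mnd_mult (tb_B S)) = mnd_cell (tb_B S) \<cdot> mnd_cell (tb_B S)"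
    "Tgt2 K (mnd_mult (tb_B S)) = mnd_cell (tb_B S)"
    "mnd_unit (tb_B S) \<in> Cell2 K" "Src2 K (mnd_unit (tb_B S)) = Id1 K (bi_base (tb_F S))"
    "Tgt2 K (mnd_unit (tb_B S)) = mnd_cell (tb_B S)"
    using assms
    by (auto simp: is_tambara_def is_bimonad_def is_monad_def is_comonad_def Let_def hom2_def)
  show ?thesis
    using assms
    by (simp add: tambara_id1_def is_tambara_1cell_def bimnd_1cell_def mnd_1cell_def comnd_1cell_def
        Let_def hom1_def hom2_def paste_simps)
qed

lemma tambara_1cell_comp:
  assumes x: "is_tambara_1cell K x" and y: "is_tambara_1cell K y" and xy: "t1_src y = t1_tgt x"
  shows "is_tambara_1cell K (tambara_comp1 K y x)"
proof -
  let ?F = "\<lambda>S. bi_cell (tb_F S)" and ?B = "\<lambda>S. mnd_cell (tb_B S)" and ?a = "\<lambda>S. bi_base (tb_F S)"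
  let ?S = "t1_src x" and ?S' = "t1_tgt x" and ?S'' = "t1_tgt y"
  have S: "is_tambara K ?S" "is_tambara K ?S'" "is_tambara K ?S''"
    using x y by (simp_all add: tambara_simps)
  have F: "?F ?S \<in> hom1 K (?a ?S) (?a ?S)" "?F ?S' \<in> hom1 K (?a ?S') (?a ?S')" "?F ?S'' \<in> hom1 K (?a ?S'') (?a ?S'')"
    and B: "?B ?S \<in> hom1 K (?a ?S) (?a ?S)" "?B ?S' \<in> hom1 K (?a ?S') (?a ?S')" "?B ?S'' \<in> hom1 K (?a ?S'') (?a ?S'')"
    and X: "t1_cell x \<in> hom1 K (?a ?S) (?a ?S')" and Y: "t1_cell y \<in> hom1 K (?a ?S') (?a ?S'')"
    and psiF: "t1_psiF x \<in> hom2 K (?F ?S' \<cdot> t1_cell x) (t1_cell x \<cdot> ?F ?S)"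
      "t1_psiF y \<in> hom2 K (?F ?S'' \<cdot> t1_cell y) (t1_cell y \<cdot> ?F ?S')"
    and phi: "t1_phi x \<in> hom2 K (t1_cell x \<cdot> ?F ?S) (?F ?S' \<cdot> t1_cell x)"
      "t1_phi y \<in> hom2 K (t1_cell y \<cdot> ?F ?S') (?F ?S'' \<cdot> t1_cell y)"
    and psiB: "t1_psiB x \<in> hom2 K (?B ?S' \<cdot> t1_cell x) (t1_cell x \<cdot> ?B ?S)"
      "t1_psiB y \<in> hom2 K (?B ?S'' \<cdot> t1_cell y) (t1_cell y \<cdot> ?B ?S')"
    and lam: "bi_lambda (tb_F ?S) \<in> hom2 K (?F ?S \<cdot> ?F ?S) (?F ?S \<cdot> ?F ?S)"
      "bi_lambda (tb_F ?S') \<in> hom2 K (?F ?S' \<cdot> ?F ?S') (?F ?S' \<cdot> ?F ?S')"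
      "bi_lambda (tb_F ?S'') \<in> hom2 K (?F ?S'' \<cdot> ?F ?S'') (?F ?S'' \<cdot> ?F ?S'')"
    and psi: "tb_psi ?S \<in> hom2 K (?B ?S \<cdot> ?F ?S) (?F ?S \<cdot> ?B ?S)"
      "tb_psi ?S' \<in> hom2 K (?B ?S' \<cdot> ?F ?S') (?F ?S' \<cdot> ?B ?S')"
      "tb_psi ?S'' \<in> hom2 K (?B ?S'' \<cdot> ?F ?S'') (?F ?S'' \<cdot> ?B ?S'')"
    using x y xy S by (simp_all add: hom1_def hom2_def tambara_simps)
  note xs = x[unfolded tambara_1cell_iff Let_def] and ys = y[unfolded tambara_1cell_iff Let_def xy]
  have "mixed_1cell K ?S ?S'' (t1_cell y \<cdot> t1_cell x)
      ((t1_phi y \<lhd> t1_cell x) \<odot> (t1_cell y \<rhd> t1_phi x)) ((t1_cell y \<rhd> t1_psiB x) \<odot> (t1_psiB y \<lhd> t1_cell x))"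
    using mixed_1cell_comp S[THEN tambara_mixed_0cell] xs ys by blast
  moreover have "mnd_1cell K (bi_mnd (tb_F ?S)) (bi_mnd (tb_F ?S'')) (t1_cell y \<cdot> t1_cell x)
      ((t1_cell y \<rhd> t1_psiF x) \<odot> (t1_psiF y \<lhd> t1_cell x))"
    using S mnd_1cell_comp xs ys by (metis (no_types) is_tambara_def is_bimonad_def)
  \<comment> \<open>The bimonad condition is the mixed hexagon with \<open>B = F\<close>,
    \<open>t = bi_lambda\<close> and \<open>s = t1_psiF\<close>. The compatibility of the two
    monad-type cells is \<open>mnd_hexagon_comp\<close> with \<open>t = tb_psi\<close>.\<close>
  ultimately show ?thesis
    unfolding tambara_1cell_iff Let_def tambara_comp1_simps
    using S xs ys mixed_hexagon_comp[OF X Y F F lam phi psiF] mnd_hexagon_comp[OF X Y F B psi psiF psiB]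
    by simp
qed

lemma tambara_2cell_id:
  assumes x: "is_tambara_1cell K x"
  shows "is_tambara_2cell K \<lparr>ar_src = x, ar_tgt = x, ar_cell = Id2 K (t1_cell x)\<rparr>"
  using x
  by (simp add: is_tambara_2cell_def bimnd_2cell_def mnd_2cell_def comnd_2cell_def Let_def hom2_def
      tambara_simps paste_simps)

lemma tambara_2cell_vcomp:
  assumes z: "is_tambara_2cell K z" and w: "is_tambara_2cell K w" and zw: "ar_src w = ar_tgt z"
  shows "is_tambara_2cell K \<lparr>ar_src = ar_src z, ar_tgt = ar_tgt w, ar_cell = ar_cell w \<odot> ar_cell z\<rparr>"
proof -
  note zs = z[unfolded tambara_2cell_iff Let_def] and ws = w[unfolded tambara_2cell_iff Let_def zw]
  have S: "is_tambara K (t1_src (ar_src z))" "is_tambara K (t1_tgt (ar_src z))"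
    using z by (simp_all add: tambara_simps)
  \<comment> \<open>\<open>mixed_2cell\<close> and \<open>mnd_2cell\<close> do not record that their
    ends are 1-cells, while the composition lemmas have this as premises; it is extracted here for
    all three 1-cells.\<close>
  note x = conjunct1[OF zs, unfolded tambara_1cell_iff Let_def]
    and y = conjunct1[OF conjunct2[OF zs], unfolded tambara_1cell_iff Let_def]
    and v = conjunct1[OF conjunct2[OF ws], unfolded tambara_1cell_iff Let_def]
  have ends: "t1_src (ar_tgt z) = t1_src (ar_src z)" "t1_tgt (ar_tgt z) = t1_tgt (ar_src z)"
    "t1_src (ar_tgt w) = t1_src (ar_src z)" "t1_tgt (ar_tgt w) = t1_tgt (ar_src z)"
    using zs ws by auto
  have monads: "is_monad K (bi_mnd (tb_F (t1_src (ar_src z))))" "is_monad K (bi_mnd (tb_F (t1_tgt (ar_src z))))"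
    using S by (auto simp: is_tambara_def is_bimonad_def Let_def)
  show ?thesis
    unfolding tambara_2cell_iff Let_def
    using zs ws x y v ends mixed_2cell_vcomp[OF S[THEN tambara_mixed_0cell]] mnd_2cell_vcomp[OF monads]
    by simp blast
qed

lemma tambara_2cell_hcomp:
  assumes z: "is_tambara_2cell K z" and w: "is_tambara_2cell K w" and zw: "t1_src (ar_src w) = t1_tgt (ar_src z)"
  shows "is_tambara_2cell K \<lparr>ar_src = tambara_comp1 K (ar_src w) (ar_src z),
    ar_tgt = tambara_comp1 K (ar_tgt w) (ar_tgt z), ar_cell = ar_cell w \<star> ar_cell z\<rparr>"
proof -
  note zs = z[unfolded tambara_2cell_iff Let_def] and ws = w[unfolded tambara_2cell_iff Let_def zw]
  have S: "is_tambara K (t1_src (ar_src z))" "is_tambara K (t1_tgt (ar_src z))" "is_tambara K (t1_tgt (ar_src w))"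
    using z w by (simp_all add: tambara_simps)
  have ends: "t1_src (ar_tgt z) = t1_src (ar_src z)" "t1_tgt (ar_tgt z) = t1_tgt (ar_src z)"
    "t1_src (ar_src w) = t1_tgt (ar_src z)" "t1_src (ar_tgt w) = t1_tgt (ar_src z)"
    "t1_tgt (ar_tgt w) = t1_tgt (ar_src w)"
    using zs ws zw by auto
  have cells: "is_tambara_1cell K (ar_src z)" "is_tambara_1cell K (ar_tgt z)"
    "is_tambara_1cell K (ar_src w)" "is_tambara_1cell K (ar_tgt w)"
    using zs ws by auto
  note c = cells[unfolded tambara_1cell_iff Let_def ends]
  have monads: "is_monad K (bi_mnd (tb_F (t1_src (ar_src z))))" "is_monad K (bi_mnd (tb_F (t1_tgt (ar_src z))))"
    "is_monad K (bi_mnd (tb_F (t1_tgt (ar_src w))))"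
    using S by (auto simp: is_tambara_def is_bimonad_def Let_def)
  show ?thesis
    unfolding tambara_2cell_iff Let_def
    using zs ws c ends cells tambara_1cell_comp mixed_2cell_hcomp[OF S[THEN tambara_mixed_0cell]]
      mnd_2cell_hcomp[OF monads]
    by (simp add: tambara_comp1_simps)
qed

lemma tambara_id1_simps:
  "t1_src (tambara_id1 K S) = S" "t1_tgt (tambara_id1 K S) = S"
  "t1_cell (tambara_id1 K S) = Id1 K (bi_base (tb_F S))"
  by (simp_all add: tambara_id1_def)

lemma tambara_comp1_unit:
  assumes "is_tambara_1cell K x"
  shows "t1_tgt x = S \<Longrightarrow> tambara_comp1 K (tambara_id1 K S) x = x"
    "t1_src x = S \<Longrightarrow> tambara_comp1 K x (tambara_id1 K S) = x"
  using assms
  by (auto simp: tambara_comp1_def tambara_id1_def Let_def tambara_simps paste_simps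
      intro!: tambara_1cell.equality)

lemma tambara_comp1_assoc:
  assumes "is_tambara_1cell K x" "is_tambara_1cell K y" "is_tambara_1cell K z"
    and "t1_src y = t1_tgt x" "t1_src z = t1_tgt y"
  shows "tambara_comp1 K (tambara_comp1 K z y) x = tambara_comp1 K z (tambara_comp1 K y x)"
  using assms by (simp add: tambara_comp1_def Let_def tambara_simps paste_simps)

text \<open>An \<open>arrow\<close> is its cell of \<open>K\<close> together with its ends, so the
  laws for 2-cells are inherited from \<open>K\<close>. For the unit and associativity laws of
  1-cells the structure 2-cells have to be compared as well, which is done in
  \<open>tambara_comp1_unit\<close> and \<open>tambara_comp1_assoc\<close>.\<close>

theorem two_category_Tambara: "two_category (Tambara_Bimnd K)"
  by unfold_locales
    (auto simp: Tambara_Bimnd_def hom1_def hom2_def tambara_comp1_simps tambara_id1_simps tambara_simps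
      tambara_1cell_id tambara_1cell_comp tambara_comp1_unit tambara_comp1_assoc
      tambara_2cell_id tambara_2cell_vcomp tambara_2cell_hcomp
      paste_simps hcomp_assoc' interchange' intro!: arrow.equality)

end

section \<open>Categories form a 2-category\<close>

lemma category_simps:
  assumes "category C"
  shows "f \<in> Arr C \<Longrightarrow> Dom C f \<in> Obj C" "f \<in> Arr C \<Longrightarrow> Cod C f \<in> Obj C"
    "x \<in> Obj C \<Longrightarrow> Ide C x \<in> Arr C" "x \<in> Obj C \<Longrightarrow> Dom C (Ide C x) = x" "x \<in> Obj C \<Longrightarrow> Cod C (Ide C x) = x"
    "\<lbrakk>f \<in> Arr C; g \<in> Arr C; Dom C g = Cod C f\<rbrakk> \<Longrightarrow> Cmp C g f \<in> Arr C"
    "\<lbrakk>f \<in> Arr C; g \<in> Arr C; Dom C g = Cod C f\<rbrakk> \<Longrightarrow> Dom C (Cmp C g f) = Dom C f"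
    "\<lbrakk>f \<in> Arr C; g \<in> Arr C; Dom C g = Cod C f\<rbrakk> \<Longrightarrow> Cod C (Cmp C g f) = Cod C g"
    "\<lbrakk>f \<in> Arr C; Cod C f = y\<rbrakk> \<Longrightarrow> Cmp C (Ide C y) f = f"
    "\<lbrakk>f \<in> Arr C; Dom C f = x\<rbrakk> \<Longrightarrow> Cmp C f (Ide C x) = f"
  using category.arr_ends[OF assms, of f] category.ide[OF assms, of x]
    category.cmp[OF assms, of f "Dom C f" "Cod C f" g "Cod C g"]
    category.cmp_ide_left[OF assms, of f "Dom C f" y] category.cmp_ide_right[OF assms, of f x "Cod C f"]
  by (auto simp: Hom_def)

lemma category_assoc:
  assumes "category C"
  shows "\<lbrakk>f \<in> Arr C; g \<in> Arr C; h \<in> Arr C; Dom C g = Cod C f; Dom C h = Cod C g\<rbrakk>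
    \<Longrightarrow> Cmp C (Cmp C h g) f = Cmp C h (Cmp C g f)"
  using category.cmp_assoc[OF assms, of f "Dom C f" "Cod C f" g "Cod C g" h "Cod C h"]
  by (auto simp: Hom_def)

text \<open>The premises \<open>D = fcod F\<close> and \<open>C = fdom F\<close> let the equations
  fire when that category is displayed as another term, for instance as the domain of the next
  functor; the simplifier then proves the equality of the two terms.\<close>

lemma functor_simps:
  assumes "is_functor F"
  shows "category (fdom F)" "category (fcod F)" "\<lbrakk>x \<in> Obj (fdom F); D = fcod F\<rbrakk> \<Longrightarrow> fob F x \<in> Obj D"
    "\<lbrakk>f \<in> Arr (fdom F); D = fcod F\<rbrakk> \<Longrightarrow> far F f \<in> Arr D"
    "\<lbrakk>f \<in> Arr (fdom F); D = fcod F\<rbrakk> \<Longrightarrow> Dom D (far F f) = fob F (Dom (fdom F) f)"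
    "\<lbrakk>f \<in> Arr (fdom F); D = fcod F\<rbrakk> \<Longrightarrow> Cod D (far F f) = fob F (Cod (fdom F) f)"
    "\<lbrakk>x \<in> Obj (fdom F); C = fdom F\<rbrakk> \<Longrightarrow> far F (Ide C x) = Ide (fcod F) (fob F x)"
    "\<lbrakk>f \<in> Arr (fdom F); g \<in> Arr (fdom F); Dom (fdom F) g = Cod (fdom F) f; C = fdom F\<rbrakk>
      \<Longrightarrow> far F (Cmp C g f) = Cmp (fcod F) (far F g) (far F f)"
  using is_functor.fdom_category[OF assms] is_functor.fcod_category[OF assms]
    is_functor.fob[OF assms, of x] is_functor.far[OF assms, of f "Dom (fdom F) f" "Cod (fdom F) f"]
    is_functor.far_ide[OF assms, of x]
    is_functor.far_cmp[OF assms, of f "Dom (fdom F) f" "Cod (fdom F) f" g "Cod (fdom F) g"]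
  by (auto simp: Hom_def)

lemma natural_simps:
  assumes "is_natural t"
  shows "is_functor (ndom t)" "is_functor (ncod t)" "fdom (ncod t) = fdom (ndom t)"
    "fcod (ncod t) = fcod (ndom t)"
    "\<lbrakk>x \<in> Obj (fdom (ndom t)); D = fcod (ndom t)\<rbrakk> \<Longrightarrow> nmap t x \<in> Arr D"
    "\<lbrakk>x \<in> Obj (fdom (ndom t)); D = fcod (ndom t)\<rbrakk> \<Longrightarrow> Dom D (nmap t x) = fob (ndom t) x"
    "\<lbrakk>x \<in> Obj (fdom (ndom t)); D = fcod (ndom t)\<rbrakk> \<Longrightarrow> Cod D (nmap t x) = fob (ncod t) x"
  using is_natural.ndom_functor[OF assms] is_natural.ncod_functor[OF assms]
    is_natural.same_fdom[OF assms] is_natural.same_fcod[OF assms] is_natural.nmap[OF assms, of x]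
  by (auto simp: Hom_def)

lemma natural_square:
  assumes "is_natural t"
  shows "\<lbrakk>f \<in> Arr (fdom (ndom t)); Dom (fdom (ndom t)) f = x; Cod (fdom (ndom t)) f = y\<rbrakk>
    \<Longrightarrow> Cmp (fcod (ndom t)) (nmap t y) (far (ndom t) f) = Cmp (fcod (ndom t)) (far (ncod t) f) (nmap t x)"
  using is_natural.naturality[OF assms, of f x y] by (auto simp: Hom_def)

text \<open>Extensionality of both maps makes agreement on objects and arrows of the domain enough
  for HOL equality. The strict laws of \<open>Cat\<close> and of \<open>T_fun\<close> are equalities
  of such records.\<close>

lemma ftor_eqI:
  assumes "is_functor F" "is_functor G" "fdom F = fdom G" "fcod F = fcod G"
    "\<And>x. x \<in> Obj (fdom G) \<Longrightarrow> fob F x = fob G x" "\<And>f. f \<in> Arr (fdom G) \<Longrightarrow> far F f = far G f"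
  shows "F = G"
  using assms is_functor.fob_extensional[of F] is_functor.fob_extensional[of G]
    is_functor.far_extensional[of F] is_functor.far_extensional[of G]
  by (auto intro!: ftor.equality extensionalityI)

lemma ntrans_eqI:
  assumes "is_natural s" "is_natural t" "ndom s = ndom t" "ncod s = ncod t"
    "\<And>x. x \<in> Obj (fdom (ndom t)) \<Longrightarrow> nmap s x = nmap t x"
  shows "s = t"
  using assms is_natural.nmap_extensional[of s] is_natural.nmap_extensional[of t]
  by (auto intro!: ntrans.equality extensionalityI)

lemma id_ftor_simps:
  "fdom (id_ftor C) = C" "fcod (id_ftor C) = C"
  "x \<in> Obj C \<Longrightarrow> fob (id_ftor C) x = x" "f \<in> Arr C \<Longrightarrow> far (id_ftor C) f = f"
  by (simp_all add: id_ftor_def)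

lemma comp_ftor_simps:
  "fdom (comp_ftor G F) = fdom F" "fcod (comp_ftor G F) = fcod G"
  "x \<in> Obj (fdom F) \<Longrightarrow> fob (comp_ftor G F) x = fob G (fob F x)"
  "f \<in> Arr (fdom F) \<Longrightarrow> far (comp_ftor G F) f = far G (far F f)"
  by (simp_all add: comp_ftor_def compose_def)

lemma id_ntrans_simps:
  "ndom (id_ntrans F) = F" "ncod (id_ntrans F) = F"
  "x \<in> Obj (fdom F) \<Longrightarrow> nmap (id_ntrans F) x = Ide (fcod F) (fob F x)"
  by (simp_all add: id_ntrans_def)

lemma vcomp_ntrans_simps:
  "ndom (vcomp_ntrans s t) = ndom t" "ncod (vcomp_ntrans s t) = ncod s"
  "x \<in> Obj (fdom (ndom t)) \<Longrightarrow> nmap (vcomp_ntrans s t) x = Cmp (fcod (ndom t)) (nmap s x) (nmap t x)"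
  by (simp_all add: vcomp_ntrans_def)

lemma hcomp_ntrans_simps:
  "ndom (hcomp_ntrans s t) = comp_ftor (ndom s) (ndom t)" "ncod (hcomp_ntrans s t) = comp_ftor (ncod s) (ncod t)"
  "x \<in> Obj (fdom (ndom t)) \<Longrightarrow> nmap (hcomp_ntrans s t) x =
    Cmp (fcod (ndom s)) (nmap s (fob (ncod t) x)) (far (ndom s) (nmap t x))"
  by (simp_all add: hcomp_ntrans_def)

lemmas cat_simps = category_simps functor_simps natural_simps id_ftor_simps comp_ftor_simps
  id_ntrans_simps vcomp_ntrans_simps hcomp_ntrans_simps

lemma is_functor_id: "category C \<Longrightarrow> is_functor (id_ftor C)"
  by (rule is_functor.intro) (auto simp: Hom_def cat_simps, auto simp: id_ftor_def)

lemma is_functor_comp: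
  assumes "is_functor F" "is_functor G" "fdom G = fcod F"
  shows "is_functor (comp_ftor G F)"
proof (rule is_functor.intro)
  show "fob (comp_ftor G F) \<in> extensional (Obj (fdom (comp_ftor G F)))"
    "far (comp_ftor G F) \<in> extensional (Arr (fdom (comp_ftor G F)))"
    by (simp_all add: comp_ftor_def)
qed (use assms in \<open>auto simp: Hom_def cat_simps\<close>)

lemma is_natural_id:
  assumes "is_functor F"
  shows "is_natural (id_ntrans F)"
proof (rule is_natural.intro)
  show "nmap (id_ntrans F) \<in> extensional (Obj (fdom (ndom (id_ntrans F))))"
    by (simp add: id_ntrans_def)
qed (use assms in \<open>auto simp: Hom_def cat_simps\<close>)

lemma is_natural_vcomp:
  assumes s: "is_natural s" and t: "is_natural t" and st: "ndom s = ncod t"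
  shows "is_natural (vcomp_ntrans s t)"
proof (rule is_natural.intro)
  show "nmap (vcomp_ntrans s t) \<in> extensional (Obj (fdom (ndom (vcomp_ntrans s t))))"
    by (simp add: vcomp_ntrans_def)
next
  fix f x y
  let ?D = "fcod (ndom t)"
  \<comment> \<open>The facts on \<open>s\<close> are rewritten with \<open>st\<close> and then with
    the parallelism of \<open>t\<close>, so that all domain and codomain categories are expressed
    through \<open>ndom t\<close>.\<close>
  note cs [simp] = cat_simps natural_simps[OF t] natural_simps[OF s, unfolded st natural_simps[OF t]]
  assume "f \<in> Hom (fdom (ndom (vcomp_ntrans s t))) x y"
  then have f [simp]: "f \<in> Arr (fdom (ndom t))" "Dom (fdom (ndom t)) f = x" "Cod (fdom (ndom t)) f = y"
    by (auto simp: Hom_def)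
  then have xy [simp]: "x \<in> Obj (fdom (ndom t))" "y \<in> Obj (fdom (ndom t))"
    using category_simps(1,2)[OF functor_simps(1)[OF natural_simps(1)[OF t]]] by blast+
  have "Cmp ?D (Cmp ?D (nmap s y) (nmap t y)) (far (ndom t) f) = Cmp ?D (nmap s y) (Cmp ?D (nmap t y) (far (ndom t) f))"
    by (simp add: category_assoc)
  also have "\<dots> = Cmp ?D (Cmp ?D (nmap s y) (far (ncod t) f)) (nmap t x)"
    by (simp add: category_assoc natural_square[OF t])
  also have "\<dots> = Cmp ?D (far (ncod s) f) (Cmp ?D (nmap s x) (nmap t x))"
    using natural_square[OF s, of f x y] by (simp add: category_assoc st)
  finally show "Cmp (fcod (ndom (vcomp_ntrans s t))) (nmap (vcomp_ntrans s t) y) (far (ndom (vcomp_ntrans s t)) f) =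
    Cmp (fcod (ndom (vcomp_ntrans s t))) (far (ncod (vcomp_ntrans s t)) f) (nmap (vcomp_ntrans s t) x)"
    by simp
qed (use assms natural_simps[OF s] natural_simps[OF t] in \<open>auto simp: Hom_def cat_simps\<close>)

text \<open>Naturality of \<open>t\<close> is used under the functor \<open>ndom s\<close>, and
  afterwards naturality of \<open>s\<close> at the arrow \<open>far (ncod t) f\<close>.\<close>

lemma is_natural_hcomp:
  assumes s: "is_natural s" and t: "is_natural t" and st: "fdom (ndom s) = fcod (ndom t)"
  shows "is_natural (hcomp_ntrans s t)"
proof (rule is_natural.intro)
  show "nmap (hcomp_ntrans s t) \<in> extensional (Obj (fdom (ndom (hcomp_ntrans s t))))"
    by (simp add: hcomp_ntrans_def comp_ftor_def)
next
  fix f x y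
  let ?D = "fcod (ndom s)" and ?E = "fcod (ndom t)"
  note cs [simp] = cat_simps natural_simps[OF t] natural_simps[OF s, unfolded st] st
  assume "f \<in> Hom (fdom (ndom (hcomp_ntrans s t))) x y"
  then have f [simp]: "f \<in> Arr (fdom (ndom t))" "Dom (fdom (ndom t)) f = x" "Cod (fdom (ndom t)) f = y"
    by (auto simp: Hom_def)
  then have xy [simp]: "x \<in> Obj (fdom (ndom t))" "y \<in> Obj (fdom (ndom t))"
    using category_simps(1,2)[OF functor_simps(1)[OF natural_simps(1)[OF t]]] by blast+
  have "Cmp ?D (Cmp ?D (nmap s (fob (ncod t) y)) (far (ndom s) (nmap t y))) (far (ndom s) (far (ndom t) f))
      = Cmp ?D (nmap s (fob (ncod t) y)) (far (ndom s) (Cmp ?E (nmap t y) (far (ndom t) f)))"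
    by (simp add: category_assoc)
  also have "\<dots> = Cmp ?D (Cmp ?D (nmap s (fob (ncod t) y)) (far (ndom s) (far (ncod t) f))) (far (ndom s) (nmap t x))"
    by (simp add: category_assoc natural_square[OF t])
  also have "\<dots> = Cmp ?D (far (ncod s) (far (ncod t) f)) (Cmp ?D (nmap s (fob (ncod t) x)) (far (ndom s) (nmap t x)))"
    using natural_square[OF s, of "far (ncod t) f" "fob (ncod t) x" "fob (ncod t) y"] by (simp add: category_assoc)
  finally show "Cmp (fcod (ndom (hcomp_ntrans s t))) (nmap (hcomp_ntrans s t) y) (far (ndom (hcomp_ntrans s t)) f) =
    Cmp (fcod (ndom (hcomp_ntrans s t))) (far (ncod (hcomp_ntrans s t)) f) (nmap (hcomp_ntrans s t) x)"
    by simp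
qed (use assms natural_simps[OF s] natural_simps[OF t] in \<open>auto simp: Hom_def cat_simps is_functor_comp\<close>)

lemmas cat_closed = is_functor_id is_functor_comp is_natural_id is_natural_vcomp is_natural_hcomp

lemma comp_ftor_assoc:
  assumes "is_functor F" "is_functor G" "is_functor H" "fdom G = fcod F" "fdom H = fcod G"
  shows "comp_ftor (comp_ftor H G) F = comp_ftor H (comp_ftor G F)"
  using assms by (intro ftor_eqI) (auto simp: cat_simps cat_closed)

lemma comp_ftor_id:
  assumes "is_functor F"
  shows "fcod F = C \<Longrightarrow> comp_ftor (id_ftor C) F = F" "fdom F = C \<Longrightarrow> comp_ftor F (id_ftor C) = F"
  using assms by (auto intro!: ftor_eqI simp: cat_simps cat_closed)

lemma ntrans_interchange:
  assumes a: "is_natural \<alpha>" "is_natural \<alpha>'" and b: "is_natural \<beta>" "is_natural \<beta>'"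
    and e: "ndom \<alpha>' = ncod \<alpha>" "ndom \<beta>' = ncod \<beta>" "fdom (ndom \<beta>) = fcod (ndom \<alpha>)"
  shows "hcomp_ntrans (vcomp_ntrans \<beta>' \<beta>) (vcomp_ntrans \<alpha>' \<alpha>)
    = vcomp_ntrans (hcomp_ntrans \<beta>' \<alpha>') (hcomp_ntrans \<beta> \<alpha>)"
proof (rule ntrans_eqI)
  note cs [simp] = cat_simps cat_closed natural_simps[OF a(1)] natural_simps[OF b(1)]
    natural_simps[OF a(2), unfolded e natural_simps[OF a(1)]]
    natural_simps[OF b(2), unfolded e natural_simps[OF b(1)]] a b e
  show "is_natural (hcomp_ntrans (vcomp_ntrans \<beta>' \<beta>) (vcomp_ntrans \<alpha>' \<alpha>))"
    "is_natural (vcomp_ntrans (hcomp_ntrans \<beta>' \<alpha>') (hcomp_ntrans \<beta> \<alpha>))"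
    by simp_all
  fix x
  assume "x \<in> Obj (fdom (ndom (vcomp_ntrans (hcomp_ntrans \<beta>' \<alpha>') (hcomp_ntrans \<beta> \<alpha>))))"
  then have x [simp]: "x \<in> Obj (fdom (ndom \<alpha>))"
    by simp
  let ?D = "fcod (ndom \<beta>)"
  have "Cmp ?D (nmap \<beta> (fob (ncod \<alpha>') x)) (Cmp ?D (far (ndom \<beta>) (nmap \<alpha>' x)) (far (ndom \<beta>) (nmap \<alpha> x)))
    = Cmp ?D (Cmp ?D (nmap \<beta> (fob (ncod \<alpha>') x)) (far (ndom \<beta>) (nmap \<alpha>' x))) (far (ndom \<beta>) (nmap \<alpha> x))"
    by (simp add: category_assoc)
  \<comment> \<open>Naturality of \<beta> at the component of \<alpha>' at \<open>x\<close>. This is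
    the content of interchange in \<open>Cat\<close>; the rest is associativity and functoriality of
    \<open>ndom \<beta>\<close>.\<close>
  also have "Cmp ?D (nmap \<beta> (fob (ncod \<alpha>') x)) (far (ndom \<beta>) (nmap \<alpha>' x))
    = Cmp ?D (far (ncod \<beta>) (nmap \<alpha>' x)) (nmap \<beta> (fob (ncod \<alpha>) x))"
    using natural_square[OF b(1), of "nmap \<alpha>' x" "fob (ncod \<alpha>) x" "fob (ncod \<alpha>') x"] by simp
  finally show "nmap (hcomp_ntrans (vcomp_ntrans \<beta>' \<beta>) (vcomp_ntrans \<alpha>' \<alpha>)) x =
      nmap (vcomp_ntrans (hcomp_ntrans \<beta>' \<alpha>') (hcomp_ntrans \<beta> \<alpha>)) x"
    by (simp add: category_assoc)
qed (simp_all add: vcomp_ntrans_simps hcomp_ntrans_simps)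

lemma Cat_components:
  "Cell0 Cat = {C. category C}" "Cell1 Cat = {F. is_functor F}" "Cell2 Cat = {t. is_natural t}"
  "Src1 Cat = fdom" "Tgt1 Cat = fcod" "Src2 Cat = ndom" "Tgt2 Cat = ncod" "Id1 Cat = id_ftor"
  "Id2 Cat = id_ntrans" "Comp1 Cat = comp_ftor" "HComp Cat = hcomp_ntrans" "VComp Cat = vcomp_ntrans"
  by (simp_all add: Cat_def)

theorem two_category_Cat: "two_category Cat"
  by unfold_locales
    (auto simp: Cat_components hom1_def hom2_def cat_simps cat_closed comp_ftor_id comp_ftor_assoc
      category_assoc ntrans_interchange intro!: ntrans_eqI)

section \<open>Endo-1-cells and currying\<close>

lemma make_cat_simps:
  "Obj (make_cat Ob Ar dm cd i m) = Ob" "Arr (make_cat Ob Ar dm cd i m) = Ar"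
  "f \<in> Ar \<Longrightarrow> Dom (make_cat Ob Ar dm cd i m) f = dm f" "f \<in> Ar \<Longrightarrow> Cod (make_cat Ob Ar dm cd i m) f = cd f"
  "x \<in> Ob \<Longrightarrow> Ide (make_cat Ob Ar dm cd i m) x = i x"
  "\<lbrakk>f \<in> Ar; g \<in> Ar; dm g = cd f\<rbrakk> \<Longrightarrow> Cmp (make_cat Ob Ar dm cd i m) g f = m g f"
  by (simp_all add: make_cat_def)

text \<open>The restrictions built into \<open>make_cat\<close> settle the extensionality axioms, so
  what remains concerns the raw structure maps on the carriers. Used for endocells, products and
  relative modules.\<close>

lemma category_make_cat:
  assumes "\<And>f. f \<in> Ar \<Longrightarrow> dm f \<in> Ob \<and> cd f \<in> Ob"
    and "\<And>x. x \<in> Ob \<Longrightarrow> i x \<in> Ar \<and> dm (i x) = x \<and> cd (i x) = x"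
    and "\<And>f g. \<lbrakk>f \<in> Ar; g \<in> Ar; dm g = cd f\<rbrakk> \<Longrightarrow> m g f \<in> Ar \<and> dm (m g f) = dm f \<and> cd (m g f) = cd g"
    and "\<And>f. f \<in> Ar \<Longrightarrow> m (i (cd f)) f = f \<and> m f (i (dm f)) = f"
    and "\<And>f g h. \<lbrakk>f \<in> Ar; g \<in> Ar; h \<in> Ar; dm g = cd f; dm h = cd g\<rbrakk> \<Longrightarrow> m (m h g) f = m h (m g f)"
  shows "category (make_cat Ob Ar dm cd i m)"
proof (rule category.intro)
  fix f g
  assume "\<not> (f \<in> Arr (make_cat Ob Ar dm cd i m) \<and> g \<in> Arr (make_cat Ob Ar dm cd i m) \<and>
    Dom (make_cat Ob Ar dm cd i m) g = Cod (make_cat Ob Ar dm cd i m) f)"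
  then show "Cmp (make_cat Ob Ar dm cd i m) g f = undefined"
    by (auto simp: make_cat_def)
next
  show "Dom (make_cat Ob Ar dm cd i m) \<in> extensional (Arr (make_cat Ob Ar dm cd i m))"
    "Cod (make_cat Ob Ar dm cd i m) \<in> extensional (Arr (make_cat Ob Ar dm cd i m))"
    "Ide (make_cat Ob Ar dm cd i m) \<in> extensional (Obj (make_cat Ob Ar dm cd i m))"
    by (simp_all add: make_cat_def)
qed (use assms in \<open>auto simp: Hom_def make_cat_simps\<close>)

lemma category_prod:
  assumes "category C" "category D"
  shows "category (prod_cat C D)"
  unfolding prod_cat_def
  by (rule category_make_cat) (use assms in \<open>auto simp: category_simps category_assoc\<close>)

lemma prod_cat_simps:
  "Obj (prod_cat C D) = Obj C \<times> Obj D" "Arr (prod_cat C D) = Arr C \<times> Arr D"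
  "\<lbrakk>f \<in> Arr C; g \<in> Arr D\<rbrakk> \<Longrightarrow> Dom (prod_cat C D) (f, g) = (Dom C f, Dom D g)"
  "\<lbrakk>f \<in> Arr C; g \<in> Arr D\<rbrakk> \<Longrightarrow> Cod (prod_cat C D) (f, g) = (Cod C f, Cod D g)"
  "\<lbrakk>x \<in> Obj C; y \<in> Obj D\<rbrakk> \<Longrightarrow> Ide (prod_cat C D) (x, y) = (Ide C x, Ide D y)"
  "\<lbrakk>f \<in> Arr C; g \<in> Arr D; f' \<in> Arr C; g' \<in> Arr D; Dom C f' = Cod C f; Dom D g' = Cod D g\<rbrakk>
    \<Longrightarrow> Cmp (prod_cat C D) (f', g') (f, g) = (Cmp C f' f, Cmp D g' g)"
  by (simp_all add: prod_cat_def make_cat_simps)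

lemma endo_moncat_simps:
  "Obj (under (endo_moncat K a)) = hom1 K a a"
  "Arr (under (endo_moncat K a)) = {\<alpha> \<in> Cell2 K. Src2 K \<alpha> \<in> hom1 K a a}"
  "tensob (endo_moncat K a) = Comp1 K" "tensar (endo_moncat K a) = HComp K" "unitob (endo_moncat K a) = Id1 K a"
  "\<lbrakk>\<alpha> \<in> Cell2 K; Src2 K \<alpha> \<in> hom1 K a a\<rbrakk> \<Longrightarrow> Dom (under (endo_moncat K a)) \<alpha> = Src2 K \<alpha>"
  "\<lbrakk>\<alpha> \<in> Cell2 K; Src2 K \<alpha> \<in> hom1 K a a\<rbrakk> \<Longrightarrow> Cod (under (endo_moncat K a)) \<alpha> = Tgt2 K \<alpha>"
  "X \<in> hom1 K a a \<Longrightarrow> Ide (under (endo_moncat K a)) X = Id2 K X"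
  "\<lbrakk>\<alpha> \<in> Cell2 K; Src2 K \<alpha> \<in> hom1 K a a; \<beta> \<in> Cell2 K; Src2 K \<beta> \<in> hom1 K a a; Src2 K \<beta> = Tgt2 K \<alpha>\<rbrakk>
    \<Longrightarrow> Cmp (under (endo_moncat K a)) \<beta> \<alpha> = VComp K \<beta> \<alpha>"
  by (simp_all add: endo_moncat_def make_cat_simps)

text \<open>The strict monoidal axioms are the 2-category axioms read at a single 0-cell;
  functoriality of the tensor product is interchange.\<close>

lemma (in two_category) strict_monoidal_endo:
  assumes "a \<in> Cell0 K"
  shows "strict_monoidal (endo_moncat K a)"
proof (rule strict_monoidal.intro)
  show "category (under (endo_moncat K a))"
    unfolding endo_moncat_def using assms
    by (simp, intro category_make_cat) (auto simp: hom1_def tgt2_ends cell_simps vcomp_id_eq vcomp_assoc')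
qed (use assms in \<open>auto simp: endo_moncat_simps Hom_def hom1_def cell_simps tgt2_ends comp1_id_eq
    hcomp_id2' hcomp_id1_eq comp1_assoc' hcomp_assoc' interchange'\<close>)

lemma (in two_functor) two_functor_simps:
  shows "a \<in> Cell0 C \<Longrightarrow> On0 T a \<in> Cell0 D"
    "X \<in> Cell1 C \<Longrightarrow> On1 T X \<in> Cell1 D" "X \<in> Cell1 C \<Longrightarrow> Src1 D (On1 T X) = On0 T (Src1 C X)"
    "X \<in> Cell1 C \<Longrightarrow> Tgt1 D (On1 T X) = On0 T (Tgt1 C X)"
    "\<alpha> \<in> Cell2 C \<Longrightarrow> On2 T \<alpha> \<in> Cell2 D" "\<alpha> \<in> Cell2 C \<Longrightarrow> Src2 D (On2 T \<alpha>) = On1 T (Src2 C \<alpha>)"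
    "\<alpha> \<in> Cell2 C \<Longrightarrow> Tgt2 D (On2 T \<alpha>) = On1 T (Tgt2 C \<alpha>)"
    "\<lbrakk>\<alpha> \<in> Cell2 C; \<beta> \<in> Cell2 C; Src2 C \<beta> = Tgt2 C \<alpha>\<rbrakk> \<Longrightarrow> On2 T (VComp C \<beta> \<alpha>) = VComp D (On2 T \<beta>) (On2 T \<alpha>)"
    "\<lbrakk>\<alpha> \<in> Cell2 C; \<beta> \<in> Cell2 C; Src1 C (Src2 C \<beta>) = Tgt1 C (Src2 C \<alpha>)\<rbrakk>
      \<Longrightarrow> On2 T (HComp C \<beta> \<alpha>) = HComp D (On2 T \<beta>) (On2 T \<alpha>)"
    "\<lbrakk>X \<in> Cell1 C; Y \<in> Cell1 C; Src1 C Y = Tgt1 C X\<rbrakk> \<Longrightarrow> On1 T (Comp1 C Y X) = Comp1 D (On1 T Y) (On1 T X)"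
  using on0[of a] on1[of X "Src1 C X" "Tgt1 C X"] on2[of \<alpha> "Src2 C \<alpha>" "Tgt2 C \<alpha>"]
    on_vcomp[of \<alpha> "Src2 C \<alpha>" "Tgt2 C \<alpha>" \<beta> "Tgt2 C \<beta>"]
    on_hcomp[of "Src2 C \<alpha>" "Src1 C (Src2 C \<alpha>)" "Tgt1 C (Src2 C \<alpha>)" "Src2 C \<beta>"
      "Tgt1 C (Src2 C \<beta>)" \<alpha> "Tgt2 C \<alpha>" \<beta> "Tgt2 C \<beta>"]
    on_comp1[of X "Src1 C X" "Tgt1 C X" Y "Tgt1 C Y"] C.cell2_ends
  by (auto simp: hom1_def hom2_def)

text \<open>The tensor product of endocells is composition, and a strict 2-functor preserves
  composites and identities on the nose.\<close>

lemma (in two_functor) strict_monoidal_functor_endo: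
  assumes "a \<in> Cell0 C"
  shows "strict_monoidal_functor (endo_moncat C a) (endo_moncat D (On0 T a)) (endo_ftor C D T a)"
proof -
  let ?V = "endo_moncat C a" and ?W = "endo_moncat D (On0 T a)" and ?P = "endo_ftor C D T a"
  have V: "strict_monoidal ?V" and W: "strict_monoidal ?W"
    using assms C.strict_monoidal_endo D.strict_monoidal_endo on0 by auto
  have P: "fdom (endo_ftor C D T b) = under (endo_moncat C b)"
    "fcod (endo_ftor C D T b) = under (endo_moncat D (On0 T b))"
    "X \<in> hom1 C b b \<Longrightarrow> fob (endo_ftor C D T b) X = On1 T X"
    "\<lbrakk>\<alpha> \<in> Cell2 C; Src2 C \<alpha> \<in> hom1 C b b\<rbrakk> \<Longrightarrow> far (endo_ftor C D T b) \<alpha> = On2 T \<alpha>" for b X \<alpha>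
    by (simp_all add: endo_ftor_def endo_moncat_simps)
  note ss = endo_moncat_simps Hom_def hom1_def two_functor_simps C.cell_simps C.tgt2_ends on_id1 on_id2
  have "is_functor ?P"
  proof (rule is_functor.intro)
    show "category (fdom ?P)" "category (fcod ?P)"
      using V W by (simp_all add: P strict_monoidal.under_category)
    show "fob ?P \<in> extensional (Obj (fdom ?P))" "far ?P \<in> extensional (Arr (fdom ?P))"
      by (simp_all add: endo_ftor_def)
  qed (use assms in \<open>auto simp: P ss\<close>)
  moreover have "strict_monoidal_functor_axioms ?V ?W ?P"
    by (rule strict_monoidal_functor_axioms.intro) (use assms in \<open>auto simp: P ss\<close>)
  ultimately show ?thesis
    using V W by (simp add: strict_monoidal_functor_def)
qed

lemma Fun_simps:
  "Obj (under (Fun C)) = {F. is_functor F \<and> fdom F = C \<and> fcod F = C}"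
  "Arr (under (Fun C)) = {t. is_natural t \<and> fdom (ndom t) = C \<and> fcod (ndom t) = C}"
  "tensob (Fun C) = comp_ftor" "tensar (Fun C) = hcomp_ntrans" "unitob (Fun C) = id_ftor C"
  "\<lbrakk>is_natural t; fdom (ndom t) = C; fcod (ndom t) = C\<rbrakk> \<Longrightarrow> Dom (under (Fun C)) t = ndom t"
  "\<lbrakk>is_natural t; fdom (ndom t) = C; fcod (ndom t) = C\<rbrakk> \<Longrightarrow> Cod (under (Fun C)) t = ncod t"
  "\<lbrakk>is_functor F; fdom F = C; fcod F = C\<rbrakk> \<Longrightarrow> Ide (under (Fun C)) F = id_ntrans F"
  "\<lbrakk>is_natural t; fdom (ndom t) = C; fcod (ndom t) = C; is_natural s; fdom (ndom s) = C; fcod (ndom s) = C;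
    ndom s = ncod t\<rbrakk> \<Longrightarrow> Cmp (under (Fun C)) s t = vcomp_ntrans s t"
  by (auto simp: Fun_def endo_moncat_simps Cat_components hom1_def natural_simps)

lemma restrict_eqI: "\<lbrakk>g \<in> extensional A; \<And>x. x \<in> A \<Longrightarrow> f x = g x\<rbrakk> \<Longrightarrow> restrict f A = g"
  by (rule extensionalityI[where A = A]) auto

section \<open>Transposing a strict monoidal functor into \<open>Fun C\<close> to an action, and
  back\<close>

lemma uncurry_ftor_simps:
  "fdom (uncurry_ftor V C P) = prod_cat (under V) C" "fcod (uncurry_ftor V C P) = C"
  "\<lbrakk>x \<in> Obj (under V); m \<in> Obj C\<rbrakk> \<Longrightarrow> fob (uncurry_ftor V C P) (x, m) = fob (fob P x) m"
  "\<lbrakk>s \<in> Arr (under V); f \<in> Arr C\<rbrakk> \<Longrightarrow> far (uncurry_ftor V C P) (s, f) =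
    Cmp C (nmap (far P s) (Cod C f)) (far (fob P (Dom (under V) s)) f)"
  by (simp_all add: uncurry_ftor_def)

context
  fixes V :: "('x, 'y) moncat" and C :: "('u, 'v) cat"
    and P :: "('x, 'y, ('u, 'v, 'u, 'v) ftor, ('u, 'v, 'u, 'v) ntrans) ftor"
  assumes P: "strict_monoidal_functor V (Fun C) P" and C: "category C"
begin

lemma strict_monoidal_source: "strict_monoidal V"
  and strict_monoidal_is_functor: "is_functor P"
  using P by (simp_all add: strict_monoidal_functor_def)

lemma to_Fun_ends: "fdom P = under V" "fcod P = under (Fun C)"
  using strict_monoidal_functor.fdom_under[OF P] strict_monoidal_functor.fcod_under[OF P] by auto

lemma to_Fun_ob:
  assumes "x \<in> Obj (under V)"
  shows "is_functor (fob P x)" "fdom (fob P x) = C" "fcod (fob P x) = C"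
    "far P (Ide (under V) x) = id_ntrans (fob P x)"
  using functor_simps(3)[OF strict_monoidal_is_functor, of x] functor_simps(7)[OF strict_monoidal_is_functor, of x]
    assms by (auto simp: to_Fun_ends Fun_simps)

lemma to_Fun_ar:
  assumes "s \<in> Arr (under V)"
  shows "is_natural (far P s)" "ndom (far P s) = fob P (Dom (under V) s)" "ncod (far P s) = fob P (Cod (under V) s)"
proof -
  have "far P s \<in> Arr (under (Fun C))"
    using functor_simps(4)[OF strict_monoidal_is_functor] assms by (simp add: to_Fun_ends)
  then show "is_natural (far P s)" "ndom (far P s) = fob P (Dom (under V) s)" "ncod (far P s) = fob P (Cod (under V) s)"
    using functor_simps(5,6)[OF strict_monoidal_is_functor, of s "under (Fun C)"] assms
    by (auto simp: to_Fun_ends Fun_simps)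
qed

lemma to_Fun_cmp:
  assumes "s \<in> Arr (under V)" "t \<in> Arr (under V)" "Dom (under V) s = Cod (under V) t"
  shows "far P (Cmp (under V) s t) = vcomp_ntrans (far P s) (far P t)"
proof -
  have V: "category (under V)"
    using strict_monoidal_source by (rule strict_monoidal.under_category)
  have "far P (Cmp (under V) s t) = Cmp (under (Fun C)) (far P s) (far P t)"
    using functor_simps(8)[OF strict_monoidal_is_functor, of t s] assms by (simp add: to_Fun_ends)
  also have "\<dots> = vcomp_ntrans (far P s) (far P t)"
    using assms by (intro Fun_simps) (simp_all add: to_Fun_ar to_Fun_ob category_simps[OF V])
  finally show ?thesis .
qed

text \<open>Functoriality in both variables jointly comes from naturality of the transformations
  \<open>far P s\<close>. The laws of an action come from the strict preservation of unit and tensor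
  product by \<open>P\<close>.\<close>

lemma strict_action_uncurry: "strict_action V C (uncurry_ftor V C P)"
proof -
  have V: "category (under V)"
    using strict_monoidal_source by (rule strict_monoidal.under_category)
  note [simp] = V C to_Fun_ob to_Fun_ar uncurry_ftor_simps category_simps[OF V] category_simps[OF C]
    functor_simps natural_simps(5,6,7)
  have "is_functor (uncurry_ftor V C P)"
  proof (rule is_functor.intro)
    show "fob (uncurry_ftor V C P) \<in> extensional (Obj (fdom (uncurry_ftor V C P)))"
      "far (uncurry_ftor V C P) \<in> extensional (Arr (fdom (uncurry_ftor V C P)))"
      by (simp_all add: uncurry_ftor_def prod_cat_simps)
  next
    fix g g' p q r
    assume "g \<in> Hom (fdom (uncurry_ftor V C P)) p q" "g' \<in> Hom (fdom (uncurry_ftor V C P)) q r"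
    then obtain s f s' f' where g: "g = (s, f)" "g' = (s', f')"
      and [simp]: "s \<in> Arr (under V)" "f \<in> Arr C" "s' \<in> Arr (under V)" "f' \<in> Arr C"
        "Dom (under V) s' = Cod (under V) s" "Dom C f' = Cod C f"
      by (auto simp: Hom_def prod_cat_simps)
    let ?P = "fob P (Dom (under V) s)" and ?P' = "fob P (Cod (under V) s)"
    have "Cmp C (Cmp C (nmap (far P s') (Cod C f')) (nmap (far P s) (Cod C f'))) (Cmp C (far ?P f') (far ?P f))
      = Cmp C (nmap (far P s') (Cod C f')) (Cmp C (Cmp C (nmap (far P s) (Cod C f')) (far ?P f')) (far ?P f))"
      by (simp add: category_assoc)
    \<comment> \<open>The naturality square of \<open>far P s\<close> at \<open>f'\<close> moves the
      component of \<open>s\<close> past \<open>f'\<close>, so that the factors belonging to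
      \<open>(s', f')\<close> and to \<open>(s, f)\<close> become adjacent.\<close>
    also have "Cmp C (nmap (far P s) (Cod C f')) (far ?P f') = Cmp C (far ?P' f') (nmap (far P s) (Cod C f))"
      using natural_square[of "far P s" f' "Cod C f" "Cod C f'"] by simp
    finally show "far (uncurry_ftor V C P) (Cmp (fdom (uncurry_ftor V C P)) g' g) =
      Cmp (fcod (uncurry_ftor V C P)) (far (uncurry_ftor V C P) g') (far (uncurry_ftor V C P) g)"
      by (simp add: g prod_cat_simps to_Fun_cmp vcomp_ntrans_simps category_assoc)
  qed (auto simp: Hom_def prod_cat_simps category_prod id_ntrans_simps)
  moreover have "strict_action_axioms V C (uncurry_ftor V C P)"
  proof (rule strict_action_axioms.intro)
    note unit = strict_monoidal.unitob[OF strict_monoidal_source]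
    show "fob (uncurry_ftor V C P) (unitob V, m) = m" if "m \<in> Obj C" for m
      using that strict_monoidal_functor.fob_unit[OF P] unit by (simp add: Fun_simps id_ftor_simps)
    show "far (uncurry_ftor V C P) (Ide (under V) (unitob V), f) = f" if "f \<in> Arr C" for f
      using that strict_monoidal_functor.fob_unit[OF P] unit
      by (simp add: Fun_simps id_ftor_simps id_ntrans_simps)
    show "fob (uncurry_ftor V C P) (tensob V x y, m) = fob (uncurry_ftor V C P) (x, fob (uncurry_ftor V C P) (y, m))"
      if "x \<in> Obj (under V)" "y \<in> Obj (under V)" "m \<in> Obj C" for x y m
      using that strict_monoidal_functor.fob_tens[OF P, of x y] strict_monoidal.tensob[OF strict_monoidal_source, of x y]
      by (simp add: Fun_simps comp_ftor_simps)
    show "far (uncurry_ftor V C P) (tensar V s t, f) = far (uncurry_ftor V C P) (s, far (uncurry_ftor V C P) (t, f))"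
      if [simp]: "s \<in> Arr (under V)" "t \<in> Arr (under V)" "f \<in> Arr C" for s t f
    proof -
      have [simp]: "tensar V s t \<in> Arr (under V)" "Dom (under V) (tensar V s t) = tensob V (Dom (under V) s) (Dom (under V) t)"
        using strict_monoidal.tensar[OF strict_monoidal_source, of s "Dom (under V) s" "Cod (under V) s" t
            "Dom (under V) t" "Cod (under V) t"] by (auto simp: Hom_def)
      \<comment> \<open>\<open>uncurry_ftor\<close> and \<open>hcomp_ntrans\<close> both place the
        component of a transformation after the functor, so the two sides differ only by
        functoriality of the value of \<open>P\<close> at the source of \<open>s\<close> and by
        associativity.\<close>
      show ?thesis
        using strict_monoidal_functor.fob_tens[OF P, of "Dom (under V) s" "Dom (under V) t"]
          strict_monoidal_functor.far_tens[OF P, of s t]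
        by (simp add: Fun_simps comp_ftor_simps hcomp_ntrans_simps category_assoc)
    qed
  qed simp_all
  ultimately show ?thesis
    using strict_monoidal_source by (simp add: strict_action_def)
qed

text \<open>Setting one variable to an identity recovers the other: at \<open>(Ide x, f)\<close> the
  component is an identity and \<open>far (fob P x) f\<close> remains, at \<open>(s, Ide m)\<close>
  the functor part is an identity and the component of \<open>far P s\<close> remains.
  Extensionality of \<open>P\<close> and of its values turns this into equality.\<close>

lemma curry_uncurry_ftor: "curry_ftor V C (uncurry_ftor V C P) = P"
proof -
  have V: "category (under V)"
    using strict_monoidal_source by (rule strict_monoidal.under_category)
  note [simp] = V C to_Fun_ob to_Fun_ar uncurry_ftor_simps category_simps[OF V] category_simps[OF C]
    functor_simps natural_simps(5,6,7)
  have ob: "partial_ftor V C (uncurry_ftor V C P) x = fob P x" if [simp]: "x \<in> Obj (under V)" for x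
    using is_functor.fob_extensional[of "fob P x"] is_functor.far_extensional[of "fob P x"]
    by (intro ftor.equality) (auto simp: partial_ftor_def id_ntrans_simps intro!: restrict_eqI)
  have ar: "(\<lambda>m\<in>Obj C. far (uncurry_ftor V C P) (s, Ide C m)) = nmap (far P s)" if [simp]: "s \<in> Arr (under V)" for s
    using is_natural.nmap_extensional[of "far P s"] by (auto intro!: restrict_eqI)
  show ?thesis
    using is_functor.fob_extensional[OF strict_monoidal_is_functor]
      is_functor.far_extensional[OF strict_monoidal_is_functor]
    by (intro ftor.equality)
      (auto simp: curry_ftor_def to_Fun_ends ob ar intro!: restrict_eqI ntrans.equality)
qed

end

section \<open>Relative modules as 1-cells out of a trivial structure\<close>

text \<open>Strictness gives \<open>I \<cdot> I = I\<close>, so every structure 2-cell can be the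
  identity on \<open>I\<close>. For a 1-cell \<open>M\<close> out of this object the cells
  \<open>M \<cdot> I -> F \<cdot> M\<close> and \<open>B \<cdot> M -> M \<cdot> I\<close> have the
  types of a coaction and an action.\<close>

definition trivial_tambara :: "('o, 'm, 'c) twocat \<Rightarrow> 'o \<Rightarrow> ('o, 'm, 'c) tambara"
  where
  "trivial_tambara K a =
    (let I = Id1 K a; i = Id2 K I in
      \<lparr>tb_F = \<lparr>bi_base = a, bi_cell = I, bi_mult = i, bi_unit = i, bi_comult = i, bi_counit = i, bi_lambda = i\<rparr>,
       tb_B = \<lparr>mnd_base = a, mnd_cell = I, mnd_mult = i, mnd_unit = i\<rparr>, tb_psi = i\<rparr>)"

lemma RelMod_simps:
  "Obj (RelMod K S) = {m. is_relmod K S m}" "Arr (RelMod K S) = {f. is_relmod_mor K S f}"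
  "is_relmod_mor K S f \<Longrightarrow> Dom (RelMod K S) f = ar_src f"
  "is_relmod_mor K S f \<Longrightarrow> Cod (RelMod K S) f = ar_tgt f"
  "is_relmod K S m \<Longrightarrow> Ide (RelMod K S) m = \<lparr>ar_src = m, ar_tgt = m, ar_cell = Id2 K (rm_cell m)\<rparr>"
  "\<lbrakk>is_relmod_mor K S f; is_relmod_mor K S g; ar_src g = ar_tgt f\<rbrakk> \<Longrightarrow>
    Cmp (RelMod K S) g f = \<lparr>ar_src = ar_src f, ar_tgt = ar_tgt g, ar_cell = VComp K (ar_cell g) (ar_cell f)\<rparr>"
  by (simp_all add: RelMod_def make_cat_simps)

lemma T_map1_simps:
  "fdom (T_map1 K x) = RelMod K (t1_src x)" "fcod (T_map1 K x) = RelMod K (t1_tgt x)"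
  "is_relmod K (t1_src x) m \<Longrightarrow> fob (T_map1 K x) m = act_relmod K x m"
  "is_relmod_mor K (t1_src x) f \<Longrightarrow> far (T_map1 K x) f =
    \<lparr>ar_src = act_relmod K x (ar_src f), ar_tgt = act_relmod K x (ar_tgt f),
     ar_cell = lwhisk K (t1_cell x) (ar_cell f)\<rparr>"
  by (simp_all add: T_map1_def RelMod_simps)

lemma T_map2_simps:
  "ndom (T_map2 K z) = T_map1 K (ar_src z)" "ncod (T_map2 K z) = T_map1 K (ar_tgt z)"
  "is_relmod K (t1_src (ar_src z)) m \<Longrightarrow> nmap (T_map2 K z) m =
    \<lparr>ar_src = act_relmod K (ar_src z) m, ar_tgt = act_relmod K (ar_tgt z) m,
     ar_cell = rwhisk K (ar_cell z) (rm_cell m)\<rparr>"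
  by (simp_all add: T_map2_def RelMod_simps)

lemma rm_cell_act_relmod: "rm_cell (act_relmod K x m) = Comp1 K (t1_cell x) (rm_cell m)"
  by (simp add: act_relmod_def Let_def)

context two_category
begin

lemma mixed_0cell_trivial: "a \<in> Cell0 K \<Longrightarrow> mixed_0cell K (trivial_tambara K a)"
  by (simp add: mixed_0cell_def trivial_tambara_def Let_def is_comonad_def is_monad_def hom1_def hom2_def paste_simps)

lemma relmod_cells:
  assumes "is_relmod K S m"
  shows "rm_cell m \<in> Cell1 K" "Tgt1 K (rm_cell m) = bi_base (tb_F S)"
    "rm_coact m \<in> Cell2 K" "Src2 K (rm_coact m) = rm_cell m" "Tgt2 K (rm_coact m) = bi_cell (tb_F S) \<cdot> rm_cell m"
    "rm_act m \<in> Cell2 K" "Src2 K (rm_act m) = mnd_cell (tb_B S) \<cdot> rm_cell m" "Tgt2 K (rm_act m) = rm_cell m"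
  using assms by (auto simp: is_relmod_def is_left_comodule_def is_left_module_def Let_def hom2_def)

lemma relmod_mor_cells:
  assumes "is_relmod_mor K S f"
  shows "is_relmod K S (ar_src f)" "is_relmod K S (ar_tgt f)" "ar_cell f \<in> Cell2 K"
    "Src2 K (ar_cell f) = rm_cell (ar_src f)" "Tgt2 K (ar_cell f) = rm_cell (ar_tgt f)"
    "Src1 K (rm_cell (ar_tgt f)) = Src1 K (rm_cell (ar_src f))"
  using assms cell2_parallel[of "ar_cell f"] by (auto simp: is_relmod_mor_def Let_def hom2_def)

text \<open>When the factors \<open>I\<close> and the identity 2-cells are cancelled, the comonad
  1-cell laws become coassociativity and counit, the monad 1-cell laws become associativity and
  unit, and the hexagon becomes the compatibility of coaction and action. The trivial structure sits
  on the source of \<open>M\<close>, which varies with \<open>m\<close>.\<close>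

lemma relmod_iff:
  assumes S: "mixed_0cell K S"
  shows "is_relmod K S m \<longleftrightarrow> rm_cell m \<in> Cell1 K \<and>
    mixed_1cell K (trivial_tambara K (Src1 K (rm_cell m))) S (rm_cell m) (rm_coact m) (rm_act m)"
proof -
  let ?M = "rm_cell m" and ?l = "rm_coact m" and ?n = "rm_act m"
  \<comment> \<open>Cancelling units is conditional on typing. Each side is therefore first shown to
    imply \<open>?typed\<close>, and the equivalence is computed under it.\<close>
  let ?typed = "?M \<in> Cell1 K \<and> Tgt1 K ?M = bi_base (tb_F S) \<and> ?l \<in> hom2 K ?M (bi_cell (tb_F S) \<cdot> ?M) \<and>
    ?n \<in> hom2 K (mnd_cell (tb_B S) \<cdot> ?M) ?M"
  have [simp]: "bi_base (tb_F S) \<in> Cell0 K" "bi_cell (tb_F S) \<in> Cell1 K" "mnd_cell (tb_B S) \<in> Cell1 K"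
    "Src1 K (bi_cell (tb_F S)) = bi_base (tb_F S)" "Tgt1 K (bi_cell (tb_F S)) = bi_base (tb_F S)"
    "Src1 K (mnd_cell (tb_B S)) = bi_base (tb_F S)" "Tgt1 K (mnd_cell (tb_B S)) = bi_base (tb_F S)"
    "tb_psi S \<in> Cell2 K" "Src2 K (tb_psi S) = mnd_cell (tb_B S) \<cdot> bi_cell (tb_F S)"
    "Tgt2 K (tb_psi S) = bi_cell (tb_F S) \<cdot> mnd_cell (tb_B S)" "mnd_base (tb_B S) = bi_base (tb_F S)"
    using mixed_0cell_cells[OF S] by (auto simp: hom1_def hom2_def)
  have ends: "Src1 K ?M \<in> Cell0 K" if "?M \<in> Cell1 K"
    using cell1_ends[OF that] by simp
  have "is_relmod K S m \<longleftrightarrow> mixed_1cell K (trivial_tambara K (Src1 K ?M)) S ?M ?l ?n" if ?typed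
    using that ends
    by (auto simp: is_relmod_def is_left_comodule_def is_left_module_def mixed_1cell_def comnd_1cell_def
        mnd_1cell_def trivial_tambara_def Let_def hom1_def hom2_def paste_simps)
  moreover have ?typed if "is_relmod K S m"
    using that by (auto simp: is_relmod_def is_left_comodule_def is_left_module_def Let_def)
  moreover have ?typed
    if "?M \<in> Cell1 K" "mixed_1cell K (trivial_tambara K (Src1 K ?M)) S ?M ?l ?n"
    using that ends by (auto simp: mixed_1cell_def comnd_1cell_def mnd_1cell_def trivial_tambara_def Let_def
        hom1_def comp1_id_eq)
  ultimately show ?thesis
    by blast
qed

text \<open>A 2-cell joins parallel 1-cells, so both modules start at the same 0-cell, and the
  trivial structure taken from the source module serves the target as well.\<close>

lemma relmod_mor_iff:
  assumes S: "mixed_0cell K S"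
  shows "is_relmod_mor K S f \<longleftrightarrow> is_relmod K S (ar_src f) \<and> is_relmod K S (ar_tgt f) \<and>
    mixed_2cell K (trivial_tambara K (Src1 K (rm_cell (ar_src f)))) S
      (rm_cell (ar_src f)) (rm_coact (ar_src f)) (rm_act (ar_src f))
      (rm_cell (ar_tgt f)) (rm_coact (ar_tgt f)) (rm_act (ar_tgt f)) (ar_cell f)"
proof (cases "is_relmod K S (ar_src f) \<and> is_relmod K S (ar_tgt f) \<and>
    ar_cell f \<in> hom2 K (rm_cell (ar_src f)) (rm_cell (ar_tgt f))")
  case True
  then have "Src1 K (rm_cell (ar_src f)) \<in> Cell0 K" "Src1 K (rm_cell (ar_tgt f)) = Src1 K (rm_cell (ar_src f))"
    using cell1_ends relmod_cells cell2_parallel[of "ar_cell f"] by (auto simp: hom2_def)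
  then show ?thesis
    using True by (auto simp: is_relmod_mor_def mixed_2cell_def comnd_2cell_def mnd_2cell_def
        trivial_tambara_def Let_def hom2_def relmod_cells paste_simps)
next
  case False
  then show ?thesis
    by (auto simp: is_relmod_mor_def mixed_2cell_def mnd_2cell_def Let_def)
qed

lemma relmod_mor_id:
  assumes S: "is_tambara K S" and m: "is_relmod K S m"
  shows "is_relmod_mor K S \<lparr>ar_src = m, ar_tgt = m, ar_cell = Id2 K (rm_cell m)\<rparr>"
  using m mixed_2cell_id[OF mixed_0cell_trivial tambara_mixed_0cell[OF S]] cell1_ends
  by (auto simp: relmod_mor_iff[OF tambara_mixed_0cell[OF S]] relmod_iff[OF tambara_mixed_0cell[OF S]])

lemma relmod_mor_vcomp:
  assumes S: "is_tambara K S" and f: "is_relmod_mor K S f" and g: "is_relmod_mor K S g"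
    and fg: "ar_src g = ar_tgt f"
  shows "is_relmod_mor K S \<lparr>ar_src = ar_src f, ar_tgt = ar_tgt g, ar_cell = ar_cell g \<odot> ar_cell f\<rparr>"
proof -
  note S' = tambara_mixed_0cell[OF S]
  let ?m = "ar_src f" and ?n = "ar_tgt f" and ?p = "ar_tgt g"
  have src: "Src1 K (rm_cell ?n) = Src1 K (rm_cell ?m)" "Src1 K (rm_cell ?p) = Src1 K (rm_cell ?m)"
    using relmod_mor_cells[OF f] relmod_mor_cells[OF g] fg by simp_all
  have m: "is_relmod K S ?m" "is_relmod K S ?n" "is_relmod K S ?p"
    using relmod_mor_cells[OF f] relmod_mor_cells[OF g] by simp_all
  have "Src1 K (rm_cell ?m) \<in> Cell0 K"
    using cell1_ends relmod_cells m by blast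
  \<comment> \<open>By \<open>src\<close> all three modules are 1-cells out of one trivial
    structure, and composition in \<open>RelMod\<close> is vertical composition between
    them.\<close>
  from mixed_2cell_vcomp[OF mixed_0cell_trivial[OF this] S'] show ?thesis
    using f g m unfolding relmod_mor_iff[OF S'] relmod_iff[OF S'] fg src by (simp add: src) blast
qed

lemma category_RelMod:
  assumes "is_tambara K S"
  shows "category (RelMod K S)"
  unfolding RelMod_def
  by (rule category_make_cat)
    (auto simp: relmod_mor_cells relmod_mor_id[OF assms] relmod_mor_vcomp[OF assms] vcomp_id_eq vcomp_assoc'
      intro!: arrow.equality)

text \<open>The coaction and action of \<open>act_relmod\<close> are literally the structure cells
  that \<open>mixed_1cell_comp\<close> gives to the composite of \<open>x\<close> with
  \<open>m\<close>, viewed as a 1-cell out of the trivial structure.\<close>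

lemma act_relmod:
  assumes x: "is_tambara_1cell K x" and m: "is_relmod K (t1_src x) m"
  shows "is_relmod K (t1_tgt x) (act_relmod K x m)"
proof -
  note S = tambara_simps(15,16)[OF x, THEN tambara_mixed_0cell]
  have src: "Src1 K (t1_cell x \<cdot> rm_cell m) = Src1 K (rm_cell m)" "t1_cell x \<cdot> rm_cell m \<in> Cell1 K"
    using x relmod_cells[OF m] by (simp_all add: tambara_simps cell_simps)
  have "Src1 K (rm_cell m) \<in> Cell0 K"
    using cell1_ends relmod_cells m by blast
  from mixed_1cell_comp[OF mixed_0cell_trivial[OF this] S] show ?thesis
    using m x src unfolding relmod_iff[OF S(1)] relmod_iff[OF S(2)] tambara_1cell_iff
    by (simp add: act_relmod_def Let_def)
qed

text \<open>Horizontal composition out of the trivial structure. This one form covers the arrow part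
  of \<open>T_map1\<close> (\<open>z\<close> an identity), the components of \<open>T_map2\<close>
  (\<open>f\<close> an identity) and the arrow part of \<open>YD_action\<close>.\<close>

lemma act_relmod_mor:
  assumes z: "is_tambara_2cell K z" and f: "is_relmod_mor K (t1_src (ar_src z)) f"
  shows "is_relmod_mor K (t1_tgt (ar_src z)) \<lparr>ar_src = act_relmod K (ar_src z) (ar_src f),
    ar_tgt = act_relmod K (ar_tgt z) (ar_tgt f), ar_cell = ar_cell z \<star> ar_cell f\<rparr>"
proof -
  let ?x = "ar_src z" and ?y = "ar_tgt z" and ?m = "ar_src f" and ?n = "ar_tgt f"
  have x: "is_tambara_1cell K ?x" and y: "is_tambara_1cell K ?y"
    and xy: "t1_src ?y = t1_src ?x" "t1_tgt ?y = t1_tgt ?x"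
    using tambara_2cell_cells[OF z] by simp_all
  note S = tambara_simps(15,16)[OF x, THEN tambara_mixed_0cell]
  have m: "is_relmod K (t1_src ?x) ?m" "is_relmod K (t1_src ?x) ?n"
    "Src1 K (rm_cell ?n) = Src1 K (rm_cell ?m)"
    using relmod_mor_cells[OF f] by simp_all
  have act: "is_relmod K (t1_tgt ?x) (act_relmod K ?x ?m)" "is_relmod K (t1_tgt ?x) (act_relmod K ?y ?n)"
    using act_relmod[OF x m(1)] act_relmod[OF y] m xy by simp_all
  have src: "Src1 K (t1_cell ?x \<cdot> rm_cell ?m) = Src1 K (rm_cell ?m)"
    using x relmod_cells[OF m(1)] by (simp add: tambara_simps cell_simps)
  have "Src1 K (rm_cell ?m) \<in> Cell0 K"
    using cell1_ends relmod_cells m by blast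
  from mixed_2cell_hcomp[OF mixed_0cell_trivial[OF this] S] show ?thesis
    using act f m src z x y xy
    unfolding relmod_mor_iff[OF S(1)] relmod_mor_iff[OF S(2)] relmod_iff[OF S(1)] tambara_2cell_iff tambara_1cell_iff
    by (simp add: act_relmod_def Let_def)
qed

lemma lwhisk_relmod_mor:
  assumes x: "is_tambara_1cell K x" and f: "is_relmod_mor K (t1_src x) f" "ar_src f = m" "ar_tgt f = n"
  shows "is_relmod_mor K (t1_tgt x) \<lparr>ar_src = act_relmod K x m, ar_tgt = act_relmod K x n,
    ar_cell = t1_cell x \<rhd> ar_cell f\<rparr>"
  using act_relmod_mor[OF tambara_2cell_id[OF x], of f] f by auto

lemma rwhisk_relmod_mor:
  assumes z: "is_tambara_2cell K z" and m: "is_relmod K (t1_src (ar_src z)) m"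
  shows "is_relmod_mor K (t1_tgt (ar_src z)) \<lparr>ar_src = act_relmod K (ar_src z) m, ar_tgt = act_relmod K (ar_tgt z) m,
    ar_cell = ar_cell z \<lhd> rm_cell m\<rparr>"
  using act_relmod_mor[OF z relmod_mor_id[OF _ m]] z by (simp add: tambara_simps)

lemma act_relmod_id:
  assumes "is_tambara K S" "is_relmod K S m"
  shows "act_relmod K (tambara_id1 K S) m = m"
  using assms(1) relmod_cells[OF assms(2)]
  by (auto simp: act_relmod_def tambara_id1_def Let_def tambara_simps paste_simps intro!: relmod.equality)

text \<open>Associativity of \<open>K\<close> is strict, so carrier, coaction and action of both
  modules have the same normal form. The resulting equality, not just an isomorphism, makes
  \<open>T_fun\<close> and the action strict.\<close>

lemma act_relmod_comp:
  assumes "is_tambara_1cell K x" "is_tambara_1cell K y" "t1_src y = t1_tgt x" "is_relmod K (t1_src x) m"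
  shows "act_relmod K (tambara_comp1 K y x) m = act_relmod K y (act_relmod K x m)"
  using assms(1-3) relmod_cells[OF assms(4)]
  by (simp add: act_relmod_def tambara_comp1_def Let_def tambara_simps paste_simps)

lemma is_functor_T_map1:
  assumes x: "is_tambara_1cell K x"
  shows "is_functor (T_map1 K x)"
proof (rule is_functor.intro)
  show "fob (T_map1 K x) \<in> extensional (Obj (fdom (T_map1 K x)))"
    "far (T_map1 K x) \<in> extensional (Arr (fdom (T_map1 K x)))"
    by (simp_all add: T_map1_def)
\<comment> \<open>The left side of \<open>relmod_cells(2)\<close> does not determine the structure
  \<open>S\<close> on its right side, hence the explicit instance.\<close>
qed (use x in \<open>auto simp: T_map1_simps RelMod_simps Hom_def category_RelMod tambara_simps(15,16) act_relmod
    lwhisk_relmod_mor relmod_mor_id relmod_mor_vcomp rm_cell_act_relmod tambara_1cell_cells(3-5) relmod_cells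
    relmod_cells(2)[where S = "t1_src x"] relmod_mor_cells hcomp_id2' lwhisk_vcomp\<close>)

lemma is_natural_T_map2:
  assumes z: "is_tambara_2cell K z"
  shows "is_natural (T_map2 K z)"
proof (rule is_natural.intro)
  show "nmap (T_map2 K z) \<in> extensional (Obj (fdom (ndom (T_map2 K z))))"
    by (simp add: T_map2_def T_map1_simps)
  show "Cmp (fcod (ndom (T_map2 K z))) (nmap (T_map2 K z) n) (far (ndom (T_map2 K z)) f) =
    Cmp (fcod (ndom (T_map2 K z))) (far (ncod (T_map2 K z)) f) (nmap (T_map2 K z) m)"
    if "f \<in> Hom (fdom (ndom (T_map2 K z))) m n" for f m n
  proof -
    let ?S = "t1_src (ar_src z)"
    have f: "is_relmod_mor K ?S f" "ar_src f = m" "ar_tgt f = n"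
      using that by (auto simp: Hom_def T_map2_simps T_map1_simps RelMod_simps)
    note fs = relmod_mor_cells[OF f(1), unfolded f]
    note zs = tambara_2cell_cells[OF z]
    \<comment> \<open>The naturality square is the exchange of the independent 2-cells
      \<open>ar_cell z\<close> and \<open>ar_cell f\<close>.\<close>
    have "(ar_cell z \<lhd> rm_cell n) \<odot> (t1_cell (ar_src z) \<rhd> ar_cell f) =
      (t1_cell (ar_tgt z) \<rhd> ar_cell f) \<odot> (ar_cell z \<lhd> rm_cell m)"
      using fs zs relmod_cells[OF fs(1)] by (intro whisk_swap) (auto simp: hom2_def tambara_1cell_cells)
    then show ?thesis
      using f fs zs lwhisk_relmod_mor[of "ar_src z" f] lwhisk_relmod_mor[of "ar_tgt z" f]
        rwhisk_relmod_mor[OF z, of m] rwhisk_relmod_mor[OF z, of n]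
      by (simp add: T_map2_simps T_map1_simps RelMod_simps)
  qed
qed (use z in \<open>auto simp: T_map2_simps T_map1_simps RelMod_simps Hom_def is_functor_T_map1 tambara_2cell_cells
    rwhisk_relmod_mor\<close>)

end

lemma Tambara_simps:
  "Cell0 (Tambara_Bimnd K) = {S. is_tambara K S}" "Cell1 (Tambara_Bimnd K) = {x. is_tambara_1cell K x}"
  "Cell2 (Tambara_Bimnd K) = {z. is_tambara_2cell K z}" "Src1 (Tambara_Bimnd K) = t1_src"
  "Tgt1 (Tambara_Bimnd K) = t1_tgt" "Src2 (Tambara_Bimnd K) = ar_src" "Tgt2 (Tambara_Bimnd K) = ar_tgt"
  "Id1 (Tambara_Bimnd K) = tambara_id1 K" "Comp1 (Tambara_Bimnd K) = tambara_comp1 K"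
  "Id2 (Tambara_Bimnd K) x = \<lparr>ar_src = x, ar_tgt = x, ar_cell = Id2 K (t1_cell x)\<rparr>"
  "HComp (Tambara_Bimnd K) w z = \<lparr>ar_src = tambara_comp1 K (ar_src w) (ar_src z),
    ar_tgt = tambara_comp1 K (ar_tgt w) (ar_tgt z), ar_cell = HComp K (ar_cell w) (ar_cell z)\<rparr>"
  "VComp (Tambara_Bimnd K) w z = \<lparr>ar_src = ar_src z, ar_tgt = ar_tgt w, ar_cell = VComp K (ar_cell w) (ar_cell z)\<rparr>"
  by (simp_all add: Tambara_Bimnd_def)

lemma T_fun_simps: "On0 (T_fun K) = RelMod K" "On1 (T_fun K) = T_map1 K" "On2 (T_fun K) = T_map2 K"
  by (simp_all add: T_fun_def)

section \<open>Strict 2-functoriality of \<open>T_fun\<close>, and its transpose\<close>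

context two_category
begin

lemma T_map1_id:
  assumes S: "is_tambara K S"
  shows "T_map1 K (tambara_id1 K S) = id_ftor (RelMod K S)"
proof (rule ftor_eqI)
  show "is_functor (T_map1 K (tambara_id1 K S))"
    by (rule is_functor_T_map1) (rule tambara_1cell_id[OF S])
  show "is_functor (id_ftor (RelMod K S))"
    by (rule is_functor_id) (rule category_RelMod[OF S])
qed (auto simp: T_map1_simps id_ftor_simps RelMod_simps tambara_id1_simps act_relmod_id[OF S] relmod_mor_cells
    relmod_cells hcomp_id1_eq intro!: arrow.equality)

lemma T_map1_comp:
  assumes x: "is_tambara_1cell K x" and y: "is_tambara_1cell K y" and xy: "t1_src y = t1_tgt x"
  shows "T_map1 K (tambara_comp1 K y x) = comp_ftor (T_map1 K y) (T_map1 K x)"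
proof (rule ftor_eqI)
  show "is_functor (T_map1 K (tambara_comp1 K y x))"
    using assms by (simp add: is_functor_T_map1 tambara_1cell_comp)
  show "is_functor (comp_ftor (T_map1 K y) (T_map1 K x))"
    using assms by (simp add: is_functor_T_map1 is_functor_comp T_map1_simps)
qed (use assms in \<open>auto simp: T_map1_simps comp_ftor_simps RelMod_simps tambara_comp1_simps act_relmod_comp
    act_relmod lwhisk_relmod_mor relmod_mor_cells relmod_cells(2)[where S = "t1_src x"] tambara_1cell_cells
    lwhisk_lwhisk\<close>)

lemma T_map2_id:
  assumes x: "is_tambara_1cell K x"
  shows "T_map2 K \<lparr>ar_src = x, ar_tgt = x, ar_cell = Id2 K (t1_cell x)\<rparr> = id_ntrans (T_map1 K x)"
  using x
  by (intro ntrans_eqI)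
    (auto simp: is_natural_T_map2 is_natural_id is_functor_T_map1 tambara_2cell_id T_map2_simps T_map1_simps
      id_ntrans_simps RelMod_simps act_relmod rm_cell_act_relmod relmod_cells tambara_1cell_cells hcomp_id2')

lemma T_map2_vcomp:
  assumes z: "is_tambara_2cell K z" and w: "is_tambara_2cell K w" and zw: "ar_src w = ar_tgt z"
  shows "T_map2 K \<lparr>ar_src = ar_src z, ar_tgt = ar_tgt w, ar_cell = ar_cell w \<odot> ar_cell z\<rparr> =
    vcomp_ntrans (T_map2 K w) (T_map2 K z)"
proof (rule ntrans_eqI)
  show "is_natural (T_map2 K \<lparr>ar_src = ar_src z, ar_tgt = ar_tgt w, ar_cell = ar_cell w \<odot> ar_cell z\<rparr>)"
    using tambara_2cell_vcomp[OF assms] by (rule is_natural_T_map2)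
  show "is_natural (vcomp_ntrans (T_map2 K w) (T_map2 K z))"
    using assms by (simp add: is_natural_vcomp is_natural_T_map2 T_map2_simps)
next
  fix m
  assume "m \<in> Obj (fdom (ndom (vcomp_ntrans (T_map2 K w) (T_map2 K z))))"
  then have m: "is_relmod K (t1_src (ar_src z)) m"
    by (simp add: vcomp_ntrans_simps T_map2_simps T_map1_simps RelMod_simps)
  show "nmap (T_map2 K \<lparr>ar_src = ar_src z, ar_tgt = ar_tgt w, ar_cell = ar_cell w \<odot> ar_cell z\<rparr>) m =
    nmap (vcomp_ntrans (T_map2 K w) (T_map2 K z)) m"
    using m zw rwhisk_relmod_mor[OF z m] rwhisk_relmod_mor[OF w, of m] tambara_2cell_cells[OF z]
      tambara_2cell_cells[OF w] relmod_cells[OF m]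
    by (simp add: T_map2_simps T_map1_simps vcomp_ntrans_simps RelMod_simps tambara_1cell_cells rwhisk_vcomp)
qed (simp_all add: T_map2_simps vcomp_ntrans_simps)

lemma T_map2_hcomp:
  assumes z: "is_tambara_2cell K z" and w: "is_tambara_2cell K w" and zw: "t1_src (ar_src w) = t1_tgt (ar_src z)"
  shows "T_map2 K \<lparr>ar_src = tambara_comp1 K (ar_src w) (ar_src z), ar_tgt = tambara_comp1 K (ar_tgt w) (ar_tgt z),
    ar_cell = ar_cell w \<star> ar_cell z\<rparr> = hcomp_ntrans (T_map2 K w) (T_map2 K z)"
    (is "T_map2 K ?wz = _")
proof (rule ntrans_eqI)
  note zs = tambara_2cell_cells[OF z] and ws = tambara_2cell_cells[OF w]
  show "is_natural (T_map2 K ?wz)"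
    using tambara_2cell_hcomp[OF assms] by (rule is_natural_T_map2)
  show "is_natural (hcomp_ntrans (T_map2 K w) (T_map2 K z))"
    using assms by (simp add: is_natural_hcomp is_natural_T_map2 T_map2_simps T_map1_simps)
  show "ndom (T_map2 K ?wz) = ndom (hcomp_ntrans (T_map2 K w) (T_map2 K z))"
    "ncod (T_map2 K ?wz) = ncod (hcomp_ntrans (T_map2 K w) (T_map2 K z))"
    using zs ws zw by (simp_all add: T_map2_simps hcomp_ntrans_simps T_map1_comp)
  fix m
  assume "m \<in> Obj (fdom (ndom (hcomp_ntrans (T_map2 K w) (T_map2 K z))))"
  then have m: "is_relmod K (t1_src (ar_src z)) m"
    by (simp add: hcomp_ntrans_simps comp_ftor_simps T_map2_simps T_map1_simps RelMod_simps)
  have act: "is_relmod K (t1_tgt (ar_src z)) (act_relmod K (ar_tgt z) m)"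
    using act_relmod[OF zs(2), of m] m zs by simp
  \<comment> \<open>Composition in \<open>RelMod\<close> is \<open>undefined\<close> outside
    composable arrows, so both factors of the component in \<open>hcomp_ntrans\<close> have to be
    recognised as morphisms before it can be unfolded.\<close>
  have mors: "is_relmod_mor K (t1_tgt (ar_src w)) \<lparr>ar_src = act_relmod K (ar_src w) (act_relmod K (ar_tgt z) m),
      ar_tgt = act_relmod K (ar_tgt w) (act_relmod K (ar_tgt z) m),
      ar_cell = ar_cell w \<lhd> rm_cell (act_relmod K (ar_tgt z) m)\<rparr>"
    "is_relmod_mor K (t1_tgt (ar_src w)) \<lparr>ar_src = act_relmod K (ar_src w) (act_relmod K (ar_src z) m),
      ar_tgt = act_relmod K (ar_src w) (act_relmod K (ar_tgt z) m),
      ar_cell = t1_cell (ar_src w) \<rhd> (ar_cell z \<lhd> rm_cell m)\<rparr>"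
    using rwhisk_relmod_mor[OF w] lwhisk_relmod_mor[OF ws(1), OF _ refl refl] rwhisk_relmod_mor[OF z m] act zw
    by force+
  \<comment> \<open>\<open>hcomp_ntrans\<close> evaluates the second transformation at the target of
    the first; this matches the order in which \<open>hcomp_whisk(1)\<close> splits a horizontal
    composite.\<close>
  have "(ar_cell w \<star> ar_cell z) \<lhd> rm_cell m =
    (ar_cell w \<lhd> (t1_cell (ar_tgt z) \<cdot> rm_cell m)) \<odot> (t1_cell (ar_src w) \<rhd> (ar_cell z \<lhd> rm_cell m))"
    using zs ws zw relmod_cells[OF m] hcomp_whisk(1)[of "ar_cell z" "ar_cell w"]
    by (simp add: tambara_1cell_cells paste_simps)
  then show "nmap (T_map2 K ?wz) m = nmap (hcomp_ntrans (T_map2 K w) (T_map2 K z)) m"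
    using m zs ws zw act mors rwhisk_relmod_mor[OF z m]
    by (simp add: T_map2_simps T_map1_simps hcomp_ntrans_simps RelMod_simps tambara_comp1_simps
        act_relmod_comp rm_cell_act_relmod)
qed

theorem two_functor_T_fun: "two_functor (Tambara_Bimnd K) Cat (T_fun K)"
proof -
  have "two_functor_axioms (Tambara_Bimnd K) Cat (T_fun K)"
    by (rule two_functor_axioms.intro)
      (auto simp: Tambara_simps Cat_components T_fun_simps hom1_def hom2_def T_map1_simps T_map2_simps category_RelMod
        is_functor_T_map1 is_natural_T_map2 T_map1_id T_map1_comp T_map2_id T_map2_vcomp T_map2_hcomp)
  then show ?thesis
    using two_category_Tambara two_category_Cat by (simp add: two_functor_def)
qed

text \<open>On arrows, uncurrying applies the functor at the source of \<open>z\<close> to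
  \<open>f\<close> and then the component of \<open>z\<close> at the target of \<open>f\<close>.
  That is one of the two whiskered forms of \<open>ar_cell z \<star> ar_cell f\<close>.\<close>

lemma uncurry_T_fun:
  "uncurry_ftor (YD_strong K S) (RelMod K S) (endo_ftor (Tambara_Bimnd K) Cat (T_fun K) S) = YD_action K S"
proof -
  let ?V = "YD_strong K S" and ?P = "endo_ftor (Tambara_Bimnd K) Cat (T_fun K) S"
  have V: "Obj (under ?V) = {x. is_tambara_1cell K x \<and> t1_src x = S \<and> t1_tgt x = S}"
    "Arr (under ?V) = {z. is_tambara_2cell K z \<and> t1_src (ar_src z) = S \<and> t1_tgt (ar_src z) = S}"
    by (auto simp: YD_strong_def endo_moncat_simps Tambara_simps hom1_def tambara_2cell_cells)
  have P: "fob ?P x = T_map1 K x" if "x \<in> Obj (under ?V)" for x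
    using that by (simp add: endo_ftor_def YD_strong_def T_fun_simps)
  have ar: "Cmp (RelMod K S) (nmap (far ?P z) (Cod (RelMod K S) f)) (far (fob ?P (Dom (under ?V) z)) f) =
    \<lparr>ar_src = act_relmod K (ar_src z) (ar_src f), ar_tgt = act_relmod K (ar_tgt z) (ar_tgt f),
     ar_cell = ar_cell z \<star> ar_cell f\<rparr>" if "z \<in> Arr (under ?V)" "f \<in> Arr (RelMod K S)" for z f
  proof -
    have z: "is_tambara_2cell K z" "t1_src (ar_src z) = S" "t1_tgt (ar_src z) = S" and f: "is_relmod_mor K S f"
      using that by (simp_all add: V RelMod_simps)
    note zs = tambara_2cell_cells[OF z(1), unfolded z] and fs = relmod_mor_cells[OF f]
    have "far ?P z = T_map2 K z" "Dom (under ?V) z = ar_src z"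
      using that zs z by (simp_all add: endo_ftor_def YD_strong_def T_fun_simps endo_moncat_simps Tambara_simps hom1_def)
    moreover have "fob ?P (ar_src z) = T_map1 K (ar_src z)"
      using zs z by (intro P) (simp add: V)
    moreover have "ar_cell z \<star> ar_cell f = (ar_cell z \<lhd> rm_cell (ar_tgt f)) \<odot> (t1_cell (ar_src z) \<rhd> ar_cell f)"
      using hcomp_whisk(1)[of "ar_cell f" "ar_cell z"] zs z fs relmod_cells[OF fs(1)] by (simp add: tambara_1cell_cells)
    ultimately show ?thesis
      using z f zs fs rwhisk_relmod_mor[OF z(1), of "ar_tgt f"] lwhisk_relmod_mor[OF zs(1), of f]
      by (simp add: T_map1_simps T_map2_simps RelMod_simps)
  qed
  show ?thesis
    unfolding uncurry_ftor_def YD_action_def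
    by (auto simp: ar fun_eq_iff restrict_def P V(1) T_map1_simps RelMod_simps(1))
qed

end

theorem theorem8p1:
  fixes K :: "('o, 'm, 'c) twocat"
  assumes "two_category K"
  shows "two_functor (Tambara_Bimnd K) Cat (T_fun K) \<and>
    (\<forall>S \<in> Cell0 (Tambara_Bimnd K).
      strict_monoidal_functor (YD_strong K S) (Fun (RelMod K S))
        (endo_ftor (Tambara_Bimnd K) Cat (T_fun K) S) \<and>
      strict_action (YD_strong K S) (RelMod K S) (YD_action K S) \<and>
      uncurry_ftor (YD_strong K S) (RelMod K S) (endo_ftor (Tambara_Bimnd K) Cat (T_fun K) S)
        = YD_action K S \<and>
      curry_ftor (YD_strong K S) (RelMod K S) (YD_action K S)
        = endo_ftor (Tambara_Bimnd K) Cat (T_fun K) S)"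
proof (intro conjI ballI)
  interpret two_category K by (rule assms)
  show T: "two_functor (Tambara_Bimnd K) Cat (T_fun K)"
    by (rule two_functor_T_fun)
  fix S
  assume S: "S \<in> Cell0 (Tambara_Bimnd K)"
  have C: "category (RelMod K S)"
    using S by (simp add: Tambara_simps category_RelMod)
  show P: "strict_monoidal_functor (YD_strong K S) (Fun (RelMod K S)) (endo_ftor (Tambara_Bimnd K) Cat (T_fun K) S)"
    using two_functor.strict_monoidal_functor_endo[OF T S] by (simp add: YD_strong_def Fun_def T_fun_simps)
  show U: "uncurry_ftor (YD_strong K S) (RelMod K S) (endo_ftor (Tambara_Bimnd K) Cat (T_fun K) S) = YD_action K S"
    by (rule uncurry_T_fun)
  \<comment> \<open>By \<open>U\<close> the functor \<open>YD_action\<close> is the transpose of the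
    strict monoidal functor in \<open>P\<close>. The action laws and the converse currying are
    thereby inherited from the general lemmas instead of being verified on modules.\<close>
  show "strict_action (YD_strong K S) (RelMod K S) (YD_action K S)"
    using strict_action_uncurry[OF P C] by (simp add: U)
  show "curry_ftor (YD_strong K S) (RelMod K S) (YD_action K S) = endo_ftor (Tambara_Bimnd K) Cat (T_fun K) S"
    using curry_uncurry_ftor[OF P C] by (simp add: U)
qed

end
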